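(* Let $\sigma=\{\sigma_i\mid i\in I\}$ be a partition of the set of all primes. If a finite group $G$ is a $\sigma$-soluble $P\sigma T$-group, then every quotient and every subgroup of $G$ are $P\sigma T$-groups.
   Context: All groups are finite. For an integer $n$, $\pi(n)$ is the set of primes dividing $n$. $\sigma=\{\sigma_i\mid i\in I\}$ is a partition of the set of all primes, $\sigma(n)=\{\sigma_i\mid \sigma_i\cap\pi(n)\neq\emptyset\}$ and $\sigma(G)=\sigma(|G|)$. A group is $\sigma$-primary if it is a $\sigma_i$-group (all primes dividing its order lie in $\sigma_i$) for some $i$. $G$ is $\sigma$-soluble if every chief factor of $G$ is $\sigma$-primary. A complete Hall $\sigma$-set of $G$ is a set $\mathcal{H}$ of subgroups of $G$ such that every member $\neq 1$ of $\mathcal{H}$ is a Hall $\sigma_i$-subgroup of $G$ for some $\sigma_i\in\sigma$ and $\mathcal{H}$ contains exactly one Hall $\sigma_i$-subgroup of $G$ for every $\sigma_i\in\sigma(G)$. A subgroup $A$ of $G$ is $\sigma$-permutable in $G$ if $G$ possesses a complete Hall $\sigma$-set and $AH=HA$ for every Hall $\sigma_i$-subgroup $H$ of $G$ and all $i\in I$. $G$ is a $P\sigma T$-group if whenever $K$ is a $\sigma$-permutable subgroup of $H$ and $H$ is a $\sigma$-permutable subgroup of $G$, then $K$ is a $\sigma$-permutable subgroup of $G$. *)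

theory Defs
  imports "HOL-Algebra.Coset" "HOL-Library.Disjoint_Sets" "HOL-Computational_Algebra.Primes"
begin

text \<open>
  Throughout, \<open>\<sigma>\<close> is the set of blocks \<open>{\<sigma>\<^sub>i | i \<in> I}\<close> of a partition of the primes; a block
  \<open>\<pi> \<in> \<sigma>\<close> plays the role of \<open>\<sigma>\<^sub>i\<close>. The definitions are meant for finite groups, since \<^const>\<open>order\<close>
  and \<^const>\<open>card\<close> are \<open>0\<close> on infinite sets. A subgroup \<open>H\<close> of \<open>G\<close>, regarded as a group,
  is \<open>G\<lparr>carrier := H\<rparr>\<close>.
\<close>

definition prime_divisors :: "nat \<Rightarrow> nat set" where
  "prime_divisors n = {p. Factorial_Ring.prime p \<and> p dvd n}"

definition sigma_of :: "nat set set \<Rightarrow> nat \<Rightarrow> nat set set" where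
  "sigma_of \<sigma> n = {\<pi> \<in> \<sigma>. \<pi> \<inter> prime_divisors n \<noteq> {}}"

definition pi_group :: "nat set \<Rightarrow> ('a, 'b) monoid_scheme \<Rightarrow> bool" where
  "pi_group \<pi> G \<longleftrightarrow> prime_divisors (order G) \<subseteq> \<pi>"

definition sigma_primary :: "nat set set \<Rightarrow> ('a, 'b) monoid_scheme \<Rightarrow> bool" where
  "sigma_primary \<sigma> G \<longleftrightarrow> (\<exists>\<pi>\<in>\<sigma>. pi_group \<pi> G)"

definition minimal_normal_subgroup :: "'a set \<Rightarrow> ('a, 'b) monoid_scheme \<Rightarrow> bool" where
  "minimal_normal_subgroup N G \<longleftrightarrow>
     N \<lhd> G \<and> N \<noteq> {\<one>\<^bsub>G\<^esub>} \<and> (\<forall>M. M \<lhd> G \<and> M \<subseteq> N \<longrightarrow> M = {\<one>\<^bsub>G\<^esub>} \<or> M = N)"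

text \<open>\<open>H/K\<close> is a chief factor of \<open>G\<close>.\<close>

definition chief_factor :: "'a set \<Rightarrow> 'a set \<Rightarrow> ('a, 'b) monoid_scheme \<Rightarrow> bool" where
  "chief_factor H K G \<longleftrightarrow> H \<lhd> G \<and> K \<lhd> G \<and> K \<subseteq> H \<and>
     minimal_normal_subgroup (carrier (G\<lparr>carrier := H\<rparr> Mod K)) (G Mod K)"

definition sigma_soluble :: "nat set set \<Rightarrow> ('a, 'b) monoid_scheme \<Rightarrow> bool" where
  "sigma_soluble \<sigma> G \<longleftrightarrow>
     (\<forall>H K. chief_factor H K G \<longrightarrow> sigma_primary \<sigma> (G\<lparr>carrier := H\<rparr> Mod K))"

definition Hall_subgroup :: "nat set \<Rightarrow> 'a set \<Rightarrow> ('a, 'b) monoid_scheme \<Rightarrow> bool" where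
  "Hall_subgroup \<pi> H G \<longleftrightarrow> subgroup H G \<and> pi_group \<pi> (G\<lparr>carrier := H\<rparr>) \<and>
     prime_divisors (card (rcosets\<^bsub>G\<^esub> H)) \<inter> \<pi> = {}"

definition complete_Hall_set ::
    "nat set set \<Rightarrow> 'a set set \<Rightarrow> ('a, 'b) monoid_scheme \<Rightarrow> bool" where
  "complete_Hall_set \<sigma> \<H> G \<longleftrightarrow>
     (\<forall>H\<in>\<H>. subgroup H G) \<and>
     (\<forall>H\<in>\<H>. H \<noteq> {\<one>\<^bsub>G\<^esub>} \<longrightarrow> (\<exists>\<pi>\<in>\<sigma>. Hall_subgroup \<pi> H G)) \<and>
     (\<forall>\<pi>\<in>sigma_of \<sigma> (order G). \<exists>!H. H \<in> \<H> \<and> Hall_subgroup \<pi> H G)"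

definition sigma_permutable :: "nat set set \<Rightarrow> 'a set \<Rightarrow> ('a, 'b) monoid_scheme \<Rightarrow> bool" where
  "sigma_permutable \<sigma> A G \<longleftrightarrow> subgroup A G \<and> (\<exists>\<H>. complete_Hall_set \<sigma> \<H> G) \<and>
     (\<forall>\<pi>\<in>\<sigma>. \<forall>H. Hall_subgroup \<pi> H G \<longrightarrow> A <#>\<^bsub>G\<^esub> H = H <#>\<^bsub>G\<^esub> A)"

definition PsigmaT_group :: "nat set set \<Rightarrow> ('a, 'b) monoid_scheme \<Rightarrow> bool" where
  "PsigmaT_group \<sigma> G \<longleftrightarrow>
     (\<forall>H K. sigma_permutable \<sigma> K (G\<lparr>carrier := H\<rparr>) \<and> sigma_permutable \<sigma> H G
        \<longrightarrow> sigma_permutable \<sigma> K G)"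

end

theory Submission
  imports Defs "HOL-Algebra.Sylow" "HOL-Algebra.Group_Action" "HOL-Number_Theory.Residues"
begin

text \<open>
  The definition of a \<open>P\<sigma>T\<close>-group gives no direct hold on subgroups that are not \<open>\<sigma>\<close>-permutable. The
  proof replaces it by a condition on normal sections that is visibly hereditary. Call \<open>G\<close>, all of
  whose chief factors are \<open>\<sigma>\<close>-primary, a power group (\<open>sigma_power\<close>) if for all \<open>\<pi> \<in> \<sigma>\<close> and all normal
  subgroups \<open>N \<subseteq> M\<close> with \<open>M/N\<close> a \<open>\<pi>\<close>-group some normal subgroup \<open>R\<close> with \<open>G/R\<close> a \<open>\<pi>\<close>-group normalizes
  every subgroup \<open>Q\<close> between \<open>N\<close> and \<open>M\<close>; thus \<open>R\<close>, which contains all \<open>\<pi>'\<close>-subgroups, induces power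
  automorphisms on \<open>M/N\<close>. This condition passes to quotients (\<open>sigma_power_epi\<close>), and for a
  subgroup \<open>X\<close> one works with the subgroups \<open>N \<inter> X\<close>, where \<open>N\<close> is normal in \<open>G\<close>.

  A \<open>\<sigma>\<close>-soluble \<open>P\<sigma>T\<close>-group is a power group (\<open>PsigmaT_sigma_power\<close>): each \<open>Q\<close> as above is
  \<open>\<sigma>\<close>-permutable in \<open>M\<close>, and \<open>M\<close> is normal, so \<open>Q\<close> is \<open>\<sigma>\<close>-permutable in \<open>G\<close>. For a Hall
  \<open>\<tau>\<close>-subgroup \<open>H\<close> with \<open>\<tau> \<noteq> \<pi>\<close>, the group \<open>QH\<close> meets \<open>M\<close> in \<open>Q\<close>, hence \<open>H\<close> normalizes \<open>Q\<close>; and the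
  elements that normalize all \<open>Q\<close> form a normal subgroup.

  Conversely every subgroup \<open>X\<close> of a power group \<open>G\<close> is a \<open>P\<sigma>T\<close>-group (\<open>sigma_power_PsigmaT\<close>).
  The structural reason (\<open>sigma_power_structure\<close>) is that for each \<open>\<pi>\<close> there are normal subgroups
  \<open>Z \<subseteq> S\<close> of \<open>G\<close> such that \<open>Z\<close> and \<open>G/S\<close> are \<open>\<pi>'\<close>-groups and \<open>S/Z\<close> is a \<open>\<pi>\<close>-group: modulo the
  largest normal \<open>\<pi>'\<close>-subgroup, the Hall \<open>\<pi>\<close>-subgroups are normal. It rests on the fact that a power
  automorphism of a finite group raises all elements of a given prime order \<open>p\<close> to the same power,
  so that coprime power automorphisms are central. Now let \<open>K\<close> be \<open>\<sigma>\<close>-permutable in \<open>L\<close> and \<open>L\<close> in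
  \<open>X\<close>, and let \<open>H\<close> be a Hall \<open>\<pi>\<close>-subgroup of \<open>X\<close>. Then \<open>K \<inter> T\<close> is a Hall subgroup of \<open>K\<close> for each
  Hall \<open>\<tau>\<close>-subgroup \<open>T\<close> of \<open>X\<close>, and these intersections generate \<open>K\<close>. For every \<open>\<tau>\<close> one \<open>T\<close>
  can be chosen such that \<open>W = TH\<close> is a group, namely a Hall \<open>{\<pi>,\<tau>}\<close>-subgroup; the structure
  theorem for \<open>\<tau>\<close> shows that \<open>H\<close> normalizes \<open>(K \<inter> T)(Z \<inter> W)\<close> and contains \<open>Z \<inter> W\<close>, so \<open>H\<close> permutes with
  \<open>K \<inter> T\<close>, and therefore with \<open>K\<close>.

  Existence of Hall subgroups comes from the Schur-Zassenhaus theorem. Their conjugacy, used to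
  find \<open>T\<close>, does not appeal to the solubility of groups of odd order: a group inducing coprime power
  automorphisms on a section can be treated by splitting the section into factors that are
  abelian or centralized (\<open>coprime_power_conjugate\<close>).
\<close>

section \<open>Prime divisors and indices\<close>

definition idx :: "'a set \<Rightarrow> 'a set \<Rightarrow> nat" where
  "idx A B = card A div card B"

lemma prime_divisors_mult:
  "prime_divisors (m * n) = prime_divisors m \<union> prime_divisors n"
  by (auto simp: prime_divisors_def prime_dvd_mult_iff)

lemma prime_divisors_mono: "m dvd n \<Longrightarrow> prime_divisors m \<subseteq> prime_divisors n"
  by (auto simp: prime_divisors_def intro: dvd_trans)

lemma prime_divisors_1 [simp]: "prime_divisors (Suc 0) = {}"
  by (auto simp: prime_divisors_def)

lemma coprime_iff_prime_divisors:
  "coprime m n \<longleftrightarrow> prime_divisors m \<inter> prime_divisors n = {}"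
proof
  assume c: "coprime m n"
  show "prime_divisors m \<inter> prime_divisors n = {}"
  proof (rule ccontr)
    assume "prime_divisors m \<inter> prime_divisors n \<noteq> {}"
    then obtain p where p: "Factorial_Ring.prime p" "p dvd m" "p dvd n"
      by (auto simp: prime_divisors_def)
    from c p(2,3) have "is_unit p" by (rule coprime_common_divisor)
    with p(1) show False using not_prime_unit by blast
  qed
next
  assume d: "prime_divisors m \<inter> prime_divisors n = {}"
  show "coprime m n"
  proof (rule ccontr)
    assume "\<not> coprime m n"
    hence "gcd m n \<noteq> 1" by (simp add: coprime_iff_gcd_eq_1)
    then obtain p where "Factorial_Ring.prime p" "p dvd gcd m n" using prime_factor_nat by blast
    with d show False by (auto simp: prime_divisors_def)
  qed
qed

lemma coprime_of_disjoint:
  assumes "prime_divisors m \<subseteq> \<pi>" "prime_divisors n \<inter> \<pi> = {}"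
  shows "coprime m n" "coprime n m"
  using assms by (auto simp: coprime_iff_prime_divisors)

lemma prime_divisors_empty_imp: "n \<noteq> 0 \<Longrightarrow> prime_divisors n = {} \<Longrightarrow> n = 1"
  using prime_factor_nat[of n] by (auto simp: prime_divisors_def)

section \<open>Subgroups of a finite group\<close>

locale finite_group = group +
  assumes finite_carrier [simp, intro]: "finite (carrier G)"
begin

definition cnj :: "'a \<Rightarrow> 'a \<Rightarrow> 'a" where
  "cnj g x = g \<otimes> x \<otimes> inv g"

definition normalizes :: "'a set \<Rightarrow> 'a set \<Rightarrow> bool" where
  "normalizes A B \<longleftrightarrow> (\<forall>a\<in>A. \<forall>b\<in>B. cnj a b \<in> B)"

lemma normalizesD: "normalizes A B \<Longrightarrow> a \<in> A \<Longrightarrow> b \<in> B \<Longrightarrow> a \<otimes> b \<otimes> inv a \<in> B"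
  by (simp add: normalizes_def cnj_def)

lemma normalizes_mono: "normalizes A B \<Longrightarrow> A' \<subseteq> A \<Longrightarrow> normalizes A' B"
  by (auto simp: normalizes_def)

lemma normalizes_Int: "normalizes A B \<Longrightarrow> normalizes A C \<Longrightarrow> normalizes A (B \<inter> C)"
  by (auto simp: normalizes_def)

lemma sub_carrier: "subgroup H G \<Longrightarrow> x \<in> H \<Longrightarrow> x \<in> carrier G"
  by (rule subgroup.mem_carrier)

lemma inv_cancel_left [simp]:
  "x \<in> carrier G \<Longrightarrow> y \<in> carrier G \<Longrightarrow> inv x \<otimes> (x \<otimes> y) = y"
  "x \<in> carrier G \<Longrightarrow> y \<in> carrier G \<Longrightarrow> x \<otimes> (inv x \<otimes> y) = y"
  by (simp_all flip: m_assoc)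

lemmas group_word = m_assoc inv_mult_group

lemma normalizes_self: "subgroup H G \<Longrightarrow> normalizes H H"
  by (auto simp: normalizes_def cnj_def subgroup.m_closed subgroup.m_inv_closed)

lemma normal_iff_normalizes: "N \<lhd> G \<longleftrightarrow> subgroup N G \<and> normalizes (carrier G) N"
  by (auto simp: normal_inv_iff normalizes_def cnj_def)

lemma subgroup_finite: "subgroup H G \<Longrightarrow> finite H"
  by (meson finite_carrier finite_subset subgroup.subset)

lemma card_pos: "subgroup H G \<Longrightarrow> card H > 0"
  by (metis card_gt_0_iff subgroup_finite subgroup.one_closed empty_iff)

lemma card_dvd: "subgroup A G \<Longrightarrow> subgroup B G \<Longrightarrow> A \<subseteq> B \<Longrightarrow> card A dvd card B"
proof -
  assume *: "subgroup A G" "subgroup B G" "A \<subseteq> B"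
  interpret B: group "G\<lparr>carrier := B\<rparr>" by (rule subgroup_imp_group[OF *(2)])
  have "subgroup A (G\<lparr>carrier := B\<rparr>)" using * by (simp add: subgroup_incl)
  have "card (rcosets\<^bsub>G\<lparr>carrier := B\<rparr>\<^esub> A) * card A = card B"
    using B.lagrange[OF \<open>subgroup A (G\<lparr>carrier := B\<rparr>)\<close>] by (simp add: order_def)
  thus ?thesis by (metis dvd_triv_right)
qed

lemma idx_mult: "subgroup A G \<Longrightarrow> subgroup B G \<Longrightarrow> A \<subseteq> B \<Longrightarrow> idx B A * card A = card B"
  unfolding idx_def using card_dvd by simp

lemma idx_pos: "subgroup A G \<Longrightarrow> subgroup B G \<Longrightarrow> A \<subseteq> B \<Longrightarrow> idx B A > 0"
  by (metis card_pos idx_mult mult_is_0 not_gr_zero)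

lemma idx_chain:
  "subgroup A G \<Longrightarrow> subgroup B G \<Longrightarrow> subgroup C G \<Longrightarrow> A \<subseteq> B \<Longrightarrow> B \<subseteq> C \<Longrightarrow>
   idx C B * idx B A = idx C A"
proof -
  assume a: "subgroup A G" "subgroup B G" "subgroup C G" "A \<subseteq> B" "B \<subseteq> C"
  have "idx C B * idx B A * card A = idx C A * card A"
    using idx_mult[of A B] idx_mult[of B C] idx_mult[of A C] a by (simp add: mult.assoc)
  thus ?thesis using card_pos[OF a(1)] by simp
qed

lemma idx_eq_1: "subgroup A G \<Longrightarrow> subgroup B G \<Longrightarrow> A \<subseteq> B \<Longrightarrow> idx B A = 1 \<Longrightarrow> A = B"
  using idx_mult[of A B] by (metis card_subset_eq nat_mult_1 subgroup_finite)

lemma idx_one [simp]: "idx H {\<one>} = card H"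
  by (simp add: idx_def)

lemma idx_self: "subgroup H G \<Longrightarrow> idx H H = 1"
  unfolding idx_def using card_pos by (metis div_self less_not_refl)

lemma subgroup_one [simp]: "subgroup {\<one>} G"
  by (rule triv_subgroup)

lemma subgroup_Int: "subgroup A G \<Longrightarrow> subgroup B G \<Longrightarrow> subgroup (A \<inter> B) G"
  by (rule subgroups_Inter_pair)

lemma set_multI: "a \<in> A \<Longrightarrow> b \<in> B \<Longrightarrow> a \<otimes> b \<in> A <#> B"
  by (auto simp: set_mult_def)

lemma set_multE:
  assumes "x \<in> A <#> B" obtains a b where "a \<in> A" "b \<in> B" "x = a \<otimes> b"
  using assms by (auto simp: set_mult_def)

text \<open>The product map \<open>A \<times> B \<rightarrow> AB\<close> has fibres \<open>{(a c, c\<inverse> b) | c \<in> A \<inter> B}\<close>.\<close>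

lemma card_set_mult:
  assumes A: "subgroup A G" and B: "subgroup B G"
  shows "card (A <#> B) * card (A \<inter> B) = card A * card B"
proof -
  let ?f = "\<lambda>(a, b). a \<otimes> b"
  have im: "A <#> B = ?f ` (A \<times> B)" by (auto simp: set_mult_def)
  have fin: "finite (A \<times> B)" using A B by (simp add: subgroup_finite)
  have fib: "card {z \<in> A \<times> B. ?f z = y} = card (A \<inter> B)" if "y \<in> ?f ` (A \<times> B)" for y
  proof -
    from that obtain a b where ab: "a \<in> A" "b \<in> B" "y = a \<otimes> b" by auto
    note cA = sub_carrier[OF A] and cB = sub_carrier[OF B]
    have "bij_betw (\<lambda>c. (a \<otimes> c, inv c \<otimes> b)) (A \<inter> B) {z \<in> A \<times> B. ?f z = y}"
    proof (rule bij_betw_byWitness[where f' = "\<lambda>(a', b'). inv a \<otimes> a'"])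
      show "\<forall>c\<in>A \<inter> B. (case (a \<otimes> c, inv c \<otimes> b) of (a', b') \<Rightarrow> inv a \<otimes> a') = c"
        using ab cA cB by simp
      show "\<forall>z\<in>{z \<in> A \<times> B. ?f z = y}.
          (a \<otimes> (case z of (a', b') \<Rightarrow> inv a \<otimes> a'), inv (case z of (a', b') \<Rightarrow> inv a \<otimes> a') \<otimes> b) = z"
      proof
        fix z assume "z \<in> {z \<in> A \<times> B. ?f z = y}"
        then obtain a' b' where 1: "z = (a', b')" "a' \<in> A" "b' \<in> B" "a' \<otimes> b' = y" by auto
        have c: "a \<in> carrier G" "b \<in> carrier G" "a' \<in> carrier G" "b' \<in> carrier G"
          using 1 ab cA cB by auto
        have "a' \<otimes> b' = a \<otimes> b" using 1 ab by simp
        hence "inv a' \<otimes> (a \<otimes> b) = b'" using c by (metis inv_cancel_left(1))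
        thus "(a \<otimes> (case z of (a', b') \<Rightarrow> inv a \<otimes> a'), inv (case z of (a', b') \<Rightarrow> inv a \<otimes> a') \<otimes> b) = z"
          using c 1 by (simp add: group_word)
      qed
      show "(\<lambda>c. (a \<otimes> c, inv c \<otimes> b)) ` (A \<inter> B) \<subseteq> {z \<in> A \<times> B. ?f z = y}"
        using ab cA cB A B
        by (auto simp: group_word subgroup.m_closed subgroup.m_inv_closed)
      show "(\<lambda>(a', b'). inv a \<otimes> a') ` {z \<in> A \<times> B. ?f z = y} \<subseteq> A \<inter> B"
      proof
        fix x assume "x \<in> (\<lambda>(a', b'). inv a \<otimes> a') ` {z \<in> A \<times> B. ?f z = y}"
        then obtain a' b' where 1: "x = inv a \<otimes> a'" "a' \<in> A" "b' \<in> B" "a' \<otimes> b' = y" by auto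
        have c: "a \<in> carrier G" "b \<in> carrier G" "a' \<in> carrier G" "b' \<in> carrier G"
          using 1 ab cA cB by auto
        have "a' \<otimes> b' = a \<otimes> b" using 1 ab by simp
        hence "a' = a \<otimes> b \<otimes> inv b'" using c by (metis inv_solve_right m_closed)
        hence "inv a \<otimes> a' = b \<otimes> inv b'" using c by (simp add: group_word)
        moreover have "inv a \<otimes> a' \<in> A" "b \<otimes> inv b' \<in> B"
          using 1 ab A B by (simp_all add: subgroup.m_closed subgroup.m_inv_closed)
        ultimately show "x \<in> A \<inter> B" using 1 by simp
      qed
    qed
    thus ?thesis by (simp add: bij_betw_same_card)
  qed
  have "card (A \<times> B) = (\<Sum>y\<in>?f ` (A \<times> B). card {z \<in> A \<times> B. ?f z = y})"
    using sum.image_gen[OF fin, of "\<lambda>_. 1::nat" ?f] by simp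
  also have "\<dots> = card (?f ` (A \<times> B)) * card (A \<inter> B)"
    using fib by simp
  finally show ?thesis using im by (simp add: card_cartesian_product)
qed

lemma subset_set_mult:
  assumes "subgroup A G" "subgroup B G"
  shows "A \<subseteq> A <#> B" "B \<subseteq> A <#> B"
proof -
  have "x \<otimes> \<one> \<in> A <#> B" if "x \<in> A" for x
    using that subgroup.one_closed[OF assms(2)] by (rule set_multI)
  moreover have "\<one> \<otimes> x \<in> A <#> B" if "x \<in> B" for x
    using subgroup.one_closed[OF assms(1)] that by (rule set_multI)
  ultimately show "A \<subseteq> A <#> B" "B \<subseteq> A <#> B" using sub_carrier assms by auto
qed

lemma set_mult_leI: "subgroup Y G \<Longrightarrow> A \<subseteq> Y \<Longrightarrow> B \<subseteq> Y \<Longrightarrow> A <#> B \<subseteq> Y"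
  unfolding set_mult_def by (auto simp: subgroup.m_closed subset_eq)

lemma set_mult_inverse:
  assumes "subgroup A G" "subgroup B G" "A <#> B \<subseteq> B <#> A"
  shows "A <#> B = B <#> A"
proof
  show "B <#> A \<subseteq> A <#> B"
  proof
    fix x assume "x \<in> B <#> A"
    then obtain a b where ab: "a \<in> A" "b \<in> B" "x = b \<otimes> a" by (auto simp: set_mult_def)
    hence "inv a \<otimes> inv b \<in> B <#> A"
      using assms by (auto simp: set_mult_def subgroup.m_inv_closed subset_eq)
    then obtain a' b' where ab': "a' \<in> A" "b' \<in> B" "inv a \<otimes> inv b = b' \<otimes> a'"
      by (auto simp: set_mult_def)
    have c: "a \<in> carrier G" "b \<in> carrier G" "a' \<in> carrier G" "b' \<in> carrier G"
      using ab ab' assms sub_carrier by blast+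
    have "x = inv (inv a \<otimes> inv b)" using ab c by (simp add: group_word)
    also have "\<dots> = inv a' \<otimes> inv b'" using ab' c by (simp add: group_word)
    finally show "x \<in> A <#> B"
      using ab' assms by (auto intro!: set_multI simp: subgroup.m_inv_closed)
  qed
qed fact

lemma set_mult_subgroup:
  assumes A: "subgroup A G" and B: "subgroup B G" and AB: "A <#> B = B <#> A"
  shows "subgroup (A <#> B) G"
proof (rule subgroupI)
  show "A <#> B \<subseteq> carrier G" using A B by (meson setmult_subset_G subgroup.subset)
  show "A <#> B \<noteq> {}" using subset_set_mult[OF A B] subgroup.one_closed[OF A] by blast
next
  fix x assume "x \<in> A <#> B"
  then obtain a b where ab: "a \<in> A" "b \<in> B" "x = a \<otimes> b" by (auto simp: set_mult_def)
  hence "inv x = inv b \<otimes> inv a" using A B by (simp add: inv_mult_group sub_carrier)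
  hence "inv x \<in> B <#> A" using ab(1,2) A B by (auto intro!: set_multI simp: subgroup.m_inv_closed)
  thus "inv x \<in> A <#> B" using AB by simp
next
  fix x y assume "x \<in> A <#> B" "y \<in> A <#> B"
  then obtain a b a' b' where ab: "a \<in> A" "b \<in> B" "x = a \<otimes> b" "a' \<in> A" "b' \<in> B" "y = a' \<otimes> b'"
    by (auto simp: set_mult_def)
  hence "b \<otimes> a' \<in> A <#> B" using AB by (auto simp: set_mult_def)
  then obtain a2 b2 where ab2: "a2 \<in> A" "b2 \<in> B" "b \<otimes> a' = a2 \<otimes> b2"
    by (auto simp: set_mult_def)
  have c: "a \<in> carrier G" "b \<in> carrier G" "a' \<in> carrier G" "b' \<in> carrier G"
    "a2 \<in> carrier G" "b2 \<in> carrier G"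
    using ab ab2 A B sub_carrier by blast+
  have "x \<otimes> y = a \<otimes> (b \<otimes> a') \<otimes> b'" using c ab by (simp add: group_word)
  also have "\<dots> = (a \<otimes> a2) \<otimes> (b2 \<otimes> b')" using c ab2 by (simp add: group_word)
  finally show "x \<otimes> y \<in> A <#> B"
    using set_multI[of "a \<otimes> a2" A "b2 \<otimes> b'" B] ab ab2 A B by (simp add: subgroup.m_closed)
qed

lemma normalizes_commute:
  assumes A: "subgroup A G" and B: "subgroup B G" and AB: "normalizes A B"
  shows "A <#> B = B <#> A"
proof (rule set_mult_inverse[OF A B], rule subsetI)
  fix x assume "x \<in> A <#> B"
  then obtain a b where ab: "a \<in> A" "b \<in> B" "x = a \<otimes> b" by (auto simp: set_mult_def)
  hence "x = (a \<otimes> b \<otimes> inv a) \<otimes> a" using A B by (simp add: group_word sub_carrier)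
  thus "x \<in> B <#> A" using ab normalizesD[OF AB] by (auto simp: set_mult_def)
qed

lemma normalizes_set_mult:
  assumes A: "subgroup A G" and B: "subgroup B G" and AB: "normalizes A B"
  shows "subgroup (A <#> B) G" "subgroup (B <#> A) G"
  using set_mult_subgroup[OF A B normalizes_commute[OF assms]] normalizes_commute[OF assms] by auto

lemma idx_set_mult:
  assumes A: "subgroup A G" and B: "subgroup B G" and AB: "subgroup (A <#> B) G"
  shows "idx (A <#> B) B = idx A (A \<inter> B)"
proof -
  have 1: "idx (A <#> B) B * card B = card (A <#> B)"
    using idx_mult[OF B AB] subset_set_mult[OF A B] by simp
  have 2: "idx A (A \<inter> B) * card (A \<inter> B) = card A"
    using idx_mult[OF subgroup_Int[OF A B] A] by simp
  have "idx (A <#> B) B * (card B * card (A \<inter> B)) = idx A (A \<inter> B) * (card B * card (A \<inter> B))"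
    using card_set_mult[OF A B] 1 2 by (metis mult.assoc mult.commute)
  moreover have "card B * card (A \<inter> B) > 0"
    using card_pos[OF B] card_pos[OF subgroup_Int[OF A B]] by simp
  ultimately show ?thesis by simp
qed

lemma equal_of_coprime_indices:
  assumes "subgroup A G" "subgroup B G" "A \<subseteq> B" "idx B A dvd m" "idx B A dvd n" "coprime m n"
  shows "A = B"
  using coprime_common_divisor[OF assms(6,4,5)] idx_eq_1[OF assms(1-3)] by simp

text \<open>The index \<open>|H : H \<inter> N| = |HN : N|\<close> divides both \<open>|H : S|\<close> and \<open>|X : N|\<close>.
  Nearly every inclusion between subgroups below is obtained in this way.\<close>

lemma coprime_index_subset:
  assumes H: "subgroup H G" and N: "subgroup N G" and S: "subgroup S G" and X: "subgroup X G"
    and "H \<subseteq> X" "N \<subseteq> X" "S \<subseteq> H" "S \<subseteq> N" and HN: "normalizes H N"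
    and cop: "coprime (idx H S) (idx X N)"
  shows "H \<subseteq> N"
proof -
  note HNs = normalizes_set_mult(1)[OF H N HN]
  have I: "subgroup (H \<inter> N) G" using H N by (rule subgroup_Int)
  have "idx H (H \<inter> N) dvd idx H S"
    using idx_chain[OF S I H] assms dvd_triv_left[of "idx H (H \<inter> N)" "idx (H \<inter> N) S"] by simp
  moreover have "H <#> N \<subseteq> X" using assms by (simp add: set_mult_leI)
  hence "idx (H <#> N) N dvd idx X N"
    using idx_chain[OF N HNs X] subset_set_mult[OF H N] dvd_triv_right[of "idx (H <#> N) N" "idx X (H <#> N)"]
    by simp
  ultimately have "H \<inter> N = H"
    using equal_of_coprime_indices[OF I H] cop idx_set_mult[OF H N HNs] by simp
  thus ?thesis by auto
qed

lemma subgroup_pow: "subgroup A G \<Longrightarrow> a \<in> A \<Longrightarrow> a [^] (n::nat) \<in> A"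
  by (induction n) (simp_all add: subgroup.one_closed subgroup.m_closed)

lemma cnj_closed [simp]: "g \<in> carrier G \<Longrightarrow> x \<in> carrier G \<Longrightarrow> cnj g x \<in> carrier G"
  by (simp add: cnj_def)

lemma cnj_mult: "g \<in> carrier G \<Longrightarrow> x \<in> carrier G \<Longrightarrow> y \<in> carrier G \<Longrightarrow>
    cnj g (x \<otimes> y) = cnj g x \<otimes> cnj g y"
  by (simp add: cnj_def group_word)

lemma cnj_one [simp]: "g \<in> carrier G \<Longrightarrow> cnj g \<one> = \<one>"
  by (simp add: cnj_def)

lemma cnj_inv: "g \<in> carrier G \<Longrightarrow> x \<in> carrier G \<Longrightarrow> cnj g (inv x) = inv (cnj g x)"
  by (simp add: cnj_def group_word)

lemma cnj_cnj: "g \<in> carrier G \<Longrightarrow> k \<in> carrier G \<Longrightarrow> x \<in> carrier G \<Longrightarrow>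
    cnj g (cnj k x) = cnj (g \<otimes> k) x"
  by (simp add: cnj_def group_word)

lemma cnj_pow: "g \<in> carrier G \<Longrightarrow> x \<in> carrier G \<Longrightarrow> cnj g (x [^] (n::nat)) = cnj g x [^] n"
  by (induction n) (simp_all add: cnj_mult)

lemma cnj_inv_cnj [simp]:
  "g \<in> carrier G \<Longrightarrow> x \<in> carrier G \<Longrightarrow> cnj (inv g) (cnj g x) = x"
  "g \<in> carrier G \<Longrightarrow> x \<in> carrier G \<Longrightarrow> cnj g (cnj (inv g) x) = x"
  by (simp_all add: cnj_def group_word)

lemma inj_on_cnj: "g \<in> carrier G \<Longrightarrow> X \<subseteq> carrier G \<Longrightarrow> inj_on (cnj g) X"
  by (rule inj_on_inverseI[where g = "cnj (inv g)"]) auto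

lemma card_cnj: "g \<in> carrier G \<Longrightarrow> subgroup A G \<Longrightarrow> card (cnj g ` A) = card A"
  by (simp add: card_image inj_on_cnj subgroup.subset)

lemma subgroup_cnj:
  assumes g: "g \<in> carrier G" and A: "subgroup A G"
  shows "subgroup (cnj g ` A) G"
proof (rule subgroupI)
  fix x assume "x \<in> cnj g ` A"
  thus "inv x \<in> cnj g ` A"
    using g A subgroup.m_inv_closed[OF A] by (auto simp: cnj_inv[symmetric] sub_carrier)
next
  fix x y assume "x \<in> cnj g ` A" "y \<in> cnj g ` A"
  thus "x \<otimes> y \<in> cnj g ` A"
    using g A subgroup.m_closed[OF A] by (auto simp: cnj_mult[symmetric] sub_carrier)
qed (use assms subgroup.one_closed[OF A] in \<open>auto simp: sub_carrier\<close>)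

lemma normalizes_image_eq:
  assumes A: "subgroup A G" and g: "g \<in> carrier G" "\<And>a. a \<in> A \<Longrightarrow> cnj g a \<in> A"
  shows "cnj g ` A = A"
  using g card_cnj[OF g(1) A] by (intro card_subset_eq subgroup_finite[OF A]) auto

text \<open>Finiteness enters in the closure under inverses: conjugation maps the finite set \<open>Q\<close>
  injectively into, hence onto, itself.\<close>

lemma common_normalizer_subgroup:
  assumes C: "subgroup C G" and Q: "\<And>Q. Q \<in> \<Q> \<Longrightarrow> subgroup Q G"
  shows "subgroup {c \<in> C. \<forall>Q\<in>\<Q>. \<forall>q\<in>Q. cnj c q \<in> Q} G"
proof (rule subgroupI)
  show "{c \<in> C. \<forall>Q\<in>\<Q>. \<forall>q\<in>Q. cnj c q \<in> Q} \<noteq> {}"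
    using subgroup.one_closed[OF C] sub_carrier[OF Q] by (auto simp: cnj_def intro!: exI[of _ \<one>])
next
  fix c assume c: "c \<in> {c \<in> C. \<forall>Q\<in>\<Q>. \<forall>q\<in>Q. cnj c q \<in> Q}"
  hence cc: "c \<in> carrier G" using sub_carrier[OF C] by simp
  have "cnj (inv c) q \<in> Q" if "Q \<in> \<Q>" "q \<in> Q" for Q q
  proof -
    have "cnj c ` Q = Q" by (rule normalizes_image_eq[OF Q]) (use that c cc in auto)
    with that obtain r where "r \<in> Q" "q = cnj c r" by blast
    thus ?thesis using cc sub_carrier[OF Q] that by simp
  qed
  thus "inv c \<in> {c \<in> C. \<forall>Q\<in>\<Q>. \<forall>q\<in>Q. cnj c q \<in> Q}"
    using c subgroup.m_inv_closed[OF C] by simp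
next
  fix c d
  assume cd: "c \<in> {c \<in> C. \<forall>Q\<in>\<Q>. \<forall>q\<in>Q. cnj c q \<in> Q}" "d \<in> {c \<in> C. \<forall>Q\<in>\<Q>. \<forall>q\<in>Q. cnj c q \<in> Q}"
  hence "c \<in> carrier G" "d \<in> carrier G" using sub_carrier[OF C] by auto
  hence "cnj (c \<otimes> d) q = cnj c (cnj d q)" if "Q \<in> \<Q>" "q \<in> Q" for Q q
    using sub_carrier[OF Q] that by (simp add: cnj_cnj)
  thus "c \<otimes> d \<in> {c \<in> C. \<forall>Q\<in>\<Q>. \<forall>q\<in>Q. cnj c q \<in> Q}"
    using cd subgroup.m_closed[OF C] by simp
qed (use C subgroup.subset in blast)

lemma normalizes_mult:
  assumes A: "subgroup A G" and B: "subgroup B G" and Q: "subgroup Q G"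
    and "normalizes A Q" "normalizes B Q"
  shows "normalizes (A <#> B) Q"
proof -
  have "cnj (a \<otimes> b) q \<in> Q" if "a \<in> A" "b \<in> B" "q \<in> Q" for a b q
    using that assms by (simp add: cnj_cnj[symmetric] sub_carrier normalizes_def)
  thus ?thesis by (auto simp: normalizes_def set_mult_def)
qed

lemma normalizes_product:
  assumes C: "subgroup C G" and A: "subgroup A G" and B: "subgroup B G"
    and "normalizes C A" "normalizes C B"
  shows "normalizes C (A <#> B)"
  unfolding normalizes_def
proof (intro ballI)
  fix c x assume c: "c \<in> C" and "x \<in> A <#> B"
  then obtain a b where ab: "a \<in> A" "b \<in> B" "x = a \<otimes> b" by (auto elim: set_multE)
  thus "cnj c x \<in> A <#> B"
    using c assms set_multI[of "cnj c a" A "cnj c b" B]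
    by (simp add: cnj_mult sub_carrier normalizes_def)
qed

definition cmt :: "'a \<Rightarrow> 'a \<Rightarrow> 'a" where
  "cmt x y = x \<otimes> y \<otimes> inv x \<otimes> inv y"

lemma cmt_closed [simp]: "x \<in> carrier G \<Longrightarrow> y \<in> carrier G \<Longrightarrow> cmt x y \<in> carrier G"
  by (simp add: cmt_def)

lemma cmt_mult: "x \<in> carrier G \<Longrightarrow> w \<in> carrier G \<Longrightarrow> y \<in> carrier G \<Longrightarrow>
    cmt (x \<otimes> w) y = cnj x (cmt w y) \<otimes> cmt x y"
  by (simp add: cmt_def cnj_def group_word)

lemma cmt_inv: "x \<in> carrier G \<Longrightarrow> y \<in> carrier G \<Longrightarrow> cmt (inv x) y = cnj (inv x) (inv (cmt x y))"
  by (simp add: cmt_def cnj_def group_word)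

lemma cmt_swap: "x \<in> carrier G \<Longrightarrow> y \<in> carrier G \<Longrightarrow> cmt y x = inv (cmt x y)"
  by (simp add: cmt_def group_word)

lemma cnj_cmt: "c \<in> carrier G \<Longrightarrow> x \<in> carrier G \<Longrightarrow> y \<in> carrier G \<Longrightarrow>
    cnj c (cmt x y) = cmt (cnj c x) (cnj c y)"
  by (simp add: cmt_def cnj_def group_word)

lemma cnj_eq_cmt_mult: "x \<in> carrier G \<Longrightarrow> y \<in> carrier G \<Longrightarrow> cnj x y = cmt x y \<otimes> y"
  by (simp add: cmt_def cnj_def group_word)

lemma cmt_eq: "cmt x y = cnj x y \<otimes> inv y"
  by (simp add: cmt_def cnj_def)

text \<open>With trivial \<open>K\<close> this gives ordinary centralizers, and with \<open>X = M\<close> the preimage of the center of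
  \<open>M/K\<close>. Closure under products follows from \<open>[zw, x] = z [w, x] z\<inverse> [z, x]\<close>.\<close>

lemma relative_centralizer:
  assumes M: "subgroup M G" and K: "subgroup K G" and MK: "normalizes M K" and X: "X \<subseteq> carrier G"
  shows "subgroup {z \<in> M. \<forall>x\<in>X. cmt z x \<in> K} G"
    and "subgroup C G \<Longrightarrow> normalizes C M \<Longrightarrow> normalizes C K \<Longrightarrow> normalizes C X \<Longrightarrow>
      normalizes C {z \<in> M. \<forall>x\<in>X. cmt z x \<in> K}"
proof -
  let ?Z = "{z \<in> M. \<forall>x\<in>X. cmt z x \<in> K}"
  note cM = sub_carrier[OF M]
  have cX: "x \<in> carrier G" if "x \<in> X" for x using that X by auto
  show "subgroup {z \<in> M. \<forall>x\<in>X. cmt z x \<in> K} G"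
  proof (rule subgroupI)
    have "\<one> \<in> ?Z" using subgroup.one_closed[OF M] subgroup.one_closed[OF K] cX
      by (simp add: cmt_def)
    thus "?Z \<noteq> {}" by blast
  next
    fix z assume z: "z \<in> ?Z"
    have "cmt (inv z) x \<in> K" if "x \<in> X" for x
      using z that cX cM M MK by (simp add: cmt_inv normalizes_def subgroup.m_inv_closed K)
    thus "inv z \<in> ?Z" using z M by (simp add: subgroup.m_inv_closed)
  next
    fix z w assume z: "z \<in> ?Z" "w \<in> ?Z"
    have "cmt (z \<otimes> w) x \<in> K" if "x \<in> X" for x
      using z that cX cM M MK K by (simp add: cmt_mult normalizes_def subgroup.m_closed)
    thus "z \<otimes> w \<in> ?Z" using z M by (simp add: subgroup.m_closed)
  qed (use cM in auto)
  assume C: "subgroup C G" and n: "normalizes C M" "normalizes C K" "normalizes C X"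
  show "normalizes C {z \<in> M. \<forall>x\<in>X. cmt z x \<in> K}"
    unfolding normalizes_def
  proof (intro ballI)
    fix c z assume c: "c \<in> C" and z: "z \<in> ?Z"
    note cc = sub_carrier[OF C c]
    have "cmt (cnj c z) x \<in> K" if x: "x \<in> X" for x
    proof -
      have y: "cnj (inv c) x \<in> X" using n(3) C c x by (simp add: normalizes_def subgroup.m_inv_closed)
      have "cmt (cnj c z) x = cnj c (cmt z (cnj (inv c) x))"
        using cc z cM cX[OF x] cX[OF y] by (simp add: cnj_cmt)
      thus ?thesis using z y n(2) c by (simp add: normalizes_def)
    qed
    thus "cnj c z \<in> ?Z" using z c n(1) by (simp add: normalizes_def)
  qed
qed

end

section \<open>Epimorphisms and sections\<close>

locale finite_epi = G: finite_group G + H: finite_group H for G (structure) and H (structure) +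
  fixes h
  assumes h_hom: "h \<in> hom G H" and h_surj: "h ` carrier G = carrier H"
begin

sublocale group_hom G H h
  by unfold_locales (rule h_hom)

definition pre :: "'c set \<Rightarrow> 'a set" where
  "pre Q = {x \<in> carrier G. h x \<in> Q}"

lemma pre_mono: "P \<subseteq> Q \<Longrightarrow> pre P \<subseteq> pre Q"
  by (auto simp: pre_def)

lemma pre_subgroup: "subgroup Q H \<Longrightarrow> subgroup (pre Q) G"
  by (rule G.subgroupI)
     (auto simp: pre_def subgroup.m_closed subgroup.m_inv_closed subgroup.one_closed
       intro!: exI[of _ "\<one>\<^bsub>G\<^esub>"])

lemma image_pre: "Q \<subseteq> carrier H \<Longrightarrow> h ` pre Q = Q"
  using h_surj by (fastforce simp: pre_def)

lemma image_subgroup: "subgroup A G \<Longrightarrow> subgroup (h ` A) H"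
  by (rule subgroup_img_is_subgroup)

lemma kernel_subgroup: "subgroup (kernel G H h) G"
  by (rule subgroup_kernel)

lemma kernel_subset_pre: "subgroup Q H \<Longrightarrow> kernel G H h \<subseteq> pre Q"
  by (auto simp: kernel_def pre_def subgroup.one_closed)

lemma pre_one: "pre {\<one>\<^bsub>H\<^esub>} = kernel G H h"
  by (auto simp: pre_def kernel_def)

lemma pre_carrier: "pre (carrier H) = carrier G"
  by (auto simp: pre_def)

lemma pre_image:
  assumes A: "subgroup A G" and K: "kernel G H h \<subseteq> A"
  shows "pre (h ` A) = A"
proof
  show "A \<subseteq> pre (h ` A)" using A by (auto simp: pre_def G.sub_carrier)
  show "pre (h ` A) \<subseteq> A"
  proof
    fix x assume "x \<in> pre (h ` A)"
    then obtain a where a: "x \<in> carrier G" "a \<in> A" "h x = h a" by (auto simp: pre_def)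
    have c: "a \<in> carrier G" using a A G.sub_carrier by blast
    have "x \<otimes>\<^bsub>G\<^esub> inv\<^bsub>G\<^esub> a \<in> kernel G H h" using a c by (simp add: kernel_def)
    hence "(x \<otimes>\<^bsub>G\<^esub> inv\<^bsub>G\<^esub> a) \<otimes>\<^bsub>G\<^esub> a \<in> A" using K a A by (blast intro: subgroup.m_closed)
    thus "x \<in> A" using a c by (simp add: G.m_assoc)
  qed
qed

lemma card_pre:
  assumes Q: "subgroup Q H"
  shows "card (pre Q) = card (kernel G H h) * card Q"
proof -
  have fin: "finite (pre Q)" by (simp add: pre_def)
  have im: "h ` pre Q = Q" using Q by (simp add: image_pre subgroup.subset)
  have fib: "card {x \<in> pre Q. h x = y} = card (kernel G H h)" if "y \<in> Q" for y
  proof -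
    from that im have "y \<in> h ` pre Q" by simp
    then obtain x0 where "x0 \<in> pre Q" "h x0 = y" by blast
    hence x0: "x0 \<in> carrier G" "h x0 = y" "x0 \<in> pre Q" by (auto simp: pre_def)
    have "bij_betw (\<lambda>k. x0 \<otimes>\<^bsub>G\<^esub> k) (kernel G H h) {x \<in> pre Q. h x = y}"
      by (rule bij_betw_byWitness[where f' = "\<lambda>x. inv\<^bsub>G\<^esub> x0 \<otimes>\<^bsub>G\<^esub> x"])
         (use x0 that in \<open>auto simp: kernel_def pre_def\<close>)
    thus ?thesis by (simp add: bij_betw_same_card)
  qed
  have "card (pre Q) = (\<Sum>y\<in>Q. card {x \<in> pre Q. h x = y})"
    using sum.image_gen[OF fin, of "\<lambda>_. 1::nat" h] im by simp
  thus ?thesis using fib by simp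
qed

lemma idx_pre:
  assumes "subgroup A H" "subgroup B H"
  shows "idx (pre A) (pre B) = idx A B"
proof -
  have "card (kernel G H h) > 0" by (rule G.card_pos[OF kernel_subgroup])
  thus ?thesis using assms by (simp add: idx_def card_pre)
qed

lemma idx_image:
  assumes "subgroup A G" "subgroup B G" "kernel G H h \<subseteq> A" "kernel G H h \<subseteq> B"
  shows "idx (h ` A) (h ` B) = idx A B"
  using idx_pre[of "h ` A" "h ` B"] assms by (simp add: pre_image image_subgroup)

lemma normalizes_pre: "H.normalizes A B \<Longrightarrow> G.normalizes (pre A) (pre B)"
  unfolding H.normalizes_def H.cnj_def G.normalizes_def G.cnj_def by (auto simp: pre_def)

lemma normalizes_image:
  assumes "G.normalizes A B" "A \<subseteq> carrier G" "B \<subseteq> carrier G"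
  shows "H.normalizes (h ` A) (h ` B)"
  unfolding H.normalizes_def H.cnj_def
proof (intro ballI)
  fix x y assume "x \<in> h ` A" "y \<in> h ` B"
  then obtain a b where ab: "a \<in> A" "b \<in> B" "x = h a" "y = h b" by auto
  hence "x \<otimes>\<^bsub>H\<^esub> y \<otimes>\<^bsub>H\<^esub> inv\<^bsub>H\<^esub> x = h (a \<otimes>\<^bsub>G\<^esub> b \<otimes>\<^bsub>G\<^esub> inv\<^bsub>G\<^esub> a)"
    using assms by (auto simp: subset_eq)
  thus "x \<otimes>\<^bsub>H\<^esub> y \<otimes>\<^bsub>H\<^esub> inv\<^bsub>H\<^esub> x \<in> h ` B" using assms(1) ab by (simp add: G.normalizesD)
qed

lemma normal_pre: "N \<lhd> H \<Longrightarrow> pre N \<lhd> G"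
  using normalizes_pre[of "carrier H" N]
  by (simp add: H.normal_iff_normalizes G.normal_iff_normalizes pre_subgroup pre_carrier)

lemma normal_image: "N \<lhd> G \<Longrightarrow> h ` N \<lhd> H"
  using normalizes_image[of "carrier G" N]
  by (simp add: H.normal_iff_normalizes G.normal_iff_normalizes image_subgroup h_surj subgroup.subset)

lemma card_image:
  assumes "subgroup A G" "kernel G H h \<subseteq> A"
  shows "card (h ` A) = idx A (kernel G H h)"
  using idx_pre[OF image_subgroup[OF assms(1)] H.subgroup_one] pre_image[OF assms]
  by (simp add: pre_one)

lemma pre_image_set_mult:
  assumes A: "subgroup A G"
  shows "pre (h ` A) = A <#>\<^bsub>G\<^esub> kernel G H h"
proof
  show "pre (h ` A) \<subseteq> A <#>\<^bsub>G\<^esub> kernel G H h"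
  proof
    fix x assume "x \<in> pre (h ` A)"
    then obtain a where a: "x \<in> carrier G" "a \<in> A" "h x = h a" by (auto simp: pre_def)
    have c: "a \<in> carrier G" using a A G.sub_carrier by blast
    have "inv\<^bsub>G\<^esub> a \<otimes>\<^bsub>G\<^esub> x \<in> kernel G H h" using a c by (simp add: kernel_def)
    thus "x \<in> A <#>\<^bsub>G\<^esub> kernel G H h"
      using G.set_multI[OF a(2), of "inv\<^bsub>G\<^esub> a \<otimes>\<^bsub>G\<^esub> x"] a c by simp
  qed
  show "A <#>\<^bsub>G\<^esub> kernel G H h \<subseteq> pre (h ` A)"
    using A by (auto simp: set_mult_def pre_def kernel_def G.sub_carrier)
qed

lemma card_image_dvd:
  assumes A: "subgroup A G"
  shows "card (h ` A) dvd card A"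
proof -
  let ?K = "kernel G H h"
  have AK: "subgroup (A <#>\<^bsub>G\<^esub> ?K) G"
    using pre_subgroup[OF image_subgroup[OF A]] pre_image_set_mult[OF A] by simp
  have "card (h ` A) = idx (A <#>\<^bsub>G\<^esub> ?K) ?K"
    using idx_pre[OF image_subgroup[OF A] H.subgroup_one] pre_image_set_mult[OF A] by (simp add: pre_one)
  also have "\<dots> = idx A (A \<inter> ?K)" by (rule G.idx_set_mult[OF A kernel_subgroup AK])
  finally show ?thesis
    using G.idx_mult[OF G.subgroup_Int[OF A kernel_subgroup] A] by (metis dvd_triv_left Int_lower1)
qed

lemma pre_complement:
  assumes N: "subgroup N G" "kernel G H h \<subseteq> N" and C: "subgroup C H"
    and CN: "C \<inter> h ` N = {\<one>\<^bsub>H\<^esub>}" "C <#>\<^bsub>H\<^esub> h ` N = carrier H"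
  shows "pre C \<inter> N = kernel G H h" "pre C <#>\<^bsub>G\<^esub> N = carrier G"
proof -
  show "pre C \<inter> N = kernel G H h"
  proof
    show "pre C \<inter> N \<subseteq> kernel G H h" using CN(1) by (auto simp: pre_def kernel_def)
    show "kernel G H h \<subseteq> pre C \<inter> N" using N(2) kernel_subset_pre[OF C] by simp
  qed
  show "pre C <#>\<^bsub>G\<^esub> N = carrier G"
  proof
    show "pre C <#>\<^bsub>G\<^esub> N \<subseteq> carrier G"
      using N by (intro G.setmult_subset_G) (auto simp: pre_def subgroup.subset)
    show "carrier G \<subseteq> pre C <#>\<^bsub>G\<^esub> N"
    proof
      fix x assume x: "x \<in> carrier G"
      hence "h x \<in> C <#>\<^bsub>H\<^esub> h ` N" using CN(2) by simp
      then obtain c n where cn: "c \<in> C" "n \<in> N" "h x = c \<otimes>\<^bsub>H\<^esub> h n" by (auto simp: set_mult_def)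
      have n: "n \<in> carrier G" using N cn by (simp add: G.sub_carrier)
      have c: "c \<in> carrier H" using C cn by (simp add: H.sub_carrier)
      have "h (x \<otimes>\<^bsub>G\<^esub> inv\<^bsub>G\<^esub> n) = c"
        using cn x n c by (simp add: H.m_assoc)
      hence "x \<otimes>\<^bsub>G\<^esub> inv\<^bsub>G\<^esub> n \<in> pre C" using x n cn by (simp add: pre_def)
      moreover have "x = (x \<otimes>\<^bsub>G\<^esub> inv\<^bsub>G\<^esub> n) \<otimes>\<^bsub>G\<^esub> n" using x n by (simp add: G.m_assoc)
      ultimately show "x \<in> pre C <#>\<^bsub>G\<^esub> N" using cn(2) G.set_multI by metis
    qed
  qed
qed

end

context finite_group
begin

lemma finite_group_subgroup: "subgroup Y G \<Longrightarrow> finite_group (G\<lparr>carrier := Y\<rparr>)"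
  using subgroup_imp_group subgroup_finite
  by (auto simp: finite_group_def finite_group_axioms_def)

lemma subgroup_subgroup_iff:
  assumes Y: "subgroup Y G"
  shows "subgroup A (G\<lparr>carrier := Y\<rparr>) \<longleftrightarrow> subgroup A G \<and> A \<subseteq> Y"
  using incl_subgroup[OF Y] subgroup_incl[OF _ Y] subgroup.subset[of A "G\<lparr>carrier := Y\<rparr>"]
  by auto

lemma normalizes_subgroup:
  assumes Y: "subgroup Y G" and "A \<subseteq> Y"
  shows "finite_group.normalizes (G\<lparr>carrier := Y\<rparr>) A B \<longleftrightarrow> normalizes A B"
proof -
  interpret Y: finite_group "G\<lparr>carrier := Y\<rparr>" by (rule finite_group_subgroup[OF Y])
  have "inv\<^bsub>G\<lparr>carrier := Y\<rparr>\<^esub> a = inv a" if "a \<in> A" for a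
    using that assms m_inv_consistent[OF Y] by auto
  thus ?thesis by (simp add: Y.normalizes_def Y.cnj_def normalizes_def cnj_def)
qed

lemma normal_subgroup_iff:
  assumes Y: "subgroup Y G"
  shows "N \<lhd> G\<lparr>carrier := Y\<rparr> \<longleftrightarrow> subgroup N G \<and> N \<subseteq> Y \<and> normalizes Y N"
  using finite_group.normal_iff_normalizes[OF finite_group_subgroup[OF Y], of N]
  by (simp add: subgroup_subgroup_iff[OF Y] normalizes_subgroup[OF Y])

lemma quotient_epi:
  assumes N: "N \<lhd> G"
  shows "finite_epi G (G Mod N) (\<lambda>x. N #> x)" "kernel G (G Mod N) (\<lambda>x. N #> x) = N"
proof -
  interpret N: normal N G by (rule N)
  interpret Q: group "G Mod N" by (rule N.factorgroup_is_group)
  have "finite (carrier (G Mod N))" by (simp add: carrier_FactGroup)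
  thus "finite_epi G (G Mod N) (\<lambda>x. N #> x)"
    by unfold_locales (auto simp: N.r_coset_hom_Mod carrier_FactGroup)
  have "x \<in> N" if "x \<in> carrier G" "N #> x = N" for x
    using that N.is_subgroup by (metis rcos_self)
  thus "kernel G (G Mod N) (\<lambda>x. N #> x) = N"
    using N.rcos_const by (auto simp: kernel_def N.mem_carrier)
qed

text \<open>A section \<open>Y/K\<close> of \<open>G\<close> is treated as a quotient of the group \<open>Y\<close>.\<close>

lemma section_epi:
  assumes Y: "subgroup Y G" and K: "subgroup K G" "K \<subseteq> Y" "normalizes Y K"
  shows "finite_epi (G\<lparr>carrier := Y\<rparr>) (G\<lparr>carrier := Y\<rparr> Mod K) (\<lambda>x. K #> x)"
    "kernel (G\<lparr>carrier := Y\<rparr>) (G\<lparr>carrier := Y\<rparr> Mod K) (\<lambda>x. K #> x) = K"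
proof -
  interpret Y: finite_group "G\<lparr>carrier := Y\<rparr>" by (rule finite_group_subgroup[OF Y])
  have "K \<lhd> G\<lparr>carrier := Y\<rparr>" using assms by (simp add: normal_subgroup_iff)
  from Y.quotient_epi[OF this]
  show "finite_epi (G\<lparr>carrier := Y\<rparr>) (G\<lparr>carrier := Y\<rparr> Mod K) (\<lambda>x. K #> x)"
    "kernel (G\<lparr>carrier := Y\<rparr>) (G\<lparr>carrier := Y\<rparr> Mod K) (\<lambda>x. K #> x) = K"
    by (simp_all add: r_coset_def)
qed

section \<open>Complements of abelian normal subgroups\<close>

lemma pow_card: "subgroup A G \<Longrightarrow> a \<in> A \<Longrightarrow> a [^] card A = \<one>"
proof -
  assume A: "subgroup A G" "a \<in> A"
  interpret A: finite_group "G\<lparr>carrier := A\<rparr>" by (rule finite_group_subgroup[OF A(1)])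
  have "a [^]\<^bsub>G\<lparr>carrier := A\<rparr>\<^esub> card A = \<one>"
    using A.pow_order_eq_1[of a] A by (simp add: order_def)
  thus ?thesis by (simp add: nat_pow_consistent[symmetric])
qed

lemma pow_mod: "a \<in> carrier G \<Longrightarrow> a [^] (m::nat) = \<one> \<Longrightarrow> a [^] (k mod m) = a [^] k"
proof -
  assume a: "a \<in> carrier G" "a [^] m = \<one>"
  have "a [^] k = a [^] (m * (k div m) + k mod m)" by simp
  also have "\<dots> = (a [^] m) [^] (k div m) \<otimes> a [^] (k mod m)"
    using a(1) by (simp add: nat_pow_mult nat_pow_pow)
  finally show ?thesis using a by simp
qed

lemma coprime_root:
  assumes "coprime n m"
  obtains u :: nat where "\<And>a. a \<in> carrier G \<Longrightarrow> a [^] (m::nat) = \<one> \<Longrightarrow> (a [^] n) [^] u = a"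
proof -
  from cong_solve_coprime_nat[OF assms] obtain u where u: "[n * u = 1] (mod m)" by auto
  have "(a [^] n) [^] u = a" if "a \<in> carrier G" "a [^] m = \<one>" for a
  proof -
    have "(a [^] n) [^] u = a [^] (n * u)" using that by (simp add: nat_pow_pow)
    also have "\<dots> = a [^] (1 mod m)" using that u by (metis cong_def pow_mod)
    also have "\<dots> = a" using pow_mod[OF that, of 1] that by simp
    finally show ?thesis .
  qed
  thus ?thesis using that by blast
qed

lemma comm_group_subgroup:
  assumes "subgroup A G" "\<And>x y. x \<in> A \<Longrightarrow> y \<in> A \<Longrightarrow> x \<otimes> y = y \<otimes> x"
  shows "comm_group (G\<lparr>carrier := A\<rparr>)"
  by (rule group.group_comm_groupI[OF subgroup_imp_group[OF assms(1)]]) (use assms in auto)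

lemma finprod_endo:
  assumes A: "comm_group (G\<lparr>carrier := A\<rparr>)" and "finite T" and f: "f \<in> T \<rightarrow> A"
    and c: "c \<in> A \<rightarrow> A" "c \<one> = \<one>" "\<And>x y. x \<in> A \<Longrightarrow> y \<in> A \<Longrightarrow> c (x \<otimes> y) = c x \<otimes> c y"
  shows "finprod (G\<lparr>carrier := A\<rparr>) (\<lambda>r. c (f r)) T = c (finprod (G\<lparr>carrier := A\<rparr>) f T)"
proof -
  interpret A: comm_group "G\<lparr>carrier := A\<rparr>" by (rule A)
  from \<open>finite T\<close> f show ?thesis
  proof induction
    case (insert x F)
    have "finprod (G\<lparr>carrier := A\<rparr>) f F \<in> A"
      using A.finprod_closed[of f F] insert.prems by auto
    moreover have "(\<lambda>r. c (f r)) \<in> F \<rightarrow> A" "c (f x) \<in> A" using insert.prems c by auto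
    ultimately show ?case using insert c by (auto simp: A.finprod_insert)
  qed (simp add: c)
qed

text \<open>Since the exponent \<open>n\<close> is prime to \<open>|A|\<close>, taking \<open>n\<close>-th powers is injective on \<open>A\<close>, so the kernel
  of \<open>d\<close> meets \<open>A\<close> trivially; multiplying \<open>g\<close> by the inverse of the \<open>n\<close>-th root of \<open>d g\<close> moves it into
  the kernel.\<close>

lemma crossed_hom_kernel_complement:
  assumes A: "A \<lhd> G" and dA: "\<And>g. g \<in> carrier G \<Longrightarrow> d g \<in> A"
    and d: "\<And>g k. g \<in> carrier G \<Longrightarrow> k \<in> carrier G \<Longrightarrow> d (g \<otimes> k) = cnj g (d k) \<otimes> d g"
    and dn: "\<And>a. a \<in> A \<Longrightarrow> d a = a [^] (n::nat)"
    and comm: "\<And>x y. x \<in> A \<Longrightarrow> y \<in> A \<Longrightarrow> x \<otimes> y = y \<otimes> x"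
    and cop: "coprime n (card A)"
  shows "\<exists>C. subgroup C G \<and> C \<inter> A = {\<one>} \<and> C <#> A = carrier G"
proof -
  have As: "subgroup A G" and An: "normalizes (carrier G) A" using A by (auto simp: normal_iff_normalizes)
  note cA [simp] = sub_carrier[OF As]
  have dc [simp]: "\<And>g. g \<in> carrier G \<Longrightarrow> d g \<in> carrier G" using dA by auto
  obtain u :: nat where u: "\<And>a. a \<in> A \<Longrightarrow> (a [^] n) [^] u = a"
    using coprime_root[OF cop] pow_card[OF As] cA by metis
  have d1: "d \<one> = \<one>" using dn[of \<one>] subgroup.one_closed[OF As] by simp
  let ?C = "{g \<in> carrier G. d g = \<one>}"
  have C: "subgroup ?C G"
  proof (rule subgroupI)
    show "?C \<noteq> {}" using d1 by auto
  next
    fix g assume g: "g \<in> ?C"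
    hence "cnj g (d (inv g)) = \<one>" using d[of g "inv g"] d1 by simp
    hence "d (inv g) = \<one>"
      using g by (metis (no_types, lifting) cnj_closed cnj_cnj cnj_one dc inv_closed l_inv
          mem_Collect_eq cnj_def inv_one l_one r_one)
    thus "inv g \<in> ?C" using g by simp
  qed (auto simp: d)
  have "?C \<inter> A = {\<one>}"
  proof -
    have "a = \<one>" if "a \<in> A" "d a = \<one>" for a
      using u[of a] dn[of a] that by (metis nat_pow_one)
    thus ?thesis using d1 subgroup.one_closed[OF As] by auto
  qed
  moreover have "carrier G \<subseteq> A <#> ?C"
  proof
    fix g assume g: "g \<in> carrier G"
    define a where "a = inv (d g [^] u)"
    have du: "d g [^] u \<in> A"
      using dA[OF g] by (rule subgroup_pow[OF As])
    hence a: "a \<in> A" by (simp add: a_def subgroup.m_inv_closed[OF As])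
    have "cnj a (d g) = d g"
      using comm[OF a dA[OF g]] a g by (simp add: cnj_def m_assoc)
    hence "d (a \<otimes> g) = d g \<otimes> a [^] n" using d[of a g] a g dn[OF a] by simp
    also have "a [^] n = inv ((d g [^] n) [^] u)"
      using g by (simp add: a_def nat_pow_inv[symmetric] nat_pow_pow mult.commute)
    also have "\<dots> = inv (d g)" using u[OF dA[OF g]] by simp
    finally have "a \<otimes> g \<in> ?C" using a g by simp
    moreover have "inv a \<otimes> (a \<otimes> g) = g" using a g by simp
    ultimately show "g \<in> A <#> ?C"
      using a set_multI[of "inv a" A "a \<otimes> g" ?C] by (simp add: subgroup.m_inv_closed[OF As])
  qed
  hence "A <#> ?C = carrier G"
    using setmult_subset_G[OF subgroup.subset[OF As] subgroup.subset[OF C]] by blast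
  moreover have "?C <#> A = A <#> ?C"
    by (rule normalizes_commute[OF C As normalizes_mono[OF An]]) auto
  ultimately show ?thesis using C by auto
qed

lemma pow_mult_comm:
  assumes As: "subgroup A G" and comm: "\<And>x y. x \<in> A \<Longrightarrow> y \<in> A \<Longrightarrow> x \<otimes> y = y \<otimes> x"
    and "x \<in> A" "y \<in> A"
  shows "(x \<otimes> y) [^] (n::nat) = x [^] n \<otimes> y [^] n"
  using pow_mult_distrib[OF comm[OF assms(3,4)]] assms sub_carrier[OF As] by simp

text \<open>For coset representatives \<open>t\<close>, write \<open>g t(C) = f(g,C) t(gC)\<close>. The product of the \<open>f(g,C)\<close>
  over all cosets \<open>C\<close> is a crossed homomorphism whose value at \<open>a \<in> A\<close> is \<open>a\<close> to the power \<open>|G : A|\<close>.\<close>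

lemma abelian_complement_exists:
  assumes A: "A \<lhd> G" and comm: "\<And>x y. x \<in> A \<Longrightarrow> y \<in> A \<Longrightarrow> x \<otimes> y = y \<otimes> x"
    and cop: "coprime (card A) (idx (carrier G) A)"
  shows "\<exists>C. subgroup C G \<and> C \<inter> A = {\<one>} \<and> C <#> A = carrier G"
proof -
  have As: "subgroup A G" and An: "normalizes (carrier G) A" using A by (auto simp: normal_iff_normalizes)
  interpret A: normal A G by (rule A)
  note cA [simp] = sub_carrier[OF As]
  interpret M: comm_group "G\<lparr>carrier := A\<rparr>" by (rule comm_group_subgroup[OF As comm])
  let ?P = "finprod (G\<lparr>carrier := A\<rparr>)"
  define t where "t x = (SOME y. y \<in> A #> x)" for x
  have tA: "t x \<in> A #> x" if "x \<in> carrier G" for x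
    unfolding t_def using rcos_self[OF that As] by (rule someI)
  have tc [simp]: "t x \<in> carrier G" if "x \<in> carrier G" for x
    using tA[OF that] that r_coset_subset_G[of A x] A.subset by auto
  have tcos: "A #> t x = A #> x" if "x \<in> carrier G" for x
    using repr_independence[OF tA[OF that] that As] by simp
  have cos_iff: "A #> x = A #> y \<longleftrightarrow> x \<otimes> inv y \<in> A" if "x \<in> carrier G" "y \<in> carrier G" for x y
    using that by (metis A.rcos_module As is_group rcos_self repr_independence)
  have t_eq: "t x = t y" if "A #> x = A #> y" for x y using that by (simp add: t_def)
  have tt: "t (t x) = t x" if "x \<in> carrier G" for x using tcos[OF that] by (rule t_eq)
  have cnjA [simp]: "cnj g a \<in> A" if "g \<in> carrier G" "a \<in> A" for g a
    using normalizesD[OF An that] by (simp add: cnj_def)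
  define T where "T = t ` carrier G"
  have T: "T \<subseteq> carrier G" "finite T" by (auto simp: T_def)
  have tT: "t r = r" if "r \<in> T" for r using that tt by (auto simp: T_def)
  have "bij_betw (\<lambda>r. A #> r) T (rcosets A)"
  proof (rule bij_betw_imageI)
    show "inj_on (\<lambda>r. A #> r) T" using t_eq tT by (metis inj_onI)
    show "(\<lambda>r. A #> r) ` T = rcosets A"
      using tcos by (auto simp: T_def RCOSETS_def image_image)
  qed
  hence "card T * card A = card (carrier G)"
    using lagrange[OF As] by (simp add: bij_betw_same_card order_def)
  hence cT: "card T = idx (carrier G) A"
    using card_pos[OF As] unfolding idx_def by (metis div_mult_self_is_m)
  define f where "f g r = g \<otimes> r \<otimes> inv (t (g \<otimes> r))" for g r
  have fA: "f g r \<in> A" if "g \<in> carrier G" "r \<in> carrier G" for g r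
    using cos_iff[of "g \<otimes> r" "t (g \<otimes> r)"] tcos[of "g \<otimes> r"] that by (simp add: f_def)
  have f_mult: "f (g \<otimes> k) r = cnj g (f k r) \<otimes> f g (t (k \<otimes> r))"
    if "g \<in> carrier G" "k \<in> carrier G" "r \<in> carrier G" for g k r
  proof -
    have "g \<otimes> t (k \<otimes> r) \<otimes> inv (g \<otimes> k \<otimes> r) = cnj g (t (k \<otimes> r) \<otimes> inv (k \<otimes> r))"
      using that by (simp add: cnj_def group_word)
    moreover have "t (k \<otimes> r) \<otimes> inv (k \<otimes> r) \<in> A"
      using cos_iff[of "t (k \<otimes> r)" "k \<otimes> r"] tcos[of "k \<otimes> r"] that by simp
    ultimately have "t (g \<otimes> t (k \<otimes> r)) = t (g \<otimes> k \<otimes> r)"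
      using cos_iff[of "g \<otimes> t (k \<otimes> r)" "g \<otimes> k \<otimes> r"] that by (intro t_eq) simp
    thus ?thesis using that by (simp add: f_def cnj_def group_word)
  qed
  define d where "d g = ?P (f g) T" for g
  have fT: "f g \<in> T \<rightarrow> carrier (G\<lparr>carrier := A\<rparr>)" if "g \<in> carrier G" for g
    using fA that T by auto
  show ?thesis
  proof (rule crossed_hom_kernel_complement[OF A _ _ _ comm])
    show "d g \<in> A" if "g \<in> carrier G" for g
      using M.finprod_closed[OF fT[OF that]] by (simp add: d_def)
  next
    fix g k assume gk: "g \<in> carrier G" "k \<in> carrier G"
    let ?s = "\<lambda>r. t (k \<otimes> r)"
    have "inj_on ?s T"
    proof (rule inj_onI)
      fix r r' assume r: "r \<in> T" "r' \<in> T" "t (k \<otimes> r) = t (k \<otimes> r')"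
      hence rc: "r \<in> carrier G" "r' \<in> carrier G" using T by auto
      have "A #> (k \<otimes> r) = A #> (k \<otimes> r')" using tcos r rc gk by (metis m_closed)
      hence "k \<otimes> r \<otimes> inv (k \<otimes> r') \<in> A" using cos_iff rc gk by simp
      hence "cnj (inv k) (k \<otimes> r \<otimes> inv (k \<otimes> r')) \<in> A" using gk by simp
      hence "r \<otimes> inv r' \<in> A" using gk rc by (simp add: cnj_def group_word)
      hence "t r = t r'" using cos_iff rc t_eq by blast
      thus "r = r'" using tT r by simp
    qed
    moreover have "?s ` T \<subseteq> T" using gk T by (auto simp: T_def)
    ultimately have s: "inj_on ?s T" "?s ` T = T" using endo_inj_surj T by blast+
    have sT: "(\<lambda>r. f g (?s r)) \<in> T \<rightarrow> A" using s(2) fA gk T by auto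
    have cT: "(\<lambda>r. cnj g (f k r)) \<in> T \<rightarrow> A" using fA gk T by auto
    have "d (g \<otimes> k) = ?P (\<lambda>r. cnj g (f k r) \<otimes> f g (?s r)) T"
      unfolding d_def using gk T fA
      by (intro M.finprod_cong') (auto simp: f_mult subset_eq As subgroup.m_closed)
    also have "\<dots> = ?P (\<lambda>r. cnj g (f k r)) T \<otimes> ?P (\<lambda>r. f g (?s r)) T"
      using M.finprod_multf[of "\<lambda>r. cnj g (f k r)" T "\<lambda>r. f g (?s r)"] sT cT by simp
    also have "?P (\<lambda>r. cnj g (f k r)) T = cnj g (d k)"
      unfolding d_def
      by (rule finprod_endo) (use gk T fT M.comm_group_axioms in \<open>auto simp: cnj_mult subset_eq\<close>)
    also have "?P (\<lambda>r. f g (?s r)) T = d g"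
      using M.finprod_reindex[of "f g" ?s T] s fT[OF gk(1)] by (simp add: d_def)
    finally show "d (g \<otimes> k) = cnj g (d k) \<otimes> d g" .
  next
    fix a assume a: "a \<in> A"
    have "f a r = a" if "r \<in> T" for r
    proof -
      have r: "r \<in> carrier G" using that T by auto
      have "A #> (a \<otimes> r) = A #> r" using cos_iff[of "a \<otimes> r" r] a r by (simp add: group_word)
      hence "t (a \<otimes> r) = r" using t_eq tT that by metis
      thus ?thesis using a r by (simp add: f_def group_word)
    qed
    hence "d a = ?P (\<lambda>_. a) T" unfolding d_def using a by (intro M.finprod_cong') auto
    also have "\<dots> = a [^] card T"
      using M.finprod_const[of a T] a by (simp add: nat_pow_consistent[symmetric])
    finally show "d a = a [^] card T" .
  next
    show "coprime (card T) (card A)" using cop cT by (simp add: coprime_commute)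
  qed
qed

text \<open>The projection \<open>p\<close> onto \<open>A\<close> along \<open>H\<close> is a crossed homomorphism with kernel \<open>H\<close>. Multiplying its
  values over \<open>H1\<close> and extracting a root of exponent \<open>|H1|\<close> in \<open>A\<close> shows that \<open>p\<close> is principal on \<open>H1\<close>.\<close>

lemma abelian_complements_conjugate:
  assumes A: "A \<lhd> G" and comm: "\<And>x y. x \<in> A \<Longrightarrow> y \<in> A \<Longrightarrow> x \<otimes> y = y \<otimes> x"
    and H: "subgroup H G" "H \<inter> A = {\<one>}" "A <#> H = carrier G"
    and H1: "subgroup H1 G" and cop: "coprime (card H1) (card A)"
  shows "\<exists>b\<in>A. \<forall>x\<in>H1. inv b \<otimes> x \<otimes> b \<in> H"
proof -
  have As: "subgroup A G" and An: "normalizes (carrier G) A" using A by (auto simp: normal_iff_normalizes)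
  interpret A: normal A G by (rule A)
  note cA [simp] = sub_carrier[OF As] and cH [simp] = sub_carrier[OF H(1)]
    and cH1 [simp] = sub_carrier[OF H1]
  interpret M: comm_group "G\<lparr>carrier := A\<rparr>" by (rule comm_group_subgroup[OF As comm])
  let ?P = "finprod (G\<lparr>carrier := A\<rparr>)"
  have cnjA [simp]: "cnj g a \<in> A" if "g \<in> carrier G" "a \<in> A" for g a
    using normalizesD[OF An that] by (simp add: cnj_def)
  define p where "p g = (SOME a. a \<in> A \<and> inv a \<otimes> g \<in> H)" for g
  have p: "p g \<in> A \<and> inv (p g) \<otimes> g \<in> H" if g: "g \<in> carrier G" for g
  proof -
    from g H(3) obtain a k where "a \<in> A" "k \<in> H" "g = a \<otimes> k" by (metis set_multE)
    hence "a \<in> A \<and> inv a \<otimes> g \<in> H" by simp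
    thus ?thesis unfolding p_def by (rule someI)
  qed
  have p_eq: "p g = a" if "g \<in> carrier G" "a \<in> A" "inv a \<otimes> g \<in> H" for g a
  proof -
    have "(inv (p g) \<otimes> g) \<otimes> inv (inv a \<otimes> g) \<in> H"
      using p[of g] that H(1) by (metis subgroup.m_closed subgroup.m_inv_closed)
    moreover have pc: "p g \<in> carrier G" using p[OF that(1)] by simp
    hence "(inv (p g) \<otimes> g) \<otimes> inv (inv a \<otimes> g) = inv (p g) \<otimes> a"
      using that p[of g] by (simp add: group_word)
    moreover have "inv (p g) \<otimes> a \<in> A" using p[of g] that As
      by (simp add: subgroup.m_closed subgroup.m_inv_closed)
    ultimately have "inv (p g) \<otimes> a = \<one>" using H(2) by auto
    thus ?thesis using pc that by (metis cA inv_cancel_left(2) r_one)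
  qed
  have p_mult: "p (g \<otimes> k) = p g \<otimes> cnj g (p k)" if "g \<in> carrier G" "k \<in> carrier G" for g k
  proof (rule p_eq)
    have c: "p g \<in> carrier G" "p k \<in> carrier G" using p that by auto
    show "p g \<otimes> cnj g (p k) \<in> A" using p that As by (simp add: subgroup.m_closed)
    have "p g \<otimes> cnj g (p k) = cnj g (p k) \<otimes> p g" using p that by (intro comm) auto
    hence "inv (p g \<otimes> cnj g (p k)) \<otimes> (g \<otimes> k) = (inv (p g) \<otimes> g) \<otimes> (inv (p k) \<otimes> k)"
      using that c by (simp add: cnj_def group_word)
    thus "inv (p g \<otimes> cnj g (p k)) \<otimes> (g \<otimes> k) \<in> H"
      using p[of g] p[of k] that H(1) by (simp add: subgroup.m_closed)
  qed (use that in auto)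
  define B where "B = ?P p H1"
  have pH1: "p \<in> H1 \<rightarrow> A" using p by auto
  have BA: "B \<in> A" using M.finprod_closed[of p H1] pH1 by (simp add: B_def)
  have finH1: "finite H1" by (rule subgroup_finite[OF H1])
  have B: "B = p x [^] card H1 \<otimes> cnj x B" if x: "x \<in> H1" for x
  proof -
    have inj: "inj_on (\<lambda>y. x \<otimes> y) H1" using x by (auto intro!: inj_onI)
    have "(\<lambda>y. x \<otimes> y) ` H1 \<subseteq> H1" using x H1 by (auto simp: subgroup.m_closed)
    hence im: "(\<lambda>y. x \<otimes> y) ` H1 = H1" using inj finH1 endo_inj_surj by blast
    have "B = ?P (\<lambda>y. p (x \<otimes> y)) H1"
      using M.finprod_reindex[of p "\<lambda>y. x \<otimes> y" H1] inj im pH1 by (simp add: B_def)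
    also have "\<dots> = ?P (\<lambda>y. p x \<otimes> cnj x (p y)) H1"
      using x p by (intro M.finprod_cong') (auto simp: p_mult As subgroup.m_closed)
    also have "\<dots> = ?P (\<lambda>y. p x) H1 \<otimes> ?P (\<lambda>y. cnj x (p y)) H1"
      using M.finprod_multf[of "\<lambda>y. p x" H1 "\<lambda>y. cnj x (p y)"] p x by auto
    also have "?P (\<lambda>y. p x) H1 = p x [^] card H1"
      using M.finprod_const[of "p x" H1] p x by (simp add: nat_pow_consistent[symmetric])
    also have "?P (\<lambda>y. cnj x (p y)) H1 = cnj x B"
      unfolding B_def
      by (rule finprod_endo) (use x finH1 pH1 M.comm_group_axioms in \<open>auto simp: cnj_mult\<close>)
    finally show ?thesis .
  qed
  obtain u :: nat where u: "\<And>a. a \<in> A \<Longrightarrow> (a [^] card H1) [^] u = a"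
    using coprime_root[OF cop] pow_card[OF As] cA by metis
  define b where "b = B [^] u"
  have bA: "b \<in> A" unfolding b_def using BA by (rule subgroup_pow[OF As])
  have "inv b \<otimes> x \<otimes> b \<in> H" if x: "x \<in> H1" for x
  proof -
    have px: "p x \<in> A" "inv (p x) \<otimes> x \<in> H" using p x by auto
    have pn: "p x [^] card H1 \<in> A"
      using px(1) by (rule subgroup_pow[OF As])
    have "b = (p x [^] card H1 \<otimes> cnj x B) [^] u" using B[OF x] by (simp add: b_def)
    also have "\<dots> = (p x [^] card H1) [^] u \<otimes> (cnj x B) [^] u"
      by (rule pow_mult_comm[OF As comm pn]) (use BA x in simp_all)
    also have "\<dots> = p x \<otimes> cnj x b"
      using u[OF px(1)] BA x by (simp add: b_def cnj_pow)
    finally have b: "b = p x \<otimes> cnj x b" .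
    have c: "p x \<in> carrier G" "b \<in> carrier G" "x \<in> carrier G" using px bA x by auto
    have "inv b = inv (p x) \<otimes> inv (cnj x b)"
      by (subst b) (use c px bA comm[of "p x" "cnj x b"] in \<open>simp add: inv_mult_group[symmetric]\<close>)
    hence "inv b \<otimes> (x \<otimes> b) = (inv (p x) \<otimes> inv (cnj x b)) \<otimes> (x \<otimes> b)" by (rule arg_cong)
    also have "\<dots> = inv (p x) \<otimes> x" using c by (simp add: cnj_def group_word)
    finally have "inv b \<otimes> x \<otimes> b = inv (p x) \<otimes> x" using c by (simp add: m_assoc)
    thus ?thesis using px by simp
  qed
  thus ?thesis using bA by blast
qed

lemma section_comm:
  assumes Y: "subgroup Y G" and K: "subgroup K G" "K \<subseteq> Y" "normalizes Y K"
    and xy: "x \<in> Y" "y \<in> Y" "x \<otimes> y \<otimes> inv x \<otimes> inv y \<in> K"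
  shows "(K #> x) \<otimes>\<^bsub>G\<lparr>carrier := Y\<rparr> Mod K\<^esub> (K #> y) = (K #> y) \<otimes>\<^bsub>G\<lparr>carrier := Y\<rparr> Mod K\<^esub> (K #> x)"
proof -
  interpret E: finite_epi "G\<lparr>carrier := Y\<rparr>" "G\<lparr>carrier := Y\<rparr> Mod K" "\<lambda>x. K #> x"
    by (rule section_epi(1)[OF Y K])
  have c: "x \<in> carrier G" "y \<in> carrier G" using xy Y sub_carrier by auto
  have "(x \<otimes> y) \<otimes> inv (y \<otimes> x) \<in> K" using xy c by (simp add: group_word)
  hence "K #> (x \<otimes> y) = K #> (y \<otimes> x)"
    using c K by (metis coset_mult_inv1 coset_join2 inv_closed m_closed subgroup.subset)
  thus ?thesis using E.hom_mult[of x y] E.hom_mult[of y x] xy by simp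
qed

text \<open>Complements of \<open>N/K\<close> in \<open>Y/K\<close> are pulled back along the quotient map. Their existence in the
  quotient is a premise, because it is needed first for abelian and then for arbitrary \<open>N/K\<close>.\<close>

lemma section_complement:
  fixes Y N K
  defines "Q \<equiv> G\<lparr>carrier := Y\<rparr> Mod K" and "A \<equiv> (\<lambda>x. K #> x) ` N"
  assumes Y: "subgroup Y G" and N: "subgroup N G" "N \<subseteq> Y" "normalizes Y N"
    and K: "subgroup K G" "K \<subseteq> N" "normalizes Y K"
    and cop: "coprime (idx N K) (idx Y N)"
    and ex: "A \<lhd> Q \<Longrightarrow> coprime (card A) (idx (carrier Q) A) \<Longrightarrow>
      \<exists>C. subgroup C Q \<and> C \<inter> A = {\<one>\<^bsub>Q\<^esub>} \<and> C <#>\<^bsub>Q\<^esub> A = carrier Q"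
  shows "\<exists>C. subgroup C G \<and> C \<subseteq> Y \<and> C \<inter> N = K \<and> C <#> N = Y"
proof -
  have KY: "K \<subseteq> Y" using K N by simp
  interpret E: finite_epi "G\<lparr>carrier := Y\<rparr>" Q "\<lambda>x. K #> x"
    unfolding Q_def by (rule section_epi(1)[OF Y K(1) KY K(3)])
  have ker: "kernel (G\<lparr>carrier := Y\<rparr>) Q (\<lambda>x. K #> x) = K"
    unfolding Q_def by (rule section_epi(2)[OF Y K(1) KY K(3)])
  have NY: "subgroup N (G\<lparr>carrier := Y\<rparr>)" "N \<lhd> G\<lparr>carrier := Y\<rparr>"
    using N Y by (simp_all add: normal_subgroup_iff subgroup_subgroup_iff)
  have YY: "subgroup Y (G\<lparr>carrier := Y\<rparr>)" using E.G.subgroup_self by simp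
  have "A \<lhd> Q" unfolding A_def by (rule E.normal_image[OF NY(2)])
  moreover have "card A = idx N K" using E.card_image[OF NY(1)] ker K(2) by (simp add: A_def)
  moreover have "idx (carrier Q) A = idx Y N"
    using E.idx_image[of Y N] NY YY ker K N E.h_surj by (simp add: A_def)
  ultimately obtain C where C: "subgroup C Q" "C \<inter> A = {\<one>\<^bsub>Q\<^esub>}" "C <#>\<^bsub>Q\<^esub> A = carrier Q"
    using ex cop by auto
  have "E.pre C \<inter> N = K" "E.pre C <#> N = Y"
    using E.pre_complement[OF NY(1) _ C[unfolded A_def]] K(2) by (simp_all add: ker)
  moreover have "subgroup (E.pre C) G" "E.pre C \<subseteq> Y"
    using E.pre_subgroup[OF C(1)] subgroup_subgroup_iff[OF Y] by auto
  ultimately show ?thesis by blast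
qed

lemma section_complement_abelian:
  assumes Y: "subgroup Y G" and N: "subgroup N G" "N \<subseteq> Y" "normalizes Y N"
    and K: "subgroup K G" "K \<subseteq> N" "normalizes Y K"
    and comm: "\<And>x y. x \<in> N \<Longrightarrow> y \<in> N \<Longrightarrow> x \<otimes> y \<otimes> inv x \<otimes> inv y \<in> K"
    and cop: "coprime (idx N K) (idx Y N)"
  shows "\<exists>C. subgroup C G \<and> C \<subseteq> Y \<and> C \<inter> N = K \<and> C <#> N = Y"
proof (rule section_complement[OF Y N K cop])
  have KY: "K \<subseteq> Y" using K N by simp
  let ?Q = "G\<lparr>carrier := Y\<rparr> Mod K" and ?A = "(\<lambda>x. K #> x) ` N"
  interpret E: finite_epi "G\<lparr>carrier := Y\<rparr>" ?Q "\<lambda>x. K #> x"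
    by (rule section_epi(1)[OF Y K(1) KY K(3)])
  assume "?A \<lhd> ?Q" and "coprime (card ?A) (idx (carrier ?Q) ?A)"
  moreover have "a \<otimes>\<^bsub>?Q\<^esub> b = b \<otimes>\<^bsub>?Q\<^esub> a" if "a \<in> ?A" "b \<in> ?A" for a b
    using that comm section_comm[OF Y K(1) KY K(3)] N(2) by blast
  ultimately show "\<exists>C. subgroup C ?Q \<and> C \<inter> ?A = {\<one>\<^bsub>?Q\<^esub>} \<and> C <#>\<^bsub>?Q\<^esub> ?A = carrier ?Q"
    by (intro E.H.abelian_complement_exists)
qed

text \<open>In \<open>Y/K\<close> the image of \<open>H\<close> is a complement of \<open>N/K\<close> and that of \<open>H1\<close> has order prime to \<open>|N/K|\<close>.\<close>

lemma section_conjugate_abelian: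
  assumes Y: "subgroup Y G" and N: "subgroup N G" "N \<subseteq> Y" "normalizes Y N"
    and K: "subgroup K G" "K \<subseteq> N" "normalizes Y K"
    and comm: "\<And>x y. x \<in> N \<Longrightarrow> y \<in> N \<Longrightarrow> x \<otimes> y \<otimes> inv x \<otimes> inv y \<in> K"
    and H: "subgroup H G" "H \<subseteq> Y" "N <#> H = Y" "H \<inter> N \<subseteq> K"
    and H1: "subgroup H1 G" "H1 \<subseteq> Y" and cop: "coprime (card H1) (idx N K)"
  shows "\<exists>b\<in>N. \<forall>x\<in>H1. inv b \<otimes> x \<otimes> b \<in> K <#> H"
proof -
  have KY: "K \<subseteq> Y" using K N by simp
  let ?Q = "G\<lparr>carrier := Y\<rparr> Mod K" and ?h = "\<lambda>x. K #> x"
  interpret E: finite_epi "G\<lparr>carrier := Y\<rparr>" ?Q ?h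
    by (rule section_epi(1)[OF Y K(1) KY K(3)])
  note ker = section_epi(2)[OF Y K(1) KY K(3)]
  have NY: "subgroup N (G\<lparr>carrier := Y\<rparr>)" "N \<lhd> G\<lparr>carrier := Y\<rparr>" "subgroup K (G\<lparr>carrier := Y\<rparr>)"
     "subgroup H (G\<lparr>carrier := Y\<rparr>)" "subgroup H1 (G\<lparr>carrier := Y\<rparr>)"
    using N Y K KY H H1 by (simp_all add: normal_subgroup_iff subgroup_subgroup_iff)
  have hK: "?h k = K" if "k \<in> K" for k using that K by (meson coset_join2 sub_carrier)
  hence "?h ` K = {\<one>\<^bsub>?Q\<^esub>}" using subgroup.one_closed[OF K(1)] by auto
  hence i1: "card (?h ` N) = idx N K"
    using E.idx_image[of N K] NY ker K E.H.idx_one by simp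
  have memK: "x \<in> K <#> H" if "x \<in> Y" "y \<in> H" "?h x = ?h y" for x y
  proof -
    have "x \<in> K #> y" using that rcos_self[of x K] K Y sub_carrier[of Y x] by auto
    thus ?thesis using that by (auto simp: r_coset_def set_mult_def)
  qed
  have "\<exists>b\<in>?h ` N. \<forall>x\<in>?h ` H1. inv\<^bsub>?Q\<^esub> b \<otimes>\<^bsub>?Q\<^esub> x \<otimes>\<^bsub>?Q\<^esub> b \<in> ?h ` H"
  proof (rule E.H.abelian_complements_conjugate)
    show "?h ` N \<lhd> ?Q" by (rule E.normal_image[OF NY(2)])
    show "a \<otimes>\<^bsub>?Q\<^esub> b = b \<otimes>\<^bsub>?Q\<^esub> a" if "a \<in> ?h ` N" "b \<in> ?h ` N" for a b
      using that comm section_comm[OF Y K(1) KY K(3)] N(2) by blast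
    show "subgroup (?h ` H) ?Q" "subgroup (?h ` H1) ?Q" using NY by (auto intro: E.image_subgroup)
    show "?h ` N <#>\<^bsub>?Q\<^esub> ?h ` H = carrier ?Q"
    proof -
      have "?h ` N <#>\<^bsub>?Q\<^esub> ?h ` H = ?h ` (N <#>\<^bsub>G\<lparr>carrier := Y\<rparr>\<^esub> H)"
        using set_mult_hom[OF E.h_hom, of N H] N H by simp
      thus ?thesis using H E.h_surj by simp
    qed
    show "?h ` H \<inter> ?h ` N = {\<one>\<^bsub>?Q\<^esub>}"
    proof -
      have "?h x = K" if x: "x \<in> H" "n \<in> N" "?h x = ?h n" for x n
      proof -
        have "x \<in> K #> n" using x rcos_self[of x K] K H sub_carrier[of H x] by auto
        then obtain k where "k \<in> K" "x = k \<otimes> n" by (auto simp: r_coset_def)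
        hence "x \<in> N" using K N x by (auto simp: subgroup.m_closed)
        thus ?thesis using H x hK by auto
      qed
      moreover have "?h \<one> = K" by (rule hK[OF subgroup.one_closed[OF K(1)]])
      hence "K \<in> ?h ` H" "K \<in> ?h ` N"
        using subgroup.one_closed[OF H(1)] subgroup.one_closed[OF N(1)] by (metis imageI)+
      ultimately have "?h ` H \<inter> ?h ` N = {K}" by (intro equalityI subsetI) (blast, simp)
      thus ?thesis by simp
    qed
    have "card (?h ` H1) dvd card H1" by (rule E.card_image_dvd[OF NY(5)])
    thus "coprime (card (?h ` H1)) (card (?h ` N))"
      using i1 cop by (metis coprime_divisors dvd_refl)
  qed
  then obtain b where b: "b \<in> N" "\<And>x. x \<in> H1 \<Longrightarrow> inv\<^bsub>?Q\<^esub> ?h b \<otimes>\<^bsub>?Q\<^esub> ?h x \<otimes>\<^bsub>?Q\<^esub> ?h b \<in> ?h ` H"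
    by auto
  have "inv b \<otimes> x \<otimes> b \<in> K <#> H" if x: "x \<in> H1" for x
  proof -
    have c: "b \<in> Y" "x \<in> Y" using b x N H1 by auto
    have ib: "inv\<^bsub>G\<lparr>carrier := Y\<rparr>\<^esub> b = inv b" using c Y by simp
    have "?h (inv b \<otimes> x \<otimes> b) = inv\<^bsub>?Q\<^esub> ?h b \<otimes>\<^bsub>?Q\<^esub> ?h x \<otimes>\<^bsub>?Q\<^esub> ?h b"
      using E.hom_mult[of "inv b \<otimes> x" b] E.hom_mult[of "inv b" x] E.hom_inv[of b] c ib Y
      by (simp add: subgroup.m_closed subgroup.m_inv_closed)
    with b(2)[OF x] obtain y where "y \<in> H" "?h (inv b \<otimes> x \<otimes> b) = ?h y" by auto
    thus ?thesis using memK c Y by (simp add: subgroup.m_closed subgroup.m_inv_closed)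
  qed
  thus ?thesis using b by blast
qed

section \<open>The Schur-Zassenhaus theorem\<close>

subsection \<open>Sylow subgroups\<close>

text \<open>The condition on the index avoids naming the exponent of \<open>p\<close> in \<open>|M|\<close>.\<close>

definition sylow_in :: "nat \<Rightarrow> 'a set \<Rightarrow> 'a set \<Rightarrow> bool" where
  "sylow_in p P M \<longleftrightarrow> subgroup P G \<and> P \<subseteq> M \<and> (\<exists>k. card P = p ^ k) \<and> \<not> p dvd idx M P"

lemma sylow_in_exists:
  assumes M: "subgroup M G" and p: "Factorial_Ring.prime p"
  shows "\<exists>P. sylow_in p P M"
proof -
  interpret M: finite_group "G\<lparr>carrier := M\<rparr>" by (rule finite_group_subgroup[OF M])
  have pos: "card M \<noteq> 0" using card_pos[OF M] by simp
  obtain m where m: "card M = p ^ multiplicity p (card M) * m" "\<not> p dvd m"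
    using multiplicity_decompose'[OF pos, of p] p by (metis not_prime_unit mult.commute)
  have "\<exists>P. subgroup P (G\<lparr>carrier := M\<rparr>) \<and> card P = p ^ multiplicity p (card M)"
    by (rule sylow_thm[OF p M.is_group]) (use m in \<open>auto simp: order_def subgroup_finite[OF M]\<close>)
  then obtain P where P: "subgroup P G" "P \<subseteq> M" "card P = p ^ multiplicity p (card M)"
    using subgroup_subgroup_iff[OF M] by auto
  have "idx M P = m" using m P card_pos[OF P(1)] unfolding idx_def
    by (metis less_not_refl nonzero_mult_div_cancel_left)
  thus ?thesis using P m(2) unfolding sylow_in_def by auto
qed

text \<open>\<open>M\<close> is a disjoint union of double cosets \<open>QxP\<close>; unless \<open>Q \<subseteq> x P x\<inverse>\<close>, the order of
  \<open>QxP\<close> is divisible by \<open>p |P|\<close>, and \<open>p |P|\<close> does not divide \<open>|M|\<close>.\<close>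

lemma sylow_in_conjugate:
  assumes M: "subgroup M G" and p: "Factorial_Ring.prime p"
    and P: "sylow_in p P M" and Q: "sylow_in p Q M"
  shows "\<exists>x\<in>M. Q \<subseteq> cnj x ` P"
proof (rule ccontr)
  assume contr: "\<not> ?thesis"
  have Ps: "subgroup P G" "P \<subseteq> M" and Qs: "subgroup Q G" "Q \<subseteq> M"
    using P Q by (auto simp: sylow_in_def)
  note c = sub_carrier[OF M] sub_carrier[OF Ps(1)] sub_carrier[OF Qs(1)]
  define r where "r = {(x, y). x \<in> M \<and> y \<in> M \<and> (\<exists>q\<in>Q. \<exists>a\<in>P. y = q \<otimes> x \<otimes> a)}"
  have "equiv M r"
  proof (rule equivI)
    show "r \<subseteq> M \<times> M" by (auto simp: r_def)
    show "refl_on M r"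
      unfolding r_def refl_on_def using subgroup.one_closed[OF Qs(1)] subgroup.one_closed[OF Ps(1)] c
      by (auto intro!: bexI[of _ \<one>])
    show "sym r"
    proof (rule symI)
      fix x y assume "(x, y) \<in> r"
      then obtain q a where *: "x \<in> M" "y \<in> M" "q \<in> Q" "a \<in> P" "y = q \<otimes> x \<otimes> a"
        by (auto simp: r_def)
      hence "x = inv q \<otimes> y \<otimes> inv a" using c by (simp add: group_word)
      moreover have "inv q \<in> Q" "inv a \<in> P" using * Qs Ps by (auto simp: subgroup.m_inv_closed)
      ultimately show "(y, x) \<in> r" unfolding r_def using *(1,2) by blast
    qed
    show "trans r"
    proof (rule transI)
      fix x y z assume "(x, y) \<in> r" "(y, z) \<in> r"
      then obtain q a q' a' where *: "x \<in> M" "y \<in> M" "z \<in> M" "q \<in> Q" "a \<in> P" "y = q \<otimes> x \<otimes> a"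
          "q' \<in> Q" "a' \<in> P" "z = q' \<otimes> y \<otimes> a'"
        by (auto simp: r_def)
      hence "z = (q' \<otimes> q) \<otimes> x \<otimes> (a \<otimes> a')" using c by (simp add: group_word)
      moreover have "q' \<otimes> q \<in> Q" "a \<otimes> a' \<in> P" using * Qs Ps by (auto simp: subgroup.m_closed)
      ultimately show "(x, z) \<in> r" unfolding r_def using *(1,3) by blast
    qed
  qed
  moreover have "p * card P dvd card X" if "X \<in> M // r" for X
  proof -
    from that obtain x where x: "x \<in> M" "X = r `` {x}" by (auto elim: quotientE)
    let ?P' = "cnj x ` P"
    have P': "subgroup ?P' G" using x c by (intro subgroup_cnj Ps) auto
    have "X = (\<lambda>z. z \<otimes> x) ` (Q <#> ?P')"
    proof
      show "X \<subseteq> (\<lambda>z. z \<otimes> x) ` (Q <#> ?P')"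
      proof
        fix y assume "y \<in> X"
        then obtain q a where *: "q \<in> Q" "a \<in> P" "y = q \<otimes> x \<otimes> a" using x by (auto simp: r_def)
        hence "y = (q \<otimes> cnj x a) \<otimes> x" using c x by (simp add: group_word cnj_def)
        thus "y \<in> (\<lambda>z. z \<otimes> x) ` (Q <#> ?P')" using * set_multI[of q Q "cnj x a" ?P'] by blast
      qed
      show "(\<lambda>z. z \<otimes> x) ` (Q <#> ?P') \<subseteq> X"
      proof
        fix y assume "y \<in> (\<lambda>z. z \<otimes> x) ` (Q <#> ?P')"
        then obtain q a where *: "q \<in> Q" "a \<in> P" "y = (q \<otimes> cnj x a) \<otimes> x"
          by (auto elim!: set_multE)
        hence y: "y = q \<otimes> x \<otimes> a" using c x by (simp add: group_word cnj_def)
        moreover have "q \<in> M" "a \<in> M" using * Ps Qs by auto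
        hence "y \<in> M" unfolding y using x M by (simp add: subgroup.m_closed)
        ultimately show "y \<in> X" using x * by (auto simp: r_def)
      qed
    qed
    moreover have "Q <#> ?P' \<subseteq> carrier G"
      using P' Qs by (intro setmult_subset_G) (auto simp: subgroup.subset)
    hence "inj_on (\<lambda>z. z \<otimes> x) (Q <#> ?P')" using x c by (intro inj_onI) (auto simp: subset_eq)
    ultimately have cX: "card X = card (Q <#> ?P')" by (simp add: card_image)
    obtain k where k: "card Q = p ^ k" using Q by (auto simp: sylow_in_def)
    have I: "subgroup (Q \<inter> ?P') G" by (rule subgroup_Int[OF Qs(1) P'])
    have "card (Q \<inter> ?P') dvd p ^ k" using card_dvd[OF I Qs(1)] k by simp
    then obtain j where j: "j \<le> k" "card (Q \<inter> ?P') = p ^ j" using divides_primepow_nat[OF p] by blast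
    have "j \<noteq> k"
    proof
      assume "j = k"
      hence "Q \<inter> ?P' = Q" using j k by (intro card_subset_eq subgroup_finite[OF Qs(1)]) auto
      thus False using contr x by blast
    qed
    hence "k = Suc (k - j - 1) + j" using j by simp
    hence "p ^ k = p * p ^ (k - j - 1) * p ^ j" by (metis power_Suc power_add)
    moreover have "card X * p ^ j = p ^ k * card P"
      using card_set_mult[OF Qs(1) P'] k j cX card_cnj[OF _ Ps(1)] x c by simp
    ultimately have "card X * p ^ j = (p * p ^ (k - j - 1) * p ^ j) * card P" by (simp only:)
    hence "card X * p ^ j = (p * p ^ (k - j - 1) * card P) * p ^ j" by (simp only: mult_ac)
    moreover have "p ^ j \<noteq> 0" using prime_gt_0_nat[OF p] by simp
    ultimately have "card X = p * p ^ (k - j - 1) * card P" by (metis mult_right_cancel)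
    thus ?thesis by simp
  qed
  ultimately have "p * card P dvd card M"
    by (rule equiv_imp_dvd_card[OF subgroup_finite[OF M]])
  hence "p * card P dvd idx M P * card P" using idx_mult[OF Ps(1) M Ps(2)] by simp
  hence "p dvd idx M P" using card_pos[OF Ps(1)] by simp
  thus False using P by (simp add: sylow_in_def)
qed

text \<open>The subgroup \<open>c P c\<inverse>\<close> is a Sylow subgroup of \<open>M\<close> again, hence already conjugate to \<open>P\<close> under \<open>M\<close>.\<close>

lemma frattini:
  assumes C: "subgroup C G" and M: "subgroup M G" "normalizes C M"
    and p: "Factorial_Ring.prime p" and P: "sylow_in p P M" and c: "c \<in> C"
  shows "\<exists>m\<in>M. \<forall>x\<in>P. cnj (inv m \<otimes> c) x \<in> P"
proof -
  have Ps: "subgroup P G" "P \<subseteq> M" using P by (auto simp: sylow_in_def)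
  have cc: "c \<in> carrier G" by (rule sub_carrier[OF C c])
  have "cnj c ` P \<subseteq> M" using M(2) c Ps by (auto simp: normalizes_def)
  hence "sylow_in p (cnj c ` P) M"
    using P subgroup_cnj[OF cc Ps(1)] by (simp add: sylow_in_def idx_def card_cnj[OF cc])
  from sylow_in_conjugate[OF M(1) p P this] obtain m where m: "m \<in> M" "cnj c ` P \<subseteq> cnj m ` P" by auto
  have mc: "m \<in> carrier G" by (rule sub_carrier[OF M(1) m(1)])
  have "cnj (inv m \<otimes> c) x \<in> P" if x: "x \<in> P" for x
  proof -
    from m(2) x obtain y where y: "y \<in> P" "cnj c x = cnj m y" by auto
    have "cnj (inv m \<otimes> c) x = cnj (inv m) (cnj c x)" using x sub_carrier[OF Ps(1)] mc cc by (simp add: cnj_cnj)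
    also have "\<dots> = y" using y sub_carrier[OF Ps(1)] mc by simp
    finally show ?thesis using y by simp
  qed
  thus ?thesis using m(1) by blast
qed

text \<open>The conjugacy class of a noncentral element has order a power of \<open>p\<close> greater than \<open>1\<close>, so \<open>p\<close>
  divides the number of noncentral elements and with it the order of the center.\<close>

lemma prime_power_center:
  assumes p: "Factorial_Ring.prime p" and k: "card (carrier G) = p ^ k" and "k > 0"
  shows "\<exists>z\<in>carrier G. z \<noteq> \<one> \<and> (\<forall>x\<in>carrier G. cmt z x = \<one>)"
proof -
  define Z where "Z = {z \<in> carrier G. \<forall>x\<in>carrier G. cmt z x = \<one>}"
  define E where "E = carrier G - Z"
  let ?\<phi> = "\<lambda>g. \<lambda>h\<in>carrier G. g \<otimes> h \<otimes> inv g"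
  interpret A: group_action G "carrier G" ?\<phi> by (rule action_by_conjugation)
  have orb: "orbit G ?\<phi> x = {cnj g x | g. g \<in> carrier G}" if "x \<in> carrier G" for x
    using that by (simp add: orbit_def cnj_def)
  define r where "r = {(x, y). x \<in> E \<and> y \<in> E \<and> y \<in> orbit G ?\<phi> x}"
  have cmt1: "cmt z x = \<one> \<longleftrightarrow> cnj x z = z" if "z \<in> carrier G" "x \<in> carrier G" for z x
  proof -
    have "cmt z x = \<one> \<longleftrightarrow> cmt x z = \<one>" using cmt_swap[of x z] cmt_swap[of z x] that by (metis inv_one)
    also have "\<dots> \<longleftrightarrow> cnj x z = z" using that by (metis cmt_eq cnj_closed inv_closed inv_inv inv_equality r_inv)
    finally show ?thesis .
  qed
  have eqv: "equiv E r"
  proof (rule equivI)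
    show "r \<subseteq> E \<times> E" by (auto simp: r_def)
    show "refl_on E r" using A.orbit_refl by (auto simp: r_def refl_on_def E_def)
    show "sym r" using A.orbit_sym unfolding r_def E_def sym_def by blast
    show "trans r" using A.orbit_trans unfolding r_def E_def trans_def by blast
  qed
  have cls: "p dvd card X" if "X \<in> E // r" for X
  proof -
    from that obtain x where x: "x \<in> E" "X = r `` {x}" by (auto elim: quotientE)
    hence xc: "x \<in> carrier G" "x \<notin> Z" by (auto simp: E_def)
    have sub: "y \<in> E" if "y \<in> orbit G ?\<phi> x" for y
    proof -
      from that obtain g where g: "g \<in> carrier G" "y = cnj g x" unfolding orb[OF xc(1)] by blast
      have "y \<notin> Z"
      proof
        assume "y \<in> Z"
        hence "cnj (inv g) y = y" using g xc cmt1[of y "inv g"] by (auto simp: Z_def)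
        hence "y = x" using g xc by simp
        thus False using \<open>y \<in> Z\<close> xc by simp
      qed
      thus ?thesis using g xc by (simp add: E_def)
    qed
    have X: "X = orbit G ?\<phi> x" unfolding x(2) r_def using x(1) sub by blast
    have "card X * card (stabilizer G ?\<phi> x) = p ^ k"
      unfolding X using A.orbit_stabilizer_theorem[OF xc(1)] k by (simp only: order_def)
    hence "card X dvd p ^ k" by (rule dvdI[OF sym])
    then obtain j where j: "card X = p ^ j" using divides_primepow_nat[OF p] by blast
    have "j \<noteq> 0"
    proof
      assume "j = 0"
      hence "card X = 1" using j by simp
      moreover have "x \<in> X" using A.orbit_refl[OF xc(1)] X by simp
      ultimately have "X = {x}" by (metis card_1_singletonE singletonD)
      hence "cnj g x = x" if "g \<in> carrier G" for g using that X unfolding orb[OF xc(1)] by blast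
      thus False using xc cmt1[OF xc(1)] by (auto simp: Z_def)
    qed
    thus ?thesis using j by (simp add: dvd_power)
  qed
  have "finite E" by (simp add: E_def)
  hence "p dvd card E" using eqv cls by (rule equiv_imp_dvd_card)
  moreover have "p dvd card (carrier G)" using k \<open>k > 0\<close> by (simp add: dvd_power)
  moreover have "card E + card Z = card (carrier G)"
    unfolding E_def by (subst card_Diff_subset) (auto simp: Z_def card_mono)
  ultimately have "p dvd card Z" by (metis dvd_add_right_iff)
  moreover have one: "\<one> \<in> Z" by (simp add: Z_def cmt_def)
  ultimately have "Z \<noteq> {\<one>}" using p by (auto simp: prime_nat_iff)
  thus ?thesis using one by (auto simp: Z_def)
qed

lemma section_prime_power_center:
  assumes M: "subgroup M G" and K: "subgroup K G" "K \<subseteq> M" "normalizes M K"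
    and p: "Factorial_Ring.prime p" and k: "idx M K = p ^ k" and "k > 0"
  shows "\<exists>z\<in>M. z \<notin> K \<and> (\<forall>x\<in>M. cmt z x \<in> K)"
proof -
  let ?Q = "G\<lparr>carrier := M\<rparr> Mod K" and ?h = "\<lambda>x. K #> x"
  interpret E: finite_epi "G\<lparr>carrier := M\<rparr>" ?Q ?h
    by (rule section_epi(1)[OF M K])
  note ker = section_epi(2)[OF M K]
  have MM: "subgroup M (G\<lparr>carrier := M\<rparr>)" using E.G.subgroup_self by simp
  have KK: "subgroup K (G\<lparr>carrier := M\<rparr>)" using K M by (simp add: subgroup_subgroup_iff)
  have "card (carrier ?Q) = p ^ k"
    using E.card_image[OF MM] k E.h_surj by (simp add: ker K)
  from E.H.prime_power_center[OF p this \<open>k > 0\<close>] obtain z' where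
    z': "z' \<in> carrier ?Q" "z' \<noteq> \<one>\<^bsub>?Q\<^esub>" "\<And>x. x \<in> carrier ?Q \<Longrightarrow> E.H.cmt z' x = \<one>\<^bsub>?Q\<^esub>" by auto
  have "z' \<in> ?h ` M" using z'(1) E.h_surj by simp
  then obtain z where z: "z \<in> M" "z' = ?h z" by blast
  have memK: "x \<in> K \<longleftrightarrow> ?h x = \<one>\<^bsub>?Q\<^esub>" if "x \<in> M" for x
    using that ker K(2) by (auto simp: kernel_def)
  have "cmt z x \<in> K" if x: "x \<in> M" for x
  proof -
    have i: "inv\<^bsub>G\<lparr>carrier := M\<rparr>\<^esub> z = inv z" "inv\<^bsub>G\<lparr>carrier := M\<rparr>\<^esub> x = inv x" using x z M by auto
    have m: "inv z \<in> M" "inv x \<in> M" using x z M by (auto simp: subgroup.m_inv_closed)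
    have "?h (cmt z x) = E.H.cmt (?h z) (?h x)"
      using E.hom_mult[of "z \<otimes> x \<otimes> inv z" "inv x"] E.hom_mult[of "z \<otimes> x" "inv z"]
        E.hom_mult[of z x] E.hom_inv[of z] E.hom_inv[of x] x z i m M
      by (simp add: cmt_def E.H.cmt_def subgroup.m_closed)
    also have "\<dots> = \<one>\<^bsub>?Q\<^esub>" using z'(3) z x E.hom_closed by simp
    finally show ?thesis using memK[of "cmt z x"] x z m M by (simp add: cmt_def subgroup.m_closed)
  qed
  moreover have "z \<notin> K" using memK z z'(2) by simp
  ultimately show ?thesis using z(1) by blast
qed

text \<open>Let \<open>C\<close> be a minimal supplement of \<open>N\<close> in \<open>Y\<close> and suppose \<open>M = C \<inter> N\<close> is nontrivial.
  By minimality and the Frattini argument, all Sylow subgroups of \<open>M\<close> are normal in \<open>C\<close>, so a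
  chief factor \<open>M/K\<close> of \<open>C\<close> is a \<open>p\<close>-group, hence abelian, and has a complement in \<open>C/K\<close>: a
  smaller supplement of \<open>N\<close>.\<close>

theorem schur_zassenhaus:
  assumes Y: "subgroup Y G" and N: "subgroup N G" "N \<subseteq> Y" "normalizes Y N"
    and cop: "coprime (card N) (idx Y N)"
  shows "\<exists>C. subgroup C G \<and> C \<subseteq> Y \<and> C \<inter> N = {\<one>} \<and> C <#> N = Y"
proof -
  define S where "S C \<longleftrightarrow> subgroup C G \<and> C \<subseteq> Y \<and> C <#> N = Y" for C
  have SI: "S C'" if "subgroup C' G" "C' \<subseteq> Y" "C \<subseteq> C' <#> N" "S C" for C C'
  proof -
    have s: "subgroup (C' <#> N) G"
      using that N by (intro normalizes_set_mult) (auto intro: normalizes_mono)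
    have "Y \<subseteq> C' <#> N"
      using that(3,4) set_mult_leI[OF s that(3) subset_set_mult(2)[OF that(1) N(1)]] by (auto simp: S_def)
    moreover have "C' <#> N \<subseteq> Y" by (rule set_mult_leI[OF Y that(2) N(2)])
    ultimately show ?thesis using that by (auto simp: S_def)
  qed
  have "S Y" unfolding S_def using Y N set_mult_leI[OF Y] subset_set_mult[OF Y N(1)] by blast
  then obtain C where SC: "S C" and min: "\<And>C'. S C' \<Longrightarrow> card C \<le> card C'"
    using ex_has_least_nat[of S Y card] by blast
  have minimal: "C' = C" if "S C'" "C' \<subseteq> C" for C'
    using that(2) min[OF that(1)] SC by (intro card_seteq) (auto simp: S_def subgroup_finite)
  have C: "subgroup C G" "C \<subseteq> Y" "C <#> N = Y" using SC by (auto simp: S_def)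
  define M where "M = C \<inter> N"
  have M: "subgroup M G" "M \<subseteq> C" "M \<subseteq> N" unfolding M_def using subgroup_Int[OF C(1) N(1)] by auto
  have CN: "normalizes C N" using N(3) C(2) by (rule normalizes_mono)
  have CM: "normalizes C M" unfolding M_def by (intro normalizes_Int normalizes_self CN C)
  have "M = {\<one>}"
  proof (rule ccontr)
    assume M1: "M \<noteq> {\<one>}"
    define T where "T K \<longleftrightarrow> subgroup K G \<and> K \<subseteq> M \<and> K \<noteq> M \<and> normalizes C K" for K
    have "T {\<one>}" using M1 subgroup.one_closed[OF M(1)] sub_carrier[OF C(1)]
      by (auto simp: T_def normalizes_def cnj_def)
    moreover have "\<forall>K. T K \<longrightarrow> card K < Suc (card M)"
      using subgroup_finite[OF M(1)] by (auto simp: T_def less_Suc_eq_le intro: card_mono)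
    ultimately obtain K where "T K" and max: "\<And>K'. T K' \<Longrightarrow> card K' \<le> card K"
      using ex_has_greatest_nat[of T "{\<one>}" card "Suc (card M)"] by blast
    hence K: "subgroup K G" "K \<subseteq> M" "K \<noteq> M" "normalizes C K" by (auto simp: T_def)
    have maximal: "K' = M" if "subgroup K' G" "K \<subset> K'" "K' \<subseteq> M" "normalizes C K'" for K'
    proof (rule ccontr)
      assume "K' \<noteq> M"
      hence "card K' \<le> card K" using that by (intro max) (auto simp: T_def)
      moreover have "card K < card K'" using that subgroup_finite by (intro psubset_card_mono) auto
      ultimately show False by simp
    qed
    have "idx M K \<noteq> 1" using idx_eq_1[OF K(1) M(1) K(2)] K(3) by blast
    then obtain p where p: "Factorial_Ring.prime p" "p dvd idx M K" using prime_factor_nat by blast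
    obtain P where P: "sylow_in p P M" using sylow_in_exists[OF M(1) p(1)] by blast
    have Ps: "subgroup P G" "P \<subseteq> M" "\<not> p dvd idx M P" and "\<exists>k. card P = p ^ k"
      using P by (auto simp: sylow_in_def)
    then obtain k where k: "card P = p ^ k" by blast
    define D where "D = {c \<in> C. \<forall>Q\<in>{P}. \<forall>q\<in>Q. cnj c q \<in> Q}"
    have D: "subgroup D G" unfolding D_def by (rule common_normalizer_subgroup[OF C(1)]) (use Ps in auto)
    have DC: "D \<subseteq> C" by (auto simp: D_def)
    have "C \<subseteq> D <#> N"
    proof
      fix c assume c: "c \<in> C"
      from frattini[OF C(1) M(1) CM p(1) P c] obtain m where
        m: "m \<in> M" "\<And>x. x \<in> P \<Longrightarrow> cnj (inv m \<otimes> c) x \<in> P" by auto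
      have d: "inv m \<otimes> c \<in> D"
        using m c M C(1) by (auto simp: D_def subgroup.m_closed subgroup.m_inv_closed subset_eq)
      have DN: "D <#> N = N <#> D"
        using normalizes_commute[OF D N(1) normalizes_mono[OF CN DC]] .
      have "c = m \<otimes> (inv m \<otimes> c)" using m c M C sub_carrier by simp
      thus "c \<in> D <#> N" unfolding DN using set_multI[of m N _ D] d m(1) M(3) by (metis subsetD)
    qed
    hence "S D" using SI[OF D _ _ SC] DC C by blast
    hence "D = C" using minimal DC by blast
    hence CP: "normalizes C P" by (auto simp: D_def normalizes_def)
    have PK: "normalizes P K" using K(4) Ps M normalizes_mono by blast
    have PKs: "subgroup (P <#> K) G" by (rule normalizes_set_mult(1)[OF Ps(1) K(1) PK])
    have "\<not> P \<subseteq> K"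
    proof
      assume "P \<subseteq> K"
      hence "idx M K * idx K P = idx M P" using idx_chain[OF Ps(1) K(1) M(1)] K by simp
      thus False using p Ps by (metis dvd_mult2)
    qed
    hence "P <#> K = M"
      using subset_set_mult[OF Ps(1) K(1)] set_mult_leI[OF M(1) Ps(2) K(2)]
        normalizes_product[OF C(1) Ps(1) K(1) CP K(4)]
      by (intro maximal PKs) auto
    hence "idx M K = idx P (P \<inter> K)" using idx_set_mult[OF Ps(1) K(1) PKs] by simp
    hence "idx M K dvd p ^ k"
      using idx_mult[OF subgroup_Int[OF Ps(1) K(1)] Ps(1)] k by (metis Int_lower1 dvd_triv_left)
    then obtain j where j: "idx M K = p ^ j" using divides_primepow_nat[OF p(1)] by blast
    have "j > 0" using j p by (metis gr0I not_prime_unit power_0)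
    have MK: "normalizes M K" using K(4) M(2) by (rule normalizes_mono)
    define Z where "Z = {z \<in> M. \<forall>x\<in>M. cmt z x \<in> K}"
    have Z: "subgroup Z G" "normalizes C Z" unfolding Z_def
      using relative_centralizer[OF M(1) K(1) MK subgroup.subset[OF M(1)]] C(1) CM K(4) by auto
    have KZ: "K \<subseteq> Z"
    proof
      fix z assume z: "z \<in> K"
      have "cmt z x \<in> K" if x: "x \<in> M" for x
      proof -
        have c: "z \<in> carrier G" "x \<in> carrier G" using z x K M sub_carrier by blast+
        have "cmt z x = z \<otimes> cnj x (inv z)" using c by (simp add: cmt_def cnj_def group_word)
        thus ?thesis using z x MK K(1)
          by (simp add: normalizes_def subgroup.m_closed subgroup.m_inv_closed)
      qed
      thus "z \<in> Z" using z K by (auto simp: Z_def)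
    qed
    moreover have "Z \<noteq> K"
      using section_prime_power_center[OF M(1) K(1,2) MK p(1) j \<open>j > 0\<close>] by (auto simp: Z_def)
    ultimately have "Z = M" using maximal[OF Z(1)] Z(2) by (auto simp: Z_def)
    hence comm: "x \<otimes> y \<otimes> inv x \<otimes> inv y \<in> K" if "x \<in> M" "y \<in> M" for x y
      using that by (auto simp: Z_def cmt_def)
    have "idx C M = idx Y N"
      unfolding M_def using idx_set_mult[OF C(1) N(1)] C(3) Y by simp
    moreover have "idx M K dvd card N"
      using idx_mult[OF K(1) M(1) K(2)] card_dvd[OF M(1) N(1) M(3)] by (metis dvd_mult_left)
    ultimately have "coprime (idx M K) (idx C M)" using cop coprime_divisors by fastforce
    from section_complement_abelian[OF C(1) M(1,2) CM K(1,2,4) comm this]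
    obtain C1 where C1: "subgroup C1 G" "C1 \<subseteq> C" "C1 \<inter> M = K" "C1 <#> M = C" by auto
    have "C \<subseteq> C1 <#> N" using C1(4) M(3) mono_set_mult[of C1 C1 M N G] by simp
    hence "S C1" using SI[OF C1(1) _ _ SC] C1 C by blast
    hence "C1 = C" using minimal C1 by blast
    thus False using C1 M K by blast
  qed
  thus ?thesis using C M_def by blast
qed

lemma section_schur_zassenhaus:
  assumes Y: "subgroup Y G" and N: "subgroup N G" "N \<subseteq> Y" "normalizes Y N"
    and K: "subgroup K G" "K \<subseteq> N" "normalizes Y K"
    and cop: "coprime (idx N K) (idx Y N)"
  shows "\<exists>C. subgroup C G \<and> C \<subseteq> Y \<and> C \<inter> N = K \<and> C <#> N = Y"
proof (rule section_complement[OF Y N K cop])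
  have KY: "K \<subseteq> Y" using K N by simp
  let ?Q = "G\<lparr>carrier := Y\<rparr> Mod K" and ?A = "(\<lambda>x. K #> x) ` N"
  interpret E: finite_epi "G\<lparr>carrier := Y\<rparr>" ?Q "\<lambda>x. K #> x"
    by (rule section_epi(1)[OF Y K(1) KY K(3)])
  assume A: "?A \<lhd> ?Q" and cop': "coprime (card ?A) (idx (carrier ?Q) ?A)"
  have As: "subgroup ?A ?Q" "E.H.normalizes (carrier ?Q) ?A" using A by (simp_all add: E.H.normal_iff_normalizes)
  show "\<exists>C. subgroup C ?Q \<and> C \<inter> ?A = {\<one>\<^bsub>?Q\<^esub>} \<and> C <#>\<^bsub>?Q\<^esub> ?A = carrier ?Q"
    using E.H.schur_zassenhaus[OF E.H.subgroup_self As(1) subgroup.subset[OF As(1)] As(2) cop'] by blast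
qed

end

section \<open>Power automorphisms\<close>

text \<open>In \<open>k\<^sup>m - l\<^sup>m = (k - l) s\<close> the cofactor \<open>s\<close> is congruent to \<open>m k ^ (m - 1)\<close> modulo
  each prime divisor of \<open>n\<close>, hence prime to \<open>n\<close>.\<close>

lemma cong_of_cong_primes:
  fixes k l m n :: nat
  assumes n: "n > 0" and k: "[k ^ m = 1] (mod n)" and l: "[l ^ m = 1] (mod n)" and cop: "coprime m n"
    and pr: "\<And>p. Factorial_Ring.prime p \<Longrightarrow> p dvd n \<Longrightarrow> [k = l] (mod p)"
  shows "[k = l] (mod n)"
proof (cases "m = 0")
  case True
  thus ?thesis using cop by simp
next
  case False
  define s :: int where "s = (\<Sum>i<m. int l ^ (m - Suc i) * int k ^ i)"
  have "int k ^ m - int l ^ m = (int k - int l) * s"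
    unfolding s_def by (rule power_diff_sumr2)
  moreover have "[k ^ m = l ^ m] (mod n)" using k l cong_sym cong_trans by blast
  hence "[int k ^ m = int l ^ m] (mod int n)" by (metis cong_int_iff of_nat_power)
  hence "int n dvd int k ^ m - int l ^ m" by (simp add: cong_iff_dvd_diff)
  ultimately have d: "int n dvd (int k - int l) * s" by simp
  have "coprime (int n) s"
  proof (rule ccontr)
    assume "\<not> coprime (int n) s"
    hence "gcd (int n) s \<noteq> 1" by (simp add: coprime_iff_gcd_eq_1)
    moreover have "gcd (int n) s > 0" using n by simp
    ultimately have "nat (gcd (int n) s) \<noteq> 1" by linarith
    then obtain p where p: "Factorial_Ring.prime p" "p dvd nat (gcd (int n) s)"
      using prime_factor_nat by blast
    hence "int p dvd gcd (int n) s" using \<open>gcd (int n) s > 0\<close>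
      by (metis int_dvd_int_iff less_imp_le nat_0_le)
    hence pn: "p dvd n" and ps: "int p dvd s" by auto
    have kl: "[int l = int k] (mod int p)" using pr[OF p(1) pn] by (simp add: cong_int_iff cong_sym)
    have "[s = (\<Sum>i<m. int k ^ (m - Suc i) * int k ^ i)] (mod int p)"
      unfolding s_def by (intro cong_sum cong_mult cong_pow kl cong_refl)
    also have "(\<Sum>i<m. int k ^ (m - Suc i) * int k ^ i) = (\<Sum>i<m. int k ^ (m - 1))"
      by (intro sum.cong refl) (simp flip: power_add)
    also have "\<dots> = int (m * k ^ (m - 1))" by simp
    finally have "int p dvd int (m * k ^ (m - 1))" using ps by (simp add: cong_dvd_iff)
    hence "p dvd m * k ^ (m - 1)" by (simp only: int_dvd_int_iff)
    hence "p dvd m \<or> p dvd k" using p(1) prime_dvd_mult_iff prime_dvd_power by blast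
    moreover have "\<not> p dvd m"
      using cop pn p(1) by (metis coprime_common_divisor not_prime_unit)
    moreover have "\<not> p dvd k"
    proof
      assume "p dvd k"
      hence "p dvd k ^ m" using False by (simp add: dvd_power_le[of p k 1 m, simplified] prime_dvd_power_iff p(1))
      moreover have "[k ^ m = 1] (mod p)" using k pn by (rule cong_dvd_modulus_nat)
      ultimately have "p dvd 1" using cong_dvd_iff by blast
      thus False using p(1) not_prime_unit by blast
    qed
    ultimately show False by blast
  qed
  hence "int n dvd int k - int l" using d by (simp add: coprime_dvd_mult_left_iff)
  thus ?thesis by (simp flip: cong_int_iff add: cong_iff_dvd_diff)
qed

context finite_group
begin

lemma pow_eq_iff_cong:
  "x \<in> carrier G \<Longrightarrow> x [^] (k::nat) = x [^] (l::nat) \<longleftrightarrow> [k = l] (mod ord x)"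
  using int_pow_eq[of x "int l" "int k"]
  by (metis int_pow_int cong_iff_dvd_diff cong_int_iff)

lemma pow_eq_self_iff: "x \<in> carrier G \<Longrightarrow> x [^] (k::nat) = x \<longleftrightarrow> [k = 1] (mod ord x)"
  using pow_eq_iff_cong[of x k 1] by simp

text \<open>In a finite group natural exponents suffice, and they keep the exponents of power automorphisms
  within congruences of natural numbers.\<close>

definition cyc :: "'a \<Rightarrow> 'a set" where
  "cyc x = range (\<lambda>n::nat. x [^] n)"

lemma subgroup_cyc:
  assumes x: "x \<in> carrier G"
  shows "subgroup (cyc x) G"
proof (rule subgroupI)
  fix y assume "y \<in> cyc x"
  then obtain n :: nat where n: "y = x [^] n" by (auto simp: cyc_def)
  have "y \<otimes> y [^] (card (carrier G) - 1) = y [^] (Suc (card (carrier G) - 1))"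
    using x n by (subst nat_pow_Suc2) auto
  also have "\<dots> = \<one>" using pow_card[OF subgroup_self, of y] card_pos[OF subgroup_self] x n by simp
  finally have "inv y = y [^] (card (carrier G) - 1)"
    using x n by (metis inv_equality inv_inv nat_pow_closed r_inv l_inv m_closed inv_unique' )
  also have "\<dots> = x [^] (n * (card (carrier G) - 1))" using x n by (simp add: nat_pow_pow)
  finally show "inv y \<in> cyc x" by (auto simp: cyc_def)
next
  fix y z assume "y \<in> cyc x" "z \<in> cyc x"
  then obtain n m :: nat where "y = x [^] n" "z = x [^] m" by (auto simp: cyc_def)
  hence "y \<otimes> z = x [^] (n + m)" using x by (simp add: nat_pow_mult)
  thus "y \<otimes> z \<in> cyc x" by (auto simp: cyc_def)
qed (use x in \<open>auto simp: cyc_def\<close>)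

lemma cyc_subset: "subgroup A G \<Longrightarrow> x \<in> A \<Longrightarrow> cyc x \<subseteq> A"
  by (auto simp: cyc_def subgroup_pow)

lemma cyc_self: "x \<in> carrier G \<Longrightarrow> x \<in> cyc x"
  unfolding cyc_def by (rule range_eqI[of _ _ 1]) simp

lemma ord_eq_prime:
  assumes "x \<in> carrier G" "x \<noteq> \<one>" "x [^] p = \<one>" "Factorial_Ring.prime (p::nat)"
  shows "ord x = p"
proof -
  have "ord x dvd p" using assms by (simp add: pow_eq_id[symmetric])
  moreover have "ord x \<noteq> 1" using assms ord_eq_1 by blast
  ultimately show ?thesis using assms(4) by (metis prime_nat_iff)
qed

lemma generator_of_prime_cyc:
  assumes x: "x \<in> carrier G" "x [^] p = \<one>" and p: "Factorial_Ring.prime (p::nat)"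
    and y: "y \<in> cyc x" "y \<noteq> \<one>"
  shows "x \<in> cyc y"
proof -
  from y obtain n :: nat where n: "y = x [^] n" by (auto simp: cyc_def)
  have "\<not> p dvd n" using y n x by (metis dvd_def nat_pow_one nat_pow_pow)
  hence "coprime n p" using p by (metis coprime_commute prime_imp_coprime)
  then obtain u :: nat where u: "\<And>a. a \<in> carrier G \<Longrightarrow> a [^] p = \<one> \<Longrightarrow> (a [^] n) [^] u = a"
    by (rule coprime_root) blast
  have "x = y [^] u" using u x n by simp
  thus ?thesis unfolding cyc_def by blast
qed

lemma cnj_iterate:
  assumes x: "x \<in> carrier G" and y: "y \<in> carrier G" and j: "cnj x y = y [^] (j::nat)"
  shows "cnj (x [^] (n::nat)) y = y [^] (j ^ n)"
proof (induction n)
  case (Suc n)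
  have "cnj (x [^] Suc n) y = cnj (x [^] n) (cnj x y)" using x y by (simp add: cnj_cnj)
  also have "\<dots> = (cnj (x [^] n) y) [^] j" using x y j by (simp add: cnj_pow)
  also have "\<dots> = y [^] (j ^ n * j)" using Suc y by (simp add: nat_pow_pow)
  finally show ?case by (simp add: mult.commute)
qed (use y in \<open>simp add: cnj_def\<close>)

text \<open>When \<open>N\<close> is normal in \<open>M\<close>, the automorphisms of \<open>M/N\<close> that map all subgroups to themselves are its
  power automorphisms: they map every element to one of its powers.\<close>

definition acts_by_powers :: "'a set \<Rightarrow> 'a set \<Rightarrow> 'a set \<Rightarrow> bool" where
  "acts_by_powers A N M \<longleftrightarrow> (\<forall>Q. subgroup Q G \<and> N \<subseteq> Q \<and> Q \<subseteq> M \<longrightarrow> normalizes A Q)"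

lemma acts_by_powersD:
  "acts_by_powers A N M \<Longrightarrow> subgroup Q G \<Longrightarrow> N \<subseteq> Q \<Longrightarrow> Q \<subseteq> M \<Longrightarrow> normalizes A Q"
  by (simp add: acts_by_powers_def)

lemma acts_by_powers_mono: "acts_by_powers A N M \<Longrightarrow> A' \<subseteq> A \<Longrightarrow> acts_by_powers A' N M"
  by (auto simp: acts_by_powers_def intro: normalizes_mono)

lemma acts_by_powers_cyc:
  assumes "acts_by_powers A {\<one>} F" "subgroup F G" "a \<in> A" "x \<in> F"
  obtains k :: nat where "cnj a x = x [^] k"
proof -
  have x: "x \<in> carrier G" by (rule sub_carrier[OF assms(2,4)])
  have "normalizes A (cyc x)"
    by (rule acts_by_powersD[OF assms(1) subgroup_cyc[OF x]])
      (use subgroup.one_closed[OF subgroup_cyc[OF x]] cyc_subset[OF assms(2,4)] in auto)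
  hence "cnj a x \<in> cyc x" using assms(3) cyc_self[OF x] by (simp add: normalizes_def)
  thus ?thesis using that by (auto simp: cyc_def)
qed

text \<open>An element that normalizes all subgroups between \<open>N\<close> and \<open>M\<close> normalizes both \<open>Q\<close> and \<open>x\<inverse> Q x\<close>, so
  its commutator with \<open>x\<close> normalizes \<open>Q\<close>.\<close>

lemma acts_by_powers_cmt:
  assumes A: "acts_by_powers {a} N M" and M: "subgroup M G" and N: "subgroup N G" "N \<subseteq> M" "normalizes M N"
    and a: "a \<in> carrier G" and x: "x \<in> M"
  shows "acts_by_powers {cmt a x} N M"
  unfolding acts_by_powers_def normalizes_def
proof (intro allI impI ballI, elim conjE, clarify)
  fix Q q assume Q: "subgroup Q G" "N \<subseteq> Q" "Q \<subseteq> M" "q \<in> Q"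
  have xc: "x \<in> carrier G" and qc: "q \<in> carrier G" using sub_carrier M x Q by blast+
  define Q' where "Q' = cnj (inv x) ` Q"
  have Q': "subgroup Q' G" unfolding Q'_def using xc Q by (simp add: subgroup_cnj)
  have "Q' \<subseteq> M"
    unfolding Q'_def using x M Q normalizes_self[OF M]
    by (auto simp: normalizes_def subgroup.m_inv_closed)
  moreover have "N \<subseteq> Q'"
  proof
    fix n assume n: "n \<in> N"
    have "cnj x n \<in> Q" using N(3) x n Q by (auto simp: normalizes_def)
    moreover have "n = cnj (inv x) (cnj x n)" using xc n sub_carrier[OF N(1)] by simp
    ultimately show "n \<in> Q'" unfolding Q'_def by blast
  qed
  ultimately have nQ: "normalizes {a} Q" "normalizes {a} Q'" using Q Q' A by (auto dest: acts_by_powersD)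
  have "cnj a ` Q' = Q'" by (rule normalizes_image_eq[OF Q' a]) (use nQ in \<open>auto simp: normalizes_def\<close>)
  moreover have "cnj (inv x) q \<in> Q'" using Q by (simp add: Q'_def)
  ultimately obtain q1 where q1: "q1 \<in> Q'" "cnj (inv x) q = cnj a q1" by blast
  then obtain q2 where q2: "q2 \<in> Q" "q1 = cnj (inv x) q2" by (auto simp: Q'_def)
  have q2c: "q2 \<in> carrier G" using q2 Q sub_carrier by blast
  have "cnj (cmt a x) q = cnj a (cnj x (cnj (inv a) (cnj (inv x) q)))"
    using a xc qc by (simp add: cmt_def cnj_cnj group_word)
  also have "\<dots> = cnj a q2" using q1 q2 a xc q2c by simp
  finally show "cnj (cmt a x) q \<in> Q" using nQ(1) q2(1) by (simp add: normalizes_def)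
qed

text \<open>If \<open>x\<close> has order \<open>p\<close> and is moved by \<open>t\<close>, then \<open>x\<close> lies in \<open>\<langle>[t,x]\<rangle>\<close> and so normalizes, hence
  centralizes, every subgroup \<open>\<langle>y\<rangle>\<close> of order \<open>p\<close>; comparing the values of \<open>t\<close> at \<open>x\<close>, \<open>y\<close> and \<open>xy\<close>
  then shows that the exponents agree.\<close>

lemma moved_power_uniform:
  assumes F: "subgroup F G" and A: "acts_by_powers {t} {\<one>} F" and t: "t \<in> carrier G"
    and p: "Factorial_Ring.prime (p::nat)"
    and x: "x \<in> F" "x [^] p = \<one>" "cnj t x = x [^] (k::nat)" "cnj t x \<noteq> x"
    and y: "y \<in> F" "y [^] p = \<one>"
  shows "cnj t y = y [^] k"
proof (cases "y \<in> cyc x")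
  case True
  have xc: "x \<in> carrier G" by (rule sub_carrier[OF F x(1)])
  from True obtain i :: nat where i: "y = x [^] i" by (auto simp: cyc_def)
  have "cnj t y = (x [^] k) [^] i" using xc t x(3) i by (simp add: cnj_pow)
  also have "\<dots> = y [^] k" using xc i by (simp add: nat_pow_pow mult.commute)
  finally show ?thesis .
next
  case False
  have xc: "x \<in> carrier G" and yc: "y \<in> carrier G" using sub_carrier[OF F] x y by auto
  have x1: "x \<noteq> \<one>" using x(4) t by auto
  have y1: "y \<noteq> \<one>" using False subgroup.one_closed[OF subgroup_cyc[OF xc]] by auto
  have one: "normalizes F {\<one>}" using sub_carrier[OF F] by (auto simp: normalizes_def)
  have Ac: "acts_by_powers {cmt t x} {\<one>} F"
    by (rule acts_by_powers_cmt[OF A F subgroup_one _ one t x(1)]) (simp add: subgroup.one_closed[OF F])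
  have "cmt t x = x [^] k \<otimes> inv x" using x(3) by (simp add: cmt_eq)
  moreover have "\<dots> \<in> cyc x" using subgroup_cyc[OF xc] cyc_self[OF xc]
    by (auto simp: cyc_def intro!: subgroup.m_closed subgroup.m_inv_closed)
  moreover have "cmt t x \<noteq> \<one>"
    using x(4) t xc by (metis cmt_eq cnj_closed inv_closed inv_inv inv_equality r_inv)
  ultimately have "x \<in> cyc (cmt t x)" using generator_of_prime_cyc[OF xc x(2) p] by simp
  moreover have "cyc (cmt t x) \<subseteq> {c \<in> carrier G. \<forall>Q\<in>{Q. subgroup Q G \<and> Q \<subseteq> F}. \<forall>q\<in>Q. cnj c q \<in> Q}"
  proof (rule cyc_subset[OF common_normalizer_subgroup[OF subgroup_self]])
    show "cmt t x \<in> {c \<in> carrier G. \<forall>Q\<in>{Q. subgroup Q G \<and> Q \<subseteq> F}. \<forall>q\<in>Q. cnj c q \<in> Q}"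
      using Ac t xc subgroup.one_closed by (auto simp: acts_by_powers_def normalizes_def)
  qed auto
  ultimately have "cnj x y \<in> cyc y"
    using subgroup_cyc[OF yc] cyc_subset[OF F y(1)] cyc_self[OF yc] by blast
  then obtain j :: nat where j: "cnj x y = y [^] j" by (auto simp: cyc_def)
  have "y [^] (j ^ p) = y"
    using cnj_iterate[OF xc yc j, of p] x(2) yc by (simp add: cnj_def)
  hence jp: "[j ^ p = 1] (mod p)" using pow_eq_self_iff[OF yc] ord_eq_prime[OF yc y1 y(2) p] by simp
  have "\<not> p dvd j"
  proof
    assume "p dvd j"
    hence "p dvd j ^ p" using p by (simp add: prime_dvd_power_iff prime_gt_0_nat)
    hence "p dvd 1" using jp cong_dvd_iff by blast
    thus False using p not_prime_unit by blast
  qed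
  hence "[j ^ (p - 1) = 1] (mod p)" using fermat_theorem p by blast
  hence "[j * j ^ (p - 1) = j * 1] (mod p)" by (rule cong_scalar_left)
  moreover have "j * j ^ (p - 1) = j ^ p" using prime_gt_0_nat[OF p] by (metis power_eq_if neq0_conv)
  ultimately have "[j = 1] (mod p)" using jp by (metis cong_sym cong_trans mult.right_neutral)
  hence "y [^] j = y" using pow_eq_self_iff[OF yc] ord_eq_prime[OF yc y1 y(2) p] by simp
  hence "cnj x y = y" using j yc by simp
  hence xy: "x \<otimes> y = y \<otimes> x" using xc yc by (metis cnj_def inv_solve_right' m_closed)
  obtain l :: nat where l: "cnj t y = y [^] l" by (rule acts_by_powers_cyc[OF A F _ y(1)]) auto
  obtain m :: nat where m: "cnj t (x \<otimes> y) = (x \<otimes> y) [^] m"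
    by (rule acts_by_powers_cyc[OF A F, of t "x \<otimes> y"]) (use x y F in \<open>auto simp: subgroup.m_closed\<close>)
  have eq: "x [^] k \<otimes> y [^] l = x [^] m \<otimes> y [^] m"
    using m l x(3) t xc yc by (simp add: cnj_mult pow_mult_distrib[OF xy])
  have "inv (x [^] m) \<otimes> x [^] k = inv (x [^] m) \<otimes> (x [^] k \<otimes> y [^] l) \<otimes> inv (y [^] l)"
    using xc yc by (simp add: m_assoc)
  also have "\<dots> = y [^] m \<otimes> inv (y [^] l)" unfolding eq using xc yc by (simp add: m_assoc)
  finally have e: "inv (x [^] m) \<otimes> x [^] k = y [^] m \<otimes> inv (y [^] l)" .
  define e where "e = inv (x [^] m) \<otimes> x [^] k"
  have "x [^] m \<in> cyc x" "x [^] k \<in> cyc x" "y [^] m \<in> cyc y" "y [^] l \<in> cyc y" by (auto simp: cyc_def)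
  hence ex: "e \<in> cyc x" and ey: "e \<in> cyc y"
    unfolding e_def using subgroup_cyc[OF xc] subgroup_cyc[OF yc]
    by (simp_all add: subgroup.m_closed subgroup.m_inv_closed) (simp add: e subgroup.m_closed subgroup.m_inv_closed)
  have "e = \<one>"
  proof (rule ccontr)
    assume "e \<noteq> \<one>"
    hence "y \<in> cyc e" using generator_of_prime_cyc[OF yc y(2) p ey] by simp
    thus False using cyc_subset[OF subgroup_cyc[OF xc] ex] False by blast
  qed
  have "x [^] k = x [^] m \<otimes> e" "y [^] m = e \<otimes> y [^] l"
    using xc yc by (simp add: e_def, simp add: e_def e m_assoc)
  hence xm: "x [^] k = x [^] m" and ym: "y [^] m = y [^] l" using \<open>e = \<one>\<close> xc yc by simp_all
  from xm have "[k = m] (mod p)" using pow_eq_iff_cong[OF xc] ord_eq_prime[OF xc x1 x(2) p] by simp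
  hence "y [^] k = y [^] m" using pow_eq_iff_cong[OF yc] ord_eq_prime[OF yc y1 y(2) p] by simp
  thus ?thesis using l ym by simp
qed

text \<open>If \<open>t\<close> fixes \<open>x\<close>, it fixes \<open>y\<close> too, since otherwise the preceding lemma, applied with \<open>y\<close> as the
  moved element, would determine the action on \<open>x\<close> as a nontrivial one.\<close>

lemma power_uniform:
  assumes F: "subgroup F G" and A: "acts_by_powers {t} {\<one>} F" and t: "t \<in> carrier G"
    and p: "Factorial_Ring.prime (p::nat)"
    and x: "x \<in> F" "x [^] p = \<one>" "x \<noteq> \<one>" "cnj t x = x [^] (k::nat)"
    and y: "y \<in> F" "y [^] p = \<one>"
  shows "cnj t y = y [^] k"
proof (cases "cnj t x = x")
  case False
  thus ?thesis using moved_power_uniform[OF F A t p x(1,2,4) _ y] by blast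
next
  case True
  have xc: "x \<in> carrier G" and yc: "y \<in> carrier G" using sub_carrier[OF F] x y by auto
  have ox: "ord x = p" by (rule ord_eq_prime[OF xc x(3,2) p])
  show ?thesis
  proof (cases "y = \<one>")
    case y1: False
    have oy: "ord y = p" by (rule ord_eq_prime[OF yc y1 y(2) p])
    have "x [^] k = x" using x True xc by simp
    hence "[k = 1] (mod p)" using pow_eq_self_iff[OF xc] ox by simp
    hence yk: "y [^] k = y" using pow_eq_self_iff[OF yc] oy by simp
    have "cnj t y = y"
    proof (rule ccontr)
      assume m: "cnj t y \<noteq> y"
      obtain l :: nat where l: "cnj t y = y [^] l" by (rule acts_by_powers_cyc[OF A F _ y(1)]) auto
      have "cnj t x = x [^] l" by (rule moved_power_uniform[OF F A t p y l m x(1,2)])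
      hence "x [^] l = x" using True xc by simp
      hence "[l = 1] (mod p)" using pow_eq_self_iff[OF xc] ox by simp
      hence "y [^] l = y" using pow_eq_self_iff[OF yc] oy by simp
      thus False using l m yc by simp
    qed
    thus ?thesis using yk yc by simp
  qed (use t in simp)
qed

text \<open>By uniformity the exponents with which \<open>t\<close> and \<open>v t v\<inverse>\<close> act on \<open>x\<close> agree modulo every prime that
  divides the order of \<open>x\<close>; as \<open>m\<close> is prime to \<open>|F|\<close>, they agree modulo that order.\<close>

lemma conjugate_power_actions_equal:
  assumes F: "subgroup F G" and V: "v \<in> carrier G" "normalizes {inv v} F"
    and t: "t \<in> carrier G" "t [^] m = \<one>" and cop: "coprime (m::nat) (card F)"
    and A: "acts_by_powers {t} {\<one>} F" and A': "acts_by_powers {cnj v t} {\<one>} F" and x: "x \<in> F"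
  shows "cnj (cnj v t) x = cnj t x"
proof -
  define s where "s = cnj v t"
  have sc: "s \<in> carrier G" using V t by (simp add: s_def)
  have sm: "s [^] m = \<one>" using V t by (simp add: s_def cnj_pow[symmetric])
  have xc: "x \<in> carrier G" by (rule sub_carrier[OF F x])
  obtain k :: nat where k: "cnj t x = x [^] k" by (rule acts_by_powers_cyc[OF A F _ x]) auto
  obtain l :: nat where l: "cnj s x = x [^] l" by (rule acts_by_powers_cyc[OF A' F _ x]) (auto simp: s_def)
  have od: "ord x dvd card F" using pow_card[OF F x] by (simp add: pow_eq_id[OF xc, symmetric])
  have ox: "ord x > 0" using od card_pos[OF F] by (metis dvd_0_left_iff gr0I not_less_zero)
  have "[k = l] (mod ord x)"
  proof (rule cong_of_cong_primes[OF ox])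
    have "x [^] (k ^ m) = x"
      using cnj_iterate[OF t(1) xc k, of m] t xc by (simp add: cnj_def)
    thus "[k ^ m = 1] (mod ord x)" using pow_eq_self_iff[OF xc] by simp
    have "x [^] (l ^ m) = x"
      using cnj_iterate[OF sc xc l, of m] sm xc by (simp add: cnj_def)
    thus "[l ^ m = 1] (mod ord x)" using pow_eq_self_iff[OF xc] by simp
    show "coprime m (ord x)" using cop od coprime_divisors dvd_refl by blast
  next
    fix p :: nat assume p: "Factorial_Ring.prime p" "p dvd ord x"
    define x0 where "x0 = x [^] (ord x div p)"
    have x0F: "x0 \<in> F" unfolding x0_def by (rule subgroup_pow[OF F x])
    have x0c: "x0 \<in> carrier G" by (rule sub_carrier[OF F x0F])
    have x0p: "x0 [^] p = \<one>" unfolding x0_def using xc p by (simp add: nat_pow_pow)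
    have x01: "x0 \<noteq> \<one>"
    proof
      assume "x0 = \<one>"
      hence "ord x dvd ord x div p" using pow_eq_id[OF xc, of "ord x div p"] by (simp add: x0_def)
      hence "ord x \<le> ord x div p" using p ox by (metis dvd_div_eq_0_iff dvd_imp_le gr0I less_not_refl)
      moreover have "ord x div p < ord x" using ox prime_gt_1_nat[OF p(1)] by simp
      ultimately show False by simp
    qed
    have k0: "cnj t x0 = x0 [^] k"
      unfolding x0_def using t xc k by (simp add: cnj_pow nat_pow_pow mult.commute)
    have l0: "cnj s x0 = x0 [^] l"
      unfolding x0_def using sc xc l by (simp add: cnj_pow nat_pow_pow mult.commute)
    define y where "y = cnj (inv v) x0"
    have y: "y \<in> F" "y [^] p = \<one>" unfolding y_def using V x0F x0c x0p
      by (auto simp: normalizes_def cnj_pow[symmetric])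
    have "cnj t y = y [^] k" by (rule power_uniform[OF F A t(1) p(1) x0F x0p x01 k0 y])
    hence "cnj v (cnj t (cnj (inv v) x0)) = cnj v (cnj (inv v) x0 [^] k)" by (simp add: y_def)
    moreover have "cnj v (cnj t (cnj (inv v) x0)) = cnj s x0"
      using V t x0c by (simp add: s_def cnj_def group_word)
    moreover have "cnj v (cnj (inv v) x0 [^] k) = x0 [^] k"
      using V x0c by (simp add: cnj_pow)
    ultimately have "x0 [^] k = x0 [^] l" using l0 by simp
    thus "[k = l] (mod p)" using pow_eq_iff_cong[OF x0c] ord_eq_prime[OF x0c x01 x0p p(1)] by simp
  qed
  hence "x [^] k = x [^] l" using pow_eq_iff_cong[OF xc] by simp
  thus ?thesis using k l by (simp add: s_def)
qed

section \<open>Hall subgroups\<close>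

lemma normal_imp_normalizes: "N \<lhd> G \<Longrightarrow> normalizes (carrier G) N"
  by (simp add: normal_iff_normalizes)

lemma normal_normalizes_subset: "N \<lhd> G \<Longrightarrow> X \<subseteq> carrier G \<Longrightarrow> normalizes X N"
  using normal_imp_normalizes normalizes_mono by blast

lemma normal_one: "{\<one>} \<lhd> G"
  by (auto simp: normal_iff_normalizes normalizes_def)

lemma normal_carrier: "carrier G \<lhd> G"
  by (simp add: normal_iff_normalizes normalizes_self subgroup_self)

lemma coprime_subset_normal:
  assumes H: "subgroup H G" and N: "N \<lhd> G" and "coprime (card H) (idx (carrier G) N)"
  shows "H \<subseteq> N"
proof (rule coprime_index_subset[OF H normal_imp_subgroup[OF N] subgroup_one subgroup_self])
  show "normalizes H N" by (rule normal_normalizes_subset[OF N subgroup.subset[OF H]])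
qed (use assms normal_imp_subgroup[OF N] in \<open>auto simp: subgroup.subset subgroup.one_closed\<close>)

lemma prime_divisors_idx_chain:
  "subgroup A G \<Longrightarrow> subgroup B G \<Longrightarrow> subgroup C G \<Longrightarrow> A \<subseteq> B \<Longrightarrow> B \<subseteq> C \<Longrightarrow>
   prime_divisors (idx C A) = prime_divisors (idx C B) \<union> prime_divisors (idx B A)"
  by (subst idx_chain[of A B C, symmetric]) (simp_all add: prime_divisors_mult)

lemma idx_Int_dvd:
  assumes N: "subgroup N G" and M: "subgroup M G" and X: "subgroup X G" and "N \<subseteq> M" "normalizes M N"
  shows "idx (M \<inter> X) (N \<inter> X) dvd idx M N"
proof -
  have MX: "subgroup (M \<inter> X) G" by (rule subgroup_Int[OF M X])
  have s: "subgroup ((M \<inter> X) <#> N) G"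
    using normalizes_set_mult(1)[OF MX N] normalizes_mono[OF assms(5)] by simp
  have "(M \<inter> X) \<inter> N = N \<inter> X" using assms(4) by blast
  hence "idx (M \<inter> X) (N \<inter> X) = idx ((M \<inter> X) <#> N) N"
    using idx_set_mult[OF MX N s] by simp
  also have "\<dots> dvd idx M N"
    using idx_chain[OF N s M subset_set_mult(2)[OF MX N]] set_mult_leI[OF M, of "M \<inter> X" N] assms(4)
    by (metis Int_lower1 dvd_triv_right)
  finally show ?thesis .
qed

definition hall :: "nat set \<Rightarrow> 'a set \<Rightarrow> 'a set \<Rightarrow> bool" where
  "hall \<pi> H X \<longleftrightarrow> subgroup H G \<and> H \<subseteq> X \<and> prime_divisors (card H) \<subseteq> \<pi> \<and>
     prime_divisors (idx X H) \<inter> \<pi> = {}"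

text \<open>\<open>\<sigma>\<close>-solubility in the form in which it is used, for inductions along a normal series of \<open>G\<close>. It
  refers to normal subgroups of \<open>G\<close> only, because for a subgroup \<open>X\<close> the series is intersected
  with \<open>X\<close>.\<close>

definition sigma_series :: "nat set set \<Rightarrow> bool" where
  "sigma_series \<sigma> \<longleftrightarrow> (\<forall>N. N \<lhd> G \<and> N \<noteq> carrier G \<longrightarrow>
     (\<exists>M. M \<lhd> G \<and> N \<subset> M \<and> (\<exists>\<tau>\<in>\<sigma>. prime_divisors (idx M N) \<subseteq> \<tau>)))"

lemma sigma_seriesE:
  assumes "sigma_series \<sigma>" "N \<lhd> G" "N \<noteq> carrier G"
  obtains M \<tau> where "M \<lhd> G" "N \<subseteq> M" "N \<noteq> M" "\<tau> \<in> \<sigma>" "prime_divisors (idx M N) \<subseteq> \<tau>"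
proof -
  have "\<exists>M. M \<lhd> G \<and> N \<subset> M \<and> (\<exists>\<tau>\<in>\<sigma>. prime_divisors (idx M N) \<subseteq> \<tau>)"
    using assms by (simp add: sigma_series_def)
  thus ?thesis using that by (elim exE conjE bexE psubsetE) auto
qed

lemma sigma_series_induct [consumes 2, case_names carrier step]:
  assumes "sigma_series \<sigma>" and "N \<lhd> G" and "P (carrier G)"
    and step: "\<And>N M \<tau>. N \<lhd> G \<Longrightarrow> M \<lhd> G \<Longrightarrow> N \<subseteq> M \<Longrightarrow> \<tau> \<in> \<sigma> \<Longrightarrow>
      prime_divisors (idx M N) \<subseteq> \<tau> \<Longrightarrow> P M \<Longrightarrow> P N"
  shows "P N"
  using assms(2)
proof (induction "card (carrier G) - card N" arbitrary: N rule: less_induct)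
  case less
  show ?case
  proof (cases "N = carrier G")
    case False
    obtain M \<tau> where M: "M \<lhd> G" "N \<subseteq> M" "N \<noteq> M" "\<tau> \<in> \<sigma>" "prime_divisors (idx M N) \<subseteq> \<tau>"
      by (rule sigma_seriesE[OF assms(1) less(2) False])
    have "card N < card M"
      using M(2,3) subgroup_finite[OF normal_imp_subgroup[OF M(1)]] by (intro psubset_card_mono) auto
    moreover have "card M \<le> card (carrier G)"
      using M(1) by (intro card_mono) (auto simp: subgroup.subset normal_imp_subgroup)
    ultimately have "P M" by (intro less(1) M(1)) linarith
    thus ?thesis using step[OF less(2) M(1,2,4,5)] by blast
  qed (use assms(3) in simp)
qed

text \<open>Going down a series of normal subgroups \<open>N\<close>, there is a subgroup \<open>Y \<supseteq> N \<inter> X\<close> of \<open>X\<close> with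
  \<open>|Y : N \<inter> X|\<close> a \<open>\<rho>\<close>-number and \<open>|X : Y|\<close> a \<open>\<rho>'\<close>-number: at a \<open>\<rho>\<close>-factor \<open>Y\<close> is kept, at a \<open>\<rho>'\<close>-factor
  it is replaced by a complement of that factor.\<close>

lemma hall_exists:
  assumes S: "sigma_series \<sigma>" and \<rho>: "\<And>\<tau>. \<tau> \<in> \<sigma> \<Longrightarrow> \<tau> \<subseteq> \<rho> \<or> \<tau> \<inter> \<rho> = {}" and X: "subgroup X G"
  shows "\<exists>H. hall \<rho> H X"
proof -
  have "\<exists>Y. subgroup Y G \<and> N \<inter> X \<subseteq> Y \<and> Y \<subseteq> X \<and> prime_divisors (idx Y (N \<inter> X)) \<subseteq> \<rho> \<and>
      prime_divisors (idx X Y) \<inter> \<rho> = {}" if "N \<lhd> G" for N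
    using S that
  proof (induction rule: sigma_series_induct)
    case carrier
    have "carrier G \<inter> X = X" using X subgroup.subset by blast
    thus ?case using X by (intro exI[of _ X]) (simp add: idx_self)
  next
    case (step N M \<tau>)
    from step(6) obtain Y where Y: "subgroup Y G" "M \<inter> X \<subseteq> Y" "Y \<subseteq> X"
      "prime_divisors (idx Y (M \<inter> X)) \<subseteq> \<rho>" "prime_divisors (idx X Y) \<inter> \<rho> = {}" by auto
    have Ns: "subgroup N G" "subgroup M G" using step by (auto intro: normal_imp_subgroup)
    have I: "subgroup (N \<inter> X) G" "subgroup (M \<inter> X) G" "N \<inter> X \<subseteq> M \<inter> X"
      using Ns X step by (auto intro: subgroup_Int)
    have "idx (M \<inter> X) (N \<inter> X) dvd idx M N"
      using Ns X step by (intro idx_Int_dvd normal_normalizes_subset) (auto simp: subgroup.subset)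
    hence pd: "prime_divisors (idx (M \<inter> X) (N \<inter> X)) \<subseteq> \<tau>"
      using step(5) prime_divisors_mono by blast
    show ?case
    proof (cases "\<tau> \<subseteq> \<rho>")
      case True
      have "prime_divisors (idx Y (N \<inter> X)) \<subseteq> \<rho>"
        using prime_divisors_idx_chain[OF I(1,2) Y(1) I(3) Y(2)] pd True Y by auto
      thus ?thesis using Y I by blast
    next
      case False
      hence d: "\<tau> \<inter> \<rho> = {}" using \<rho> step by blast
      have nn: "normalizes Y (K \<inter> X)" if "K \<lhd> G" for K
        using that Y X by (intro normalizes_Int normal_normalizes_subset normalizes_mono[OF normalizes_self])
          (auto simp: subgroup.subset)
      have "coprime (idx (M \<inter> X) (N \<inter> X)) (idx Y (M \<inter> X))"
        using coprime_of_disjoint(2)[OF Y(4)] pd d by blast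
      from section_schur_zassenhaus[OF Y(1) I(2) Y(2) nn[OF step(2)] I(1,3) nn[OF step(1)] this]
      obtain C where C: "subgroup C G" "C \<subseteq> Y" "C \<inter> (M \<inter> X) = N \<inter> X" "C <#> (M \<inter> X) = Y" by auto
      have i: "idx C (N \<inter> X) = idx Y (M \<inter> X)"
        using idx_set_mult[OF C(1) I(2)] C Y by simp
      have NC: "N \<inter> X \<subseteq> C" using C by blast
      have "idx Y C * idx C (N \<inter> X) = idx Y (M \<inter> X) * idx (M \<inter> X) (N \<inter> X)"
        using idx_chain[OF I(1) C(1) Y(1) NC C(2)] idx_chain[OF I(1,2) Y(1) I(3) Y(2)] by simp
      hence "idx Y C = idx (M \<inter> X) (N \<inter> X)"
        using i idx_pos[OF I(2) Y(1) Y(2)] by simp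
      hence "prime_divisors (idx X C) \<inter> \<rho> = {}"
        using prime_divisors_idx_chain[OF C(1) Y(1) X C(2) Y(3)] pd d Y(5) by auto
      thus ?thesis using C NC Y i by (intro exI[of _ C]) auto
    qed
  qed
  from this[OF normal_one] obtain Y where Y: "subgroup Y G" "{\<one>} \<inter> X \<subseteq> Y" "Y \<subseteq> X"
    "prime_divisors (idx Y ({\<one>} \<inter> X)) \<subseteq> \<rho>" "prime_divisors (idx X Y) \<inter> \<rho> = {}" by auto
  moreover have "{\<one>} \<inter> X = {\<one>}" using subgroup.one_closed[OF X] by auto
  ultimately show ?thesis unfolding hall_def by auto
qed

text \<open>The subgroup \<open>R\<close> stands for the set of \<open>\<pi>'\<close>-elements: its index being a \<open>\<pi>\<close>-number, it contains
  every \<open>\<pi>'\<close>-subgroup of \<open>G\<close>.\<close>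

definition sigma_power :: "nat set set \<Rightarrow> bool" where
  "sigma_power \<sigma> \<longleftrightarrow> sigma_series \<sigma> \<and> (\<forall>\<pi>\<in>\<sigma>. \<forall>N M. N \<lhd> G \<and> M \<lhd> G \<and> N \<subseteq> M \<and> prime_divisors (idx M N) \<subseteq> \<pi> \<longrightarrow>
     (\<exists>R. R \<lhd> G \<and> prime_divisors (idx (carrier G) R) \<subseteq> \<pi> \<and> acts_by_powers R N M))"

lemma sigma_powerD:
  assumes "sigma_power \<sigma>" "\<pi> \<in> \<sigma>" "N \<lhd> G" "M \<lhd> G" "N \<subseteq> M" "prime_divisors (idx M N) \<subseteq> \<pi>"
  obtains R where "R \<lhd> G" "prime_divisors (idx (carrier G) R) \<subseteq> \<pi>" "acts_by_powers R N M"
  using assms unfolding sigma_power_def by blast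

end

context finite_epi
begin

lemma sigma_series_epi:
  assumes "G.sigma_series \<sigma>"
  shows "H.sigma_series \<sigma>"
  unfolding H.sigma_series_def
proof (intro allI impI, elim conjE)
  fix N assume N: "N \<lhd> H" "N \<noteq> carrier H"
  have Ns: "subgroup N H" "N \<subseteq> carrier H"
    using normal_imp_subgroup[OF N(1)] by (simp_all add: subgroup.subset)
  have im: "h ` pre N = N" using Ns by (simp add: image_pre)
  have "pre N \<noteq> carrier G" using im N(2) h_surj by auto
  then obtain M \<tau> where M: "M \<lhd> G" "pre N \<subseteq> M" "pre N \<noteq> M" "\<tau> \<in> \<sigma>"
    "prime_divisors (idx M (pre N)) \<subseteq> \<tau>"
    by (rule G.sigma_seriesE[OF assms normal_pre[OF N(1)]])
  have kM: "kernel G H h \<subseteq> M" using kernel_subset_pre[OF Ns(1)] M by blast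
  have Ms: "subgroup M G" using M normal_imp_subgroup by blast
  have pM: "pre (h ` M) = M" by (rule pre_image[OF Ms kM])
  have "N \<subseteq> h ` M" "N \<noteq> h ` M" using M(2,3) im pM by blast+
  moreover have "idx (h ` M) N = idx M (pre N)"
    using idx_pre[OF image_subgroup[OF Ms] Ns(1)] pM by simp
  ultimately show "\<exists>M. M \<lhd> H \<and> N \<subset> M \<and> (\<exists>\<tau>\<in>\<sigma>. prime_divisors (idx M N) \<subseteq> \<tau>)"
    using M(4,5) normal_image[OF M(1)] by (intro exI[of _ "h ` M"]) auto
qed

lemma acts_by_powers_image:
  assumes R: "subgroup R G" and "G.acts_by_powers R (pre N) (pre M)" and M: "subgroup M H"
  shows "H.acts_by_powers (h ` R) N M"
  unfolding H.acts_by_powers_def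
proof (intro allI impI, elim conjE)
  fix Q assume Q: "subgroup Q H" "N \<subseteq> Q" "Q \<subseteq> M"
  have "G.normalizes R (pre Q)"
    by (rule G.acts_by_powersD[OF assms(2) pre_subgroup[OF Q(1)]]) (use Q in \<open>auto intro: pre_mono[THEN subsetD]\<close>)
  from normalizes_image[OF this] show "H.normalizes (h ` R) Q"
    using R Q pre_subgroup[OF Q(1)] by (simp add: image_pre subgroup.subset)
qed

lemma idx_image_dvd:
  assumes R: "subgroup R G"
  shows "idx (carrier H) (h ` R) dvd idx (carrier G) R"
proof -
  let ?R = "pre (h ` R)"
  have R': "subgroup ?R G" by (intro pre_subgroup image_subgroup R)
  have "R \<subseteq> ?R" using subgroup.subset[OF R] by (auto simp: pre_def)
  moreover have "?R \<subseteq> carrier G" by (auto simp: pre_def)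
  ultimately have "idx (carrier G) ?R dvd idx (carrier G) R"
    using G.idx_chain[OF R R' G.subgroup_self] by (metis dvd_triv_left)
  moreover have "idx (carrier H) (h ` R) = idx (carrier G) ?R"
    using idx_pre[OF H.subgroup_self image_subgroup[OF R]] by (simp add: pre_carrier)
  ultimately show ?thesis by simp
qed

lemma sigma_power_epi:
  assumes "G.sigma_power \<sigma>"
  shows "H.sigma_power \<sigma>"
  unfolding H.sigma_power_def
proof (intro conjI ballI allI impI, goal_cases)
  case 1
  show ?case using assms by (intro sigma_series_epi) (simp add: G.sigma_power_def)
next
  case (2 \<pi> N M)
  have s: "subgroup N H" "subgroup M H" using 2 normal_imp_subgroup by auto
  obtain R where R: "R \<lhd> G" "prime_divisors (idx (carrier G) R) \<subseteq> \<pi>" "G.acts_by_powers R (pre N) (pre M)"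
  proof (rule G.sigma_powerD[OF assms 2(1)])
    show "pre N \<lhd> G" "pre M \<lhd> G" using 2 by (auto intro: normal_pre)
    show "pre N \<subseteq> pre M" using 2 by (auto intro: pre_mono[THEN subsetD])
    show "prime_divisors (idx (pre M) (pre N)) \<subseteq> \<pi>" using 2 s by (simp add: idx_pre)
  qed
  have Rs: "subgroup R G" using R normal_imp_subgroup by blast
  show ?case
    using normal_image[OF R(1)] acts_by_powers_image[OF Rs R(3) s(2)]
      prime_divisors_mono[OF idx_image_dvd[OF Rs]] R(2) by blast
qed

end

section \<open>The structure of groups acting by powers on their sections\<close>

context finite_group
begin

lemma maximal_normal_exists:
  assumes "N \<lhd> G" "P N"
  obtains M where "M \<lhd> G" "P M" "N \<subseteq> M" "\<And>L. L \<lhd> G \<Longrightarrow> P L \<Longrightarrow> M \<subseteq> L \<Longrightarrow> L = M"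
proof -
  define T where "T M \<longleftrightarrow> M \<lhd> G \<and> P M \<and> N \<subseteq> M" for M
  have "T N" using assms by (simp add: T_def)
  moreover have "\<forall>M. T M \<longrightarrow> card M < Suc (card (carrier G))"
    by (auto simp: T_def less_Suc_eq_le intro!: card_mono dest: normal_imp_subgroup subgroup.subset)
  ultimately obtain M where "T M" and max: "\<And>L. T L \<Longrightarrow> card L \<le> card M"
    using ex_has_greatest_nat[of T N card "Suc (card (carrier G))"] by blast
  moreover have "L = M" if "L \<lhd> G" "P L" "M \<subseteq> L" for L
  proof -
    have "card L \<le> card M" using that \<open>T M\<close> by (intro max) (auto simp: T_def)
    thus ?thesis using that subgroup_finite[OF normal_imp_subgroup[OF that(1)]] card_seteq by blast
  qed
  ultimately show ?thesis using that by (auto simp: T_def)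
qed

lemma normal_of_conjugate_subset:
  assumes W: "subgroup W G" and "\<And>g. g \<in> carrier G \<Longrightarrow> cnj g ` W \<subseteq> W"
  shows "W \<lhd> G"
  using assms by (auto simp: normal_iff_normalizes normalizes_def)

text \<open>A normal Hall subgroup \<open>W\<close> of \<open>V\<close> contains every subgroup of \<open>V\<close> of the same order, in particular
  its conjugates.\<close>

lemma normal_hall_normal:
  assumes V: "V \<lhd> G" and W: "subgroup W G" "W \<subseteq> V" "normalizes V W"
    and cop: "coprime (card W) (idx V W)"
  shows "W \<lhd> G"
proof (rule normal_of_conjugate_subset[OF W(1)])
  fix g assume g: "g \<in> carrier G"
  have Vs: "subgroup V G" "normalizes (carrier G) V" using V by (auto simp: normal_iff_normalizes)
  have gW: "cnj g ` W \<subseteq> V" using Vs(2) g W(2) by (auto simp: normalizes_def)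
  show "cnj g ` W \<subseteq> W"
    by (rule coprime_index_subset[OF subgroup_cnj[OF g W(1)] W(1) subgroup_one Vs(1) gW W(2)])
      (use g W gW cop in \<open>auto simp: card_cnj subgroup.one_closed subgroup_cnj intro: normalizes_mono\<close>)
qed

text \<open>Let \<open>F\<close> be the largest normal \<open>\<pi>\<close>-subgroup, and \<open>U/F\<close> a largest normal \<open>\<pi>'\<close>-subgroup of \<open>G/F\<close>,
  where \<open>G\<close> has no nontrivial normal \<open>\<pi>'\<close>-subgroups. A complement \<open>T\<close> of \<open>F\<close> in \<open>U\<close> lies in \<open>R\<close> and so
  acts on \<open>F\<close> by coprime power automorphisms, which are invariant under conjugation in \<open>G\<close>; as \<open>F\<close>
  contains its centralizer in \<open>U\<close>, the group \<open>U/F\<close> is central in \<open>G/F\<close>. A normal \<open>\<pi>\<close>-factor above \<open>U\<close>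
  would then split off \<open>U/F\<close> as a direct factor and enlarge \<open>F\<close>. Hence \<open>U = G\<close>.\<close>

lemma sigma_power_normal_hall:
  assumes SP: "sigma_power \<sigma>" and disj: "\<And>\<tau>. \<tau> \<in> \<sigma> \<Longrightarrow> \<tau> \<noteq> \<pi> \<Longrightarrow> \<tau> \<inter> \<pi> = {}" and \<pi>: "\<pi> \<in> \<sigma>"
    and core: "\<And>N. N \<lhd> G \<Longrightarrow> prime_divisors (card N) \<inter> \<pi> = {} \<Longrightarrow> N = {\<one>}"
  obtains F R where "F \<lhd> G" "R \<lhd> G" "prime_divisors (card F) \<subseteq> \<pi>"
    "prime_divisors (idx (carrier G) F) \<inter> \<pi> = {}" "prime_divisors (idx (carrier G) R) \<subseteq> \<pi>"
    "acts_by_powers R {\<one>} F"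
proof -
  obtain F where F: "F \<lhd> G" "prime_divisors (card F) \<subseteq> \<pi>"
    and Fmax: "\<And>L. L \<lhd> G \<Longrightarrow> prime_divisors (card L) \<subseteq> \<pi> \<Longrightarrow> F \<subseteq> L \<Longrightarrow> L = F"
    by (rule maximal_normal_exists[OF normal_one, of "\<lambda>N. prime_divisors (card N) \<subseteq> \<pi>"]) auto
  have Fs: "subgroup F G" and Fn: "normalizes (carrier G) F" using F by (auto simp: normal_iff_normalizes)
  have F1: "{\<one>} \<subseteq> F" using subgroup.one_closed[OF Fs] by simp
  obtain R where R: "R \<lhd> G" "prime_divisors (idx (carrier G) R) \<subseteq> \<pi>" "acts_by_powers R {\<one>} F"
    by (rule sigma_powerD[OF SP \<pi> normal_one F(1) F1]) (use F(2) in auto)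
  have Rs: "subgroup R G" and Rn: "normalizes (carrier G) R" using R by (auto simp: normal_iff_normalizes)
  obtain U where U: "U \<lhd> G" "prime_divisors (idx U F) \<inter> \<pi> = {}" "F \<subseteq> U"
    and Umax: "\<And>L. L \<lhd> G \<Longrightarrow> prime_divisors (idx L F) \<inter> \<pi> = {} \<Longrightarrow> U \<subseteq> L \<Longrightarrow> L = U"
    by (rule maximal_normal_exists[OF F(1), of "\<lambda>N. prime_divisors (idx N F) \<inter> \<pi> = {}"])
      (auto simp: idx_self[OF Fs])
  have Us: "subgroup U G" and Un: "normalizes (carrier G) U" using U by (auto simp: normal_iff_normalizes)
  have UF: "normalizes U F" by (rule normalizes_mono[OF Fn subgroup.subset[OF Us]])
  have cF: "coprime (card F) (idx U F)" using coprime_of_disjoint F U by blast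
  have cf [simp]: "\<And>x. x \<in> F \<Longrightarrow> x \<in> carrier G" and cu [simp]: "\<And>x. x \<in> U \<Longrightarrow> x \<in> carrier G"
    using sub_carrier Fs Us by auto
  \<comment> \<open>The centralizer \<open>C\<close> of \<open>F\<close> in \<open>U\<close> has the central Hall subgroup \<open>Z = C \<inter> F\<close>; a complement of it
    is a normal \<open>\<pi>'\<close>-subgroup of \<open>G\<close>, hence trivial.\<close>
  define C where "C = {z \<in> U. \<forall>x\<in>F. cmt z x \<in> {\<one>}}"
  have U1: "normalizes U {\<one>}" by (auto simp: normalizes_def)
  have Cs: "subgroup C G" and Cn: "normalizes (carrier G) C"
    unfolding C_def using relative_centralizer[OF Us subgroup_one U1 subgroup.subset[OF Fs]]
      Un Fn normal_imp_normalizes[OF normal_one] subgroup_self by auto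
  have CU: "C \<subseteq> U" by (auto simp: C_def)
  have CF: "C \<subseteq> F"
  proof -
    define Z where "Z = C \<inter> F"
    have Z: "subgroup Z G" "Z \<subseteq> C" "normalizes C Z"
      unfolding Z_def using subgroup_Int[OF Cs Fs] normalizes_Int[OF normalizes_self[OF Cs]] normalizes_mono[OF UF CU]
      by auto
    have sCF: "subgroup (C <#> F) G" by (rule normalizes_set_mult(1)[OF Cs Fs normalizes_mono[OF UF CU]])
    have "idx C Z = idx (C <#> F) F" using idx_set_mult[OF Cs Fs sCF] by (simp add: Z_def)
    also have "\<dots> dvd idx U F"
      using idx_chain[OF Fs sCF Us subset_set_mult(2)[OF Cs Fs] set_mult_leI[OF Us CU U(3)]]
      by (metis dvd_triv_right)
    finally have iZ: "prime_divisors (idx C Z) \<inter> \<pi> = {}" using U(2) prime_divisors_mono by blast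
    have cZ: "prime_divisors (card Z) \<subseteq> \<pi>"
      using F(2) prime_divisors_mono[OF card_dvd[OF Z(1) Fs]] by (auto simp: Z_def)
    have "coprime (card Z) (idx C Z)" using coprime_of_disjoint cZ iZ by blast
    from schur_zassenhaus[OF Cs Z this]
    obtain E where E: "subgroup E G" "E \<subseteq> C" "E \<inter> Z = {\<one>}" "E <#> Z = C" by auto
    have cE: "card E = idx C Z" using idx_set_mult[OF E(1) Z(1)] E Cs by simp
    have "idx C E * card E = idx C Z * card Z" using idx_mult[OF E(1) Cs E(2)] idx_mult[OF Z(1) Cs Z(2)] by simp
    hence iE: "idx C E = card Z" using cE idx_pos[OF Z(1) Cs Z(2)] by simp
    have "normalizes Z E"
      unfolding normalizes_def
    proof (intro ballI)
      fix z e assume ze: "z \<in> Z" "e \<in> E"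
      hence "e \<in> C" "z \<in> F" using E by (auto simp: Z_def)
      hence "cmt e z = \<one>" "e \<in> carrier G" "z \<in> carrier G" by (auto simp: C_def)
      hence "cmt z e = \<one>" using cmt_swap[of e z] by simp
      hence "cnj z e = e" using cnj_eq_cmt_mult \<open>e \<in> carrier G\<close> \<open>z \<in> carrier G\<close> by simp
      thus "cnj z e \<in> E" using ze by simp
    qed
    hence "normalizes C E" using normalizes_mult[OF E(1) Z(1) E(1) normalizes_self[OF E(1)]] E(4) by simp
    hence "E \<lhd> G"
      using normal_hall_normal[OF _ E(1,2)] Cs Cn cE iE coprime_of_disjoint(2)[OF cZ iZ] by (simp add: normal_iff_normalizes)
    hence "E = {\<one>}" using core cE iZ by simp
    hence "idx C Z = 1" using cE by simp
    hence "card C = card Z" using idx_mult[OF Z(1) Cs Z(2)] by simp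
    hence "Z = C" using Z by (intro card_subset_eq subgroup_finite[OF Cs]) auto
    thus ?thesis by (auto simp: Z_def)
  qed
  \<comment> \<open>For \<open>t \<in> T\<close> the commutators \<open>[v, t]\<close> centralize \<open>F\<close>, so they lie in \<open>C \<subseteq> F\<close>.\<close>
  obtain T where T: "subgroup T G" "T \<subseteq> U" "T \<inter> F = {\<one>}" "T <#> F = U"
    using schur_zassenhaus[OF Us Fs U(3) UF cF] by auto
  have cT: "card T = idx U F" using idx_set_mult[OF T(1) Fs] T Us by simp
  have TR: "T \<subseteq> R"
    using U(2) cT by (intro coprime_subset_normal T R(1) coprime_of_disjoint(2)[OF R(2)]) simp
  have T_central: "cmt v t \<in> F" if v: "v \<in> carrier G" and t: "t \<in> T" for v t
  proof -
    have tc: "t \<in> carrier G" "t \<in> U" "t \<in> R" using t T TR by auto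
    have vt: "cnj v t \<in> U" "cnj v t \<in> R" using v tc Un Rn by (auto simp: normalizes_def)
    have "cnj (cnj v t) x = cnj t x" if x: "x \<in> F" for x
    proof (rule conjugate_power_actions_equal[OF Fs v _ tc(1) pow_card[OF T(1) t] _ _ _ x])
      show "normalizes {inv v} F" using Fn v by (auto simp: normalizes_def)
      show "coprime (card T) (card F)" using cF cT by (simp add: coprime_commute)
      show "acts_by_powers {t} {\<one>} F" "acts_by_powers {cnj v t} {\<one>} F"
        using R(3) tc vt by (auto intro: acts_by_powers_mono)
    qed
    have "cmt v t \<in> C"
    proof -
      have cm: "cmt v t = cnj v t \<otimes> inv t" by (rule cmt_eq)
      have "cmt v t \<in> U" unfolding cm using vt tc Us by (simp add: subgroup.m_closed subgroup.m_inv_closed)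
      moreover have "cmt (cmt v t) x = \<one>" if x: "x \<in> F" for x
      proof -
        have y: "cnj (inv t) x \<in> F" using Fn tc x by (auto simp: normalizes_def)
        have "cnj (cmt v t) x = cnj (cnj v t) (cnj (inv t) x)"
          unfolding cm using v tc x by (simp add: cnj_cnj)
        also have "\<dots> = x" using \<open>\<And>x. x \<in> F \<Longrightarrow> cnj (cnj v t) x = cnj t x\<close>[OF y] tc x by simp
        finally show ?thesis using cmt_eq[of "cmt v t" x] x by simp
      qed
      ultimately show ?thesis by (simp add: C_def)
    qed
    thus ?thesis using CF by blast
  qed
  have U_central: "cmt v u \<in> F" if v: "v \<in> carrier G" and u: "u \<in> U" for u v
  proof -
    from u T(4) obtain t f where tf: "t \<in> T" "f \<in> F" "u = t \<otimes> f" by (auto elim: set_multE)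
    have c: "t \<in> carrier G" using tf T(2) by auto
    have "cmt v u = cmt v t \<otimes> cnj t (cmt v f)"
      using v c tf by (simp add: cmt_def cnj_def group_word)
    moreover have "cmt v f \<in> F"
      unfolding cmt_eq using Fn v tf Fs by (simp add: normalizes_def subgroup.m_closed subgroup.m_inv_closed)
    hence "cnj t (cmt v f) \<in> F" using Fn c by (simp add: normalizes_def)
    ultimately show ?thesis using T_central[OF v tf(1)] Fs by (simp add: subgroup.m_closed)
  qed
  \<comment> \<open>A normal factor \<open>V/U\<close> must be a \<open>\<pi>\<close>-group by the choice of \<open>U\<close>; a complement \<open>W/F\<close> of the
    central \<open>U/F\<close> in \<open>V/F\<close> is normal in \<open>G/F\<close>, against the choice of \<open>F\<close>.\<close>
  have "U = carrier G"
  proof (rule ccontr)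
    assume "U \<noteq> carrier G"
    moreover have "sigma_series \<sigma>" using SP by (simp add: sigma_power_def)
    ultimately obtain V \<tau> where V0: "V \<lhd> G" "U \<subseteq> V" "U \<noteq> V" "\<tau> \<in> \<sigma>" "prime_divisors (idx V U) \<subseteq> \<tau>"
      using sigma_seriesE U(1) by metis
    hence V: "V \<lhd> G" "U \<subset> V" "\<tau> \<in> \<sigma>" "prime_divisors (idx V U) \<subseteq> \<tau>" by auto
    have Vs: "subgroup V G" using V by (simp add: normal_imp_subgroup)
    have FV: "F \<subseteq> V" "U \<subseteq> V" using U V by auto
    have chain: "prime_divisors (idx V F) = prime_divisors (idx V U) \<union> prime_divisors (idx U F)"
      by (rule prime_divisors_idx_chain[OF Fs Us Vs U(3) FV(2)])
    have "\<tau> = \<pi>"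
    proof (rule ccontr)
      assume "\<tau> \<noteq> \<pi>"
      hence "prime_divisors (idx V F) \<inter> \<pi> = {}" using chain V U(2) disj by blast
      thus False using Umax[OF V(1)] V(2) by blast
    qed
    hence "coprime (idx U F) (idx V U)" using coprime_of_disjoint(2) V(4) U(2) by blast
    from section_schur_zassenhaus[OF Vs Us FV(2) normalizes_mono[OF Un] Fs U(3) normalizes_mono[OF Fn] this]
    obtain W where W: "subgroup W G" "W \<subseteq> V" "W \<inter> U = F" "W <#> U = V"
      using subgroup.subset[OF Vs] by auto
    have FW: "F \<subseteq> W" using W by blast
    have iW: "idx W F = idx V U" using idx_set_mult[OF W(1) Us] W Vs by simp
    have cW: "card W = idx W F * card F" using idx_mult[OF Fs W(1) FW] by simp
    have pW: "prime_divisors (card W) \<subseteq> \<pi>"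
      unfolding cW prime_divisors_mult using iW V(4) \<open>\<tau> = \<pi>\<close> F(2) by simp
    have "idx V W * idx W F = idx V U * idx U F"
      using idx_chain[OF Fs W(1) Vs FW W(2)] idx_chain[OF Fs Us Vs U(3) FV(2)] by simp
    hence iVW: "idx V W = idx U F" using iW idx_pos[OF Us Vs FV(2)] by simp
    have "normalizes U W"
      unfolding normalizes_def
    proof (intro ballI)
      fix u w assume u: "u \<in> U" "w \<in> W"
      have wc: "w \<in> carrier G" using u W sub_carrier by blast
      have "cmt u w = inv (cmt w u)" by (rule cmt_swap) (use u wc in auto)
      hence "cmt u w \<in> F" using U_central[OF wc u(1)] Fs by (simp add: subgroup.m_inv_closed)
      thus "cnj u w \<in> W" using FW u wc W(1) by (auto simp: cnj_eq_cmt_mult subgroup.m_closed)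
    qed
    hence "normalizes V W" using normalizes_mult[OF W(1) Us W(1) normalizes_self[OF W(1)]] W(4) by simp
    hence "W \<lhd> G"
      using coprime_of_disjoint(1)[OF pW] U(2) by (intro normal_hall_normal[OF V(1) W(1,2)]) (simp_all add: iVW)
    hence "W = F" using Fmax pW FW by blast
    hence "V = U" using W(4) set_mult_leI[OF Us U(3) subset_refl] FV by blast
    thus False using V(2) by blast
  qed
  thus ?thesis using that[OF F(1) R(1) F(2) _ R(2,3)] U(2) by simp
qed

end

context finite_epi
begin

lemma acts_by_powers_pre:
  assumes R: "H.acts_by_powers R {\<one>\<^bsub>H\<^esub>} F" and RH: "R \<subseteq> carrier H" and F: "subgroup F H"
  shows "G.acts_by_powers (pre R) (kernel G H h) (pre F)"
  unfolding G.acts_by_powers_def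
proof (intro allI impI, elim conjE)
  fix Q assume Q: "subgroup Q G" "kernel G H h \<subseteq> Q" "Q \<subseteq> pre F"
  have "h ` Q \<subseteq> F" using Q(3) by (auto simp: pre_def)
  moreover have "subgroup (h ` Q) H" by (rule image_subgroup[OF Q(1)])
  ultimately have "H.normalizes R (h ` Q)"
    using R subgroup.one_closed[of "h ` Q" H] by (auto intro: H.acts_by_powersD)
  from normalizes_pre[OF this] show "G.normalizes (pre R) Q" using pre_image[OF Q(1,2)] by simp
qed

end

context finite_group
begin

text \<open>Dividing out the largest normal \<open>\<pi>'\<close>-subgroup \<open>Z\<close> leaves a group without nontrivial normal
  \<open>\<pi>'\<close>-subgroups, to which \<open>sigma_power_normal_hall\<close> applies.\<close>

theorem sigma_power_structure:
  assumes SP: "sigma_power \<sigma>" and disj: "\<And>\<tau>. \<tau> \<in> \<sigma> \<Longrightarrow> \<tau> \<noteq> \<pi> \<Longrightarrow> \<tau> \<inter> \<pi> = {}" and \<pi>: "\<pi> \<in> \<sigma>"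
  obtains Z S R where "Z \<lhd> G" "S \<lhd> G" "R \<lhd> G" "Z \<subseteq> S" "prime_divisors (card Z) \<inter> \<pi> = {}"
    "prime_divisors (idx S Z) \<subseteq> \<pi>" "prime_divisors (idx (carrier G) S) \<inter> \<pi> = {}"
    "prime_divisors (idx (carrier G) R) \<subseteq> \<pi>" "acts_by_powers R Z S"
proof -
  obtain Z where Z: "Z \<lhd> G" "prime_divisors (card Z) \<inter> \<pi> = {}"
    and Omax: "\<And>L. L \<lhd> G \<Longrightarrow> prime_divisors (card L) \<inter> \<pi> = {} \<Longrightarrow> Z \<subseteq> L \<Longrightarrow> L = Z"
    by (rule maximal_normal_exists[OF normal_one, of "\<lambda>N. prime_divisors (card N) \<inter> \<pi> = {}"]) auto
  have Os: "subgroup Z G" using Z by (simp add: normal_imp_subgroup)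
  interpret E: finite_epi G "G Mod Z" "\<lambda>x. Z #> x" by (rule quotient_epi(1)[OF Z(1)])
  note ker = quotient_epi(2)[OF Z(1)]
  obtain F R where FR: "F \<lhd> G Mod Z" "R \<lhd> G Mod Z" "prime_divisors (card F) \<subseteq> \<pi>"
    "prime_divisors (idx (carrier (G Mod Z)) F) \<inter> \<pi> = {}" "prime_divisors (idx (carrier (G Mod Z)) R) \<subseteq> \<pi>"
    "E.H.acts_by_powers R {\<one>\<^bsub>G Mod Z\<^esub>} F"
  proof (rule E.H.sigma_power_normal_hall[OF E.sigma_power_epi[OF SP] disj \<pi>])
    fix N assume N: "N \<lhd> G Mod Z" "prime_divisors (card N) \<inter> \<pi> = {}"
    have Ns: "subgroup N (G Mod Z)" using N normal_imp_subgroup by blast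
    have "E.pre N = Z"
    proof (rule Omax[OF E.normal_pre[OF N(1)]])
      show "prime_divisors (card (E.pre N)) \<inter> \<pi> = {}"
        using E.card_pre[OF Ns] N(2) Z(2) by (auto simp: ker prime_divisors_mult)
      show "Z \<subseteq> E.pre N" using E.kernel_subset_pre[OF Ns] ker by simp
    qed
    hence "card N = 1" using E.card_pre[OF Ns] card_pos[OF Os] by (simp add: ker)
    thus "N = {\<one>\<^bsub>G Mod Z\<^esub>}"
      using subgroup.one_closed[OF Ns] by (metis card_1_singletonE singletonD)
  qed auto
  have s: "subgroup F (G Mod Z)" "subgroup R (G Mod Z)" using FR normal_imp_subgroup by auto
  show ?thesis
  proof (rule that[of Z "E.pre F" "E.pre R"])
    show "E.pre F \<lhd> G" "E.pre R \<lhd> G" using FR by (auto intro: E.normal_pre)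
    show OF: "Z \<subseteq> E.pre F" using E.kernel_subset_pre[OF s(1)] ker by simp
    have "idx (E.pre F) Z = card F"
      unfolding idx_def E.card_pre[OF s(1)] ker using card_pos[OF Os] by simp
    thus "prime_divisors (idx (E.pre F) Z) \<subseteq> \<pi>" using FR by simp
    show "prime_divisors (idx (carrier G) (E.pre F)) \<inter> \<pi> = {}"
      "prime_divisors (idx (carrier G) (E.pre R)) \<subseteq> \<pi>"
      using E.idx_pre[OF E.H.subgroup_self] s FR by (simp_all add: E.pre_carrier)
    show "acts_by_powers (E.pre R) Z (E.pre F)"
      using E.acts_by_powers_pre[OF FR(6) subgroup.subset[OF s(2)] s(1)] ker by simp
  qed (use Z in auto)
qed

section \<open>Conjugacy of Hall subgroups\<close>

lemma acts_by_powers_section: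
  "acts_by_powers A N M \<Longrightarrow> N \<subseteq> N' \<Longrightarrow> M' \<subseteq> M \<Longrightarrow> acts_by_powers A N' M'"
  unfolding acts_by_powers_def by (meson subset_trans)

lemma acts_by_powers_conjugate:
  assumes H: "acts_by_powers H N M" and Hc: "H \<subseteq> carrier G" and N: "N \<subseteq> carrier G"
    and X: "subgroup X G" "normalizes X N" "normalizes X M" and g: "g \<in> X"
  shows "acts_by_powers (cnj (inv g) ` H) N M"
  unfolding acts_by_powers_def
proof (intro allI impI, elim conjE)
  fix Q assume Q: "subgroup Q G" "N \<subseteq> Q" "Q \<subseteq> M"
  have gc: "g \<in> carrier G" by (rule sub_carrier[OF X(1) g])
  have Q': "subgroup (cnj g ` Q) G" by (rule subgroup_cnj[OF gc Q(1)])
  have "N \<subseteq> cnj g ` Q"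
  proof
    fix n assume n: "n \<in> N"
    have "cnj (inv g) n \<in> Q" using X(1,2) g Q n by (auto simp: normalizes_def subgroup.m_inv_closed)
    moreover have "n \<in> carrier G" using n N by blast
    hence "n = cnj g (cnj (inv g) n)" using gc by simp
    ultimately show "n \<in> cnj g ` Q" by blast
  qed
  moreover have "cnj g ` Q \<subseteq> M" using X(3) g Q(3) by (auto simp: normalizes_def)
  ultimately have nQ: "normalizes H (cnj g ` Q)" by (rule acts_by_powersD[OF H Q'])
  show "normalizes (cnj (inv g) ` H) Q"
    unfolding normalizes_def
  proof (intro ballI)
    fix x q assume "x \<in> cnj (inv g) ` H" and q: "q \<in> Q"
    then obtain y where y: "y \<in> H" "x = cnj (inv g) y" by auto
    hence yc: "y \<in> carrier G" and qc: "q \<in> carrier G" using Hc q Q sub_carrier by auto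
    have "cnj y (cnj g q) \<in> cnj g ` Q" using nQ y q by (auto simp: normalizes_def)
    then obtain q' where q': "q' \<in> Q" "cnj y (cnj g q) = cnj g q'" by auto
    have "cnj x q = cnj (inv g) (cnj y (cnj g q))"
      using y yc qc gc by (simp add: cnj_def group_word)
    also have "\<dots> = q'" using q' gc Q sub_carrier by simp
    finally show "cnj x q \<in> Q" using q' by simp
  qed
qed

text \<open>A subgroup \<open>Q\<close> between \<open>N \<inter> X\<close> and \<open>M \<inter> X\<close> is recovered from \<open>QN\<close>, which lies between \<open>N\<close> and
  \<open>M\<close>, as \<open>QN \<inter> X\<close>.\<close>

lemma acts_by_powers_Int:
  assumes R: "acts_by_powers R N M" and N: "subgroup N G" "normalizes X N" "N \<subseteq> M"
    and M: "subgroup M G" and X: "subgroup X G"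
  shows "acts_by_powers (R \<inter> X) (N \<inter> X) (M \<inter> X)"
  unfolding acts_by_powers_def
proof (intro allI impI, elim conjE)
  fix Q assume Q: "subgroup Q G" "N \<inter> X \<subseteq> Q" "Q \<subseteq> M \<inter> X"
  have QN: "subgroup (Q <#> N) G"
    using Q N by (intro normalizes_set_mult(1)) (auto intro: normalizes_mono)
  have "Q <#> N \<subseteq> M" using Q N by (intro set_mult_leI[OF M]) auto
  hence nR: "normalizes R (Q <#> N)"
    by (rule acts_by_powersD[OF R QN subset_set_mult(2)[OF Q(1) N(1)]])
  show "normalizes (R \<inter> X) Q"
    unfolding normalizes_def
  proof (intro ballI)
    fix r q assume rq: "r \<in> R \<inter> X" "q \<in> Q"
    have "cnj r q \<in> Q <#> N" using nR rq subset_set_mult(1)[OF Q(1) N(1)] by (auto simp: normalizes_def)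
    then obtain q' n where q': "q' \<in> Q" "n \<in> N" "cnj r q = q' \<otimes> n" by (auto elim: set_multE)
    have "cnj r q \<in> X" using rq Q normalizes_self[OF X] by (auto simp: normalizes_def)
    moreover have "q' \<in> X" using q' Q by auto
    moreover have "n = inv q' \<otimes> cnj r q" using q' sub_carrier[OF Q(1)] sub_carrier[OF N(1)] by simp
    ultimately have "n \<in> X" using X by (simp add: subgroup.m_closed subgroup.m_inv_closed)
    hence "n \<in> Q" using q' Q by auto
    thus "cnj r q \<in> Q" using q' Q by (simp add: subgroup.m_closed)
  qed
qed

lemma set_mult_absorb:
  assumes "subgroup M G" "subgroup N G" "N \<subseteq> M" "subgroup H G"
  shows "M <#> (N <#> H) = M <#> H"
proof -
  have "M <#> N = M"
    using set_mult_leI[OF assms(1) subset_refl assms(3)] subset_set_mult(1)[OF assms(1,2)] by blast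
  thus ?thesis using set_mult_assoc[of M N H] assms subgroup.subset by metis
qed

lemma cmt_mem_normalized:
  assumes "subgroup N G" "n \<in> N" "x \<in> carrier G" "normalizes {x} N"
  shows "cmt n x \<in> N"
proof -
  have "n \<in> carrier G" using assms sub_carrier by blast
  hence "cmt n x = n \<otimes> cnj x (inv n)" using assms by (simp add: cmt_def cnj_def group_word)
  thus ?thesis using assms by (simp add: normalizes_def subgroup.m_closed subgroup.m_inv_closed)
qed

text \<open>By induction \<open>M/N\<close> may be assumed simple. The elements of \<open>M\<close> that induce power automorphisms on
  \<open>M/N\<close> form a normal subgroup \<open>\<kappa>\<close> containing \<open>N\<close>. If \<open>\<kappa> = M\<close>, all subgroups of \<open>M/N\<close> are normal, so
  \<open>M/N\<close> is abelian and complements are conjugate. If \<open>\<kappa> = N\<close>, then \<open>[H, M] \<subseteq> \<kappa> = N\<close>, so \<open>NH\<close> is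
  normal in \<open>MH\<close> and contains \<open>H1\<close> by its order.\<close>

lemma coprime_power_conjugate:
  assumes H: "subgroup H G" and H1: "subgroup H1 G" and N: "subgroup N G" and M: "subgroup M G"
    and "N \<subseteq> M" "normalizes M N" and "acts_by_powers H N M" "acts_by_powers H1 N M"
    and "H1 \<subseteq> M <#> H" and "coprime (card H) (idx M N)" "coprime (card H1) (idx M N)"
  shows "\<exists>g\<in>M. \<forall>x\<in>H1. cnj (inv g) x \<in> N <#> H"
  using H1 N M assms(5-)
proof (induction "idx M N" arbitrary: H1 M N rule: less_induct)
  case less
  note H1 = less(2) and N = less(3) and M = less(4) and NM = less(5) and nMN = less(6)
    and aH = less(7) and aH1 = less(8) and sub = less(9) and cH = less(10) and cH1 = less(11)
  have nHM: "normalizes H M" and nHN: "normalizes H N"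
    using acts_by_powersD[OF aH M NM] acts_by_powersD[OF aH N] NM by auto
  show ?case
  proof (cases "\<exists>K. subgroup K G \<and> N \<subseteq> K \<and> K \<subseteq> M \<and> K \<noteq> N \<and> K \<noteq> M \<and> normalizes M K")
    case True
    then obtain K where K: "subgroup K G" "N \<subseteq> K" "K \<subseteq> M" "K \<noteq> N" "K \<noteq> M" "normalizes M K" by blast
    have chain: "idx M K * idx K N = idx M N" by (rule idx_chain[OF N K(1) M K(2,3)])
    have "idx M K \<noteq> 1" "idx K N \<noteq> 1"
      using idx_eq_1[OF K(1) M K(3)] idx_eq_1[OF N K(1,2)] K by auto
    moreover have "idx M K > 0" "idx K N > 0" using idx_pos K N M by auto
    ultimately have lt: "idx M K < idx M N" "idx K N < idx M N"
      unfolding chain[symmetric] by auto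
    have cop: "coprime c (idx M K) \<and> coprime c (idx K N)" if "coprime c (idx M N)" for c
      using that by (simp add: chain[symmetric])
    have "\<exists>g\<in>M. \<forall>x\<in>H1. cnj (inv g) x \<in> K <#> H"
      using K cH cH1 cop
      by (intro less(1)[OF lt(1)] H1 M sub acts_by_powers_section[OF aH] acts_by_powers_section[OF aH1]) auto
    then obtain g where g: "g \<in> M" "\<And>x. x \<in> H1 \<Longrightarrow> cnj (inv g) x \<in> K <#> H" by auto
    have gc: "g \<in> carrier G" by (rule sub_carrier[OF M g(1)])
    let ?H1 = "cnj (inv g) ` H1"
    have H1': "subgroup ?H1 G" using gc by (intro subgroup_cnj H1) simp
    have "acts_by_powers ?H1 N M"
      by (rule acts_by_powers_conjugate[OF aH1 subgroup.subset[OF H1] subgroup.subset[OF N] M nMN normalizes_self[OF M] g(1)])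
    hence "\<exists>k\<in>K. \<forall>x\<in>?H1. cnj (inv k) x \<in> N <#> H"
      using K cH cH1 cop gc g H1
      by (intro less(1)[OF lt(2)] H1' N acts_by_powers_section[OF aH])
        (auto intro: normalizes_mono[OF nMN] acts_by_powers_section simp: card_cnj)
    then obtain k where k: "k \<in> K" "\<And>x. x \<in> H1 \<Longrightarrow> cnj (inv k) (cnj (inv g) x) \<in> N <#> H" by auto
    have kM: "k \<in> M" "k \<in> carrier G" using k K sub_carrier by auto
    have "cnj (inv (g \<otimes> k)) x \<in> N <#> H" if "x \<in> H1" for x
      using k(2)[OF that] gc kM sub_carrier[OF H1 that] by (simp add: cnj_cnj inv_mult_group)
    thus ?thesis using g kM M by (intro bexI[of _ "g \<otimes> k"]) (auto simp: subgroup.m_closed)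
  next
    case False
    hence simple: "K = N \<or> K = M" if "subgroup K G" "N \<subseteq> K" "K \<subseteq> M" "normalizes M K" for K
      using that by blast
    have MH: "subgroup (M <#> H) G" by (rule normalizes_set_mult(2)[OF H M nHM])
    have cM [simp]: "\<And>x. x \<in> M \<Longrightarrow> x \<in> carrier G" using sub_carrier[OF M] .
    define \<kappa> where "\<kappa> = {m \<in> M. \<forall>Q\<in>{Q. subgroup Q G \<and> N \<subseteq> Q \<and> Q \<subseteq> M}. \<forall>q\<in>Q. cnj m q \<in> Q}"
    have \<kappa>_iff: "m \<in> \<kappa> \<longleftrightarrow> m \<in> M \<and> acts_by_powers {m} N M" for m
      by (auto simp: \<kappa>_def acts_by_powers_def normalizes_def)
    have \<kappa>: "subgroup \<kappa> G" unfolding \<kappa>_def by (rule common_normalizer_subgroup[OF M]) auto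
    have "N \<subseteq> \<kappa>"
    proof
      fix n assume n: "n \<in> N"
      have "normalizes {n} Q" if "subgroup Q G" "N \<subseteq> Q" for Q
        using normalizes_self[OF that(1)] n that(2) by (auto intro: normalizes_mono)
      thus "n \<in> \<kappa>" using n NM by (auto simp: \<kappa>_iff acts_by_powers_def)
    qed
    moreover have "\<kappa> \<subseteq> M" by (auto simp: \<kappa>_def)
    moreover have "normalizes M \<kappa>"
      unfolding normalizes_def
    proof (intro ballI)
      fix m k assume mk: "m \<in> M" "k \<in> \<kappa>"
      have k: "k \<in> M" "acts_by_powers {k} N M" using mk \<kappa>_iff by auto
      have "acts_by_powers (cnj (inv (inv m)) ` {k}) N M"
        using mk k M subgroup.subset[OF N]
        by (intro acts_by_powers_conjugate[OF _ _ _ M nMN normalizes_self[OF M]]) (auto simp: subgroup.m_inv_closed)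
      thus "cnj m k \<in> \<kappa>" using mk k normalizes_self[OF M] by (simp add: \<kappa>_iff normalizes_def)
    qed
    ultimately have "\<kappa> = N \<or> \<kappa> = M" by (intro simple \<kappa>)
    thus ?thesis
    proof
      assume \<kappa>M: "\<kappa> = M"
      have all: "Q = N \<or> Q = M" if "subgroup Q G" "N \<subseteq> Q" "Q \<subseteq> M" for Q
      proof (rule simple[OF that])
        have "m \<in> \<kappa>" if "m \<in> M" for m using that \<kappa>M by simp
        thus "normalizes M Q" using that by (auto simp: \<kappa>_def normalizes_def)
      qed
      have comm: "cmt m x \<in> N" if m: "m \<in> M" and x: "x \<in> M" for m x
      proof (cases "x \<in> N")
        case True
        have "cmt x m \<in> N"
          using True m nMN by (intro cmt_mem_normalized N) (auto intro: normalizes_mono)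
        moreover have "cmt m x = inv (cmt x m)" by (rule cmt_swap) (use m x in auto)
        ultimately show ?thesis using N by (simp add: subgroup.m_inv_closed)
      next
        case False
        let ?Z = "{z \<in> M. \<forall>y\<in>{x}. cmt z y \<in> N}"
        have "subgroup ?Z G" by (rule relative_centralizer(1)[OF M N nMN]) (use x in auto)
        moreover have "N \<subseteq> ?Z"
          using NM x nMN by (auto intro!: cmt_mem_normalized[OF N] intro: normalizes_mono)
        moreover have "x \<in> ?Z" using x subgroup.one_closed[OF N] by (simp add: cmt_def m_assoc)
        ultimately have "?Z = M" using all[of ?Z] False by blast
        thus ?thesis using m by blast
      qed
      have "H \<inter> M \<subseteq> N"
      proof (rule coprime_index_subset[OF subgroup_Int[OF H M] N subgroup_one M])
        show "coprime (idx (H \<inter> M) {\<one>}) (idx M N)"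
          using coprime_divisors[OF card_dvd[OF subgroup_Int[OF H M] H] dvd_refl cH] by simp
      qed (use NM subgroup.one_closed[OF H] subgroup.one_closed[OF M] subgroup.one_closed[OF N] nMN in
          \<open>auto intro: normalizes_mono\<close>)
      hence "\<exists>b\<in>M. \<forall>x\<in>H1. inv b \<otimes> x \<otimes> b \<in> N <#> H"
        using comm subset_set_mult[OF M H]
        by (intro section_conjugate_abelian[where Y = "M <#> H"] MH M N NM H H1 sub cH1 refl
              normalizes_mult normalizes_self nHM nHN nMN)
          (simp_all add: cmt_def)
      thus ?thesis by (simp add: cnj_def)
    next
      assume \<kappa>N: "\<kappa> = N"
      have cHM: "cmt h m \<in> N" if h: "h \<in> H" and m: "m \<in> M" for h m
      proof -
        have hc: "h \<in> carrier G" by (rule sub_carrier[OF H h])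
        have "acts_by_powers {cmt h m} N M"
          by (rule acts_by_powers_cmt[OF acts_by_powers_mono[OF aH] M N NM nMN hc m]) (use h in auto)
        moreover have "cmt h m \<in> M"
          unfolding cmt_eq using nHM h m M by (simp add: normalizes_def subgroup.m_closed subgroup.m_inv_closed)
        ultimately show ?thesis using \<kappa>N \<kappa>_iff by blast
      qed
      have NH: "subgroup (N <#> H) G" by (rule normalizes_set_mult(2)[OF H N nHN])
      have "normalizes M (N <#> H)"
        unfolding normalizes_def
      proof (intro ballI)
        fix m x assume m: "m \<in> M" and "x \<in> N <#> H"
        then obtain n h where nh: "n \<in> N" "h \<in> H" "x = n \<otimes> h" by (auto elim: set_multE)
        have c: "m \<in> carrier G" "n \<in> carrier G" "h \<in> carrier G"
          using m nh sub_carrier[OF N] sub_carrier[OF H] by auto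
        have "cmt m h = inv (cmt h m)" by (rule cmt_swap) (use c in auto)
        hence "cmt m h \<in> N" using cHM[OF nh(2) m] N by (simp add: subgroup.m_inv_closed)
        moreover have "cnj m n \<in> N" using nMN m nh by (simp add: normalizes_def)
        moreover have "cnj m x = (cnj m n \<otimes> cmt m h) \<otimes> h"
          using c nh by (simp add: cnj_mult cnj_eq_cmt_mult[of m h] m_assoc)
        ultimately show "cnj m x \<in> N <#> H" using nh N set_multI by (simp add: subgroup.m_closed)
      qed
      moreover have "normalizes H (N <#> H)" by (intro normalizes_product H N nHN normalizes_self)
      ultimately have nn: "normalizes (M <#> H) (N <#> H)" by (intro normalizes_mult M H NH)
      have MNH: "M <#> (N <#> H) = M <#> H" by (rule set_mult_absorb[OF M N NM H])
      have I: "subgroup (M \<inter> (N <#> H)) G" by (rule subgroup_Int[OF M NH])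
      have "idx (M <#> H) (N <#> H) = idx M (M \<inter> (N <#> H))"
        using idx_set_mult[OF M NH] MH MNH by simp
      also have "\<dots> dvd idx M N"
        using idx_chain[OF N I M] NM subset_set_mult(1)[OF N H] by (metis Int_lower1 Int_subset_iff dvd_triv_left)
      finally have "coprime (card H1) (idx (M <#> H) (N <#> H))"
        by (rule coprime_divisors[OF dvd_refl _ cH1])
      hence "H1 \<subseteq> N <#> H"
        using sub nn subgroup.one_closed[OF H1] subgroup.one_closed[OF NH] mono_set_mult[OF NM subset_refl]
        by (intro coprime_index_subset[OF H1 NH subgroup_one MH]) (auto intro: normalizes_mono)
      thus ?thesis using subgroup.one_closed[OF M] sub_carrier[OF H1]
        by (intro bexI[of _ \<one>]) (auto simp: cnj_def)
    qed
  qed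
qed

lemma hall_card_dvd:
  assumes X: "subgroup X G" and "hall \<pi> H X" "hall \<pi> H' X"
  shows "card H dvd card H'"
proof -
  have H: "subgroup H G" "H \<subseteq> X" "prime_divisors (card H) \<subseteq> \<pi>"
    and H': "subgroup H' G" "H' \<subseteq> X" "prime_divisors (idx X H') \<inter> \<pi> = {}"
    using assms by (auto simp: hall_def)
  have "card H dvd idx X H' * card H'" using card_dvd[OF H(1) X H(2)] idx_mult[OF H'(1) X H'(2)] by simp
  moreover have "coprime (card H) (idx X H')" by (rule coprime_of_disjoint(1)[OF H(3) H'(3)])
  ultimately show ?thesis by (simp add: coprime_dvd_mult_right_iff)
qed

lemma hall_card: "subgroup X G \<Longrightarrow> hall \<pi> H X \<Longrightarrow> hall \<pi> H' X \<Longrightarrow> card H = card H'"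
  using hall_card_dvd by (auto intro: dvd_antisym)

lemma hall_cnj:
  assumes X: "subgroup X G" and g: "g \<in> X" and H: "hall \<pi> H X"
  shows "hall \<pi> (cnj g ` H) X"
proof -
  have gc: "g \<in> carrier G" by (rule sub_carrier[OF X g])
  have "cnj g ` H \<subseteq> X" using H g normalizes_self[OF X] by (auto simp: hall_def normalizes_def)
  thus ?thesis using H subgroup_cnj[OF gc] card_cnj[OF gc] by (simp add: hall_def idx_def)
qed

lemma hall_trans:
  assumes X: "subgroup X G" and W: "hall \<rho> W X" and H: "hall \<pi> H W" and "\<pi> \<subseteq> \<rho>"
  shows "hall \<pi> H X"
proof -
  have "prime_divisors (idx X H) = prime_divisors (idx X W) \<union> prime_divisors (idx W H)"
    using X W H by (intro prime_divisors_idx_chain) (auto simp: hall_def)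
  thus ?thesis using assms by (auto simp: hall_def)
qed

text \<open>Along a normal series of \<open>G\<close>, conjugates of \<open>H1\<close> are brought into \<open>(N \<inter> X) H\<close>. A \<open>\<pi>\<close>-factor of the
  series does not change this product; on the other factors \<open>H\<close> and \<open>H1\<close> act by powers.\<close>

theorem hall_conjugate:
  assumes SP: "sigma_power \<sigma>" and disj: "\<And>\<tau>. \<tau> \<in> \<sigma> \<Longrightarrow> \<tau> \<noteq> \<pi> \<Longrightarrow> \<tau> \<inter> \<pi> = {}"
    and X: "subgroup X G" and H: "hall \<pi> H X" and H1: "hall \<pi> H1 X"
  shows "\<exists>g\<in>X. cnj (inv g) ` H1 = H"
proof -
  have Hs: "subgroup H G" "H \<subseteq> X" "prime_divisors (card H) \<subseteq> \<pi>" "prime_divisors (idx X H) \<inter> \<pi> = {}"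
    using H by (auto simp: hall_def)
  have H1s: "subgroup H1 G" "H1 \<subseteq> X" "prime_divisors (card H1) \<subseteq> \<pi>" using H1 by (auto simp: hall_def)
  have cX [simp]: "\<And>x. x \<in> X \<Longrightarrow> x \<in> carrier G" using sub_carrier[OF X] .
  have "sigma_series \<sigma>" using SP by (simp add: sigma_power_def)
  from this normal_one have "\<exists>g\<in>X. \<forall>x\<in>H1. cnj (inv g) x \<in> ({\<one>} \<inter> X) <#> H"
  proof (induction rule: sigma_series_induct)
    case carrier
    have "carrier G \<inter> X = X" using cX by blast
    moreover have "cnj (inv \<one>) x \<in> X <#> H" if "x \<in> H1" for x
      using that H1s(2) subset_set_mult(1)[OF X Hs(1)] sub_carrier[OF H1s(1) that]
      by (auto simp: cnj_def)
    ultimately show ?case using subgroup.one_closed[OF X] by (intro bexI[of _ \<one>]) auto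
  next
    case (step N M \<tau>)
    have Ns: "subgroup N G" "subgroup M G" using step by (auto intro: normal_imp_subgroup)
    let ?N = "N \<inter> X" and ?M = "M \<inter> X"
    have I: "subgroup ?N G" "subgroup ?M G" "?N \<subseteq> ?M"
      using Ns X step by (auto intro: subgroup_Int)
    have nX: "normalizes X ?N" "normalizes X ?M"
      using X by (simp_all add: normalizes_Int normalizes_self normal_normalizes_subset step(1,2) subgroup.subset)
    from step(6) obtain g where g: "g \<in> X" "\<And>x. x \<in> H1 \<Longrightarrow> cnj (inv g) x \<in> ?M <#> H" by auto
    let ?H1 = "cnj (inv g) ` H1"
    have "idx ?M ?N dvd idx M N"
      by (rule idx_Int_dvd[OF Ns X step(3) normal_normalizes_subset[OF step(1) subgroup.subset[OF Ns(2)]]])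
    hence iM: "prime_divisors (idx ?M ?N) \<subseteq> \<tau>" using prime_divisors_mono step(5) by blast
    have NH: "subgroup (?N <#> H) G" "subgroup (?M <#> H) G"
      using I Hs nX by (auto intro!: normalizes_set_mult(2) intro: normalizes_mono)
    show ?case
    proof (cases "\<tau> = \<pi>")
      case True
      have NM: "?N <#> H \<subseteq> ?M <#> H" using I(3) by (intro mono_set_mult) auto
      have MX: "?M <#> H \<subseteq> X" using Hs by (intro set_mult_leI X) auto
      have "idx (?M <#> H) (?N <#> H) dvd idx X (?N <#> H)"
        using idx_chain[OF NH X NM MX] by (metis dvd_triv_right)
      also have "\<dots> dvd idx X H"
        using idx_chain[OF Hs(1) NH(1) X subset_set_mult(2)[OF I(1) Hs(1)]] NM MX by (metis dvd_triv_left order_trans)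
      finally have 1: "idx (?M <#> H) (?N <#> H) dvd idx X H" .
      have MNH: "?M <#> (?N <#> H) = ?M <#> H" by (rule set_mult_absorb[OF I(2,1,3) Hs(1)])
      have J: "subgroup (?M \<inter> (?N <#> H)) G" by (rule subgroup_Int[OF I(2) NH(1)])
      have "idx (?M <#> H) (?N <#> H) = idx ?M (?M \<inter> (?N <#> H))"
        using idx_set_mult[OF I(2) NH(1)] NH(2) MNH by simp
      also have "\<dots> dvd idx ?M ?N"
        using idx_chain[OF I(1) J I(2)] I(3) subset_set_mult(1)[OF I(1) Hs(1)]
        by (metis Int_lower1 Int_subset_iff dvd_triv_left)
      finally have 2: "idx (?M <#> H) (?N <#> H) dvd idx ?M ?N" .
      have "coprime (idx ?M ?N) (idx X H)" using iM Hs(4) True by (simp add: coprime_of_disjoint)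
      with 1 2 have "?N <#> H = ?M <#> H" by (intro equal_of_coprime_indices[OF NH NM])
      thus ?thesis using g by auto
    next
      case False
      hence d: "\<tau> \<inter> \<pi> = {}" using disj step by blast
      obtain R where R: "R \<lhd> G" "prime_divisors (idx (carrier G) R) \<subseteq> \<tau>" "acts_by_powers R N M"
        by (rule sigma_powerD[OF SP step(4,1,2,3,5)])
      have act: "acts_by_powers L ?N ?M" if L: "subgroup L G" "L \<subseteq> X" "prime_divisors (card L) \<subseteq> \<pi>" for L
      proof -
        have "L \<subseteq> R"
          using R(2) d by (intro coprime_subset_normal L R(1) coprime_of_disjoint(1)[OF L(3)]) auto
        moreover have "acts_by_powers (R \<inter> X) ?N ?M"
          using step X Ns by (intro acts_by_powers_Int[OF R(3)]) (auto intro: normal_normalizes_subset)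
        ultimately show ?thesis using L(2) by (auto intro: acts_by_powers_mono)
      qed
      have gc: "inv g \<in> carrier G" "inv g \<in> X" using g X by (auto simp: subgroup.m_inv_closed)
      have h1: "hall \<pi> ?H1 X" by (rule hall_cnj[OF X gc(2) H1])
      have cop: "coprime (card L) (idx ?M ?N)" if "prime_divisors (card L) \<subseteq> \<pi>" for L
        using that iM d by (intro coprime_of_disjoint(1)[of _ \<pi>]) auto
      have "\<exists>k\<in>?M. \<forall>x\<in>?H1. cnj (inv k) x \<in> ?N <#> H"
        using h1 g(2) I Hs nX
        by (intro coprime_power_conjugate act cop) (auto simp: hall_def intro: normalizes_mono)
      then obtain k where k: "k \<in> ?M" "\<And>x. x \<in> H1 \<Longrightarrow> cnj (inv k) (cnj (inv g) x) \<in> ?N <#> H" by auto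
      have "cnj (inv (g \<otimes> k)) x \<in> ?N <#> H" if "x \<in> H1" for x
        using k(2)[OF that] k(1) g(1) sub_carrier[OF H1s(1) that] by (simp add: cnj_cnj inv_mult_group)
      thus ?thesis using g k X by (intro bexI[of _ "g \<otimes> k"]) (auto simp: subgroup.m_closed)
    qed
  qed
  moreover have "{\<one>} \<inter> X = {\<one>}" using subgroup.one_closed[OF X] by auto
  moreover have "{\<one>} <#> H = H" using sub_carrier[OF Hs(1)] by (auto simp: set_mult_def)
  ultimately obtain g where g: "g \<in> X" "cnj (inv g) ` H1 \<subseteq> H" by auto
  moreover have "card (cnj (inv g) ` H1) = card H"
    using hall_card[OF X H1 H] g card_cnj[OF _ H1s(1)] by simp
  ultimately show ?thesis using card_subset_eq[OF subgroup_finite[OF Hs(1)]] by blast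
qed

section \<open>Permutability with Hall subgroups\<close>

text \<open>Because \<open>LT\<close> is a group, \<open>|L : L \<inter> T| = |LT : T|\<close> divides \<open>|X : T|\<close>.\<close>

lemma hall_Int_of_commute:
  assumes X: "subgroup X G" and T: "hall \<tau> T X" and L: "subgroup L G" "L \<subseteq> X" and LT: "L <#> T = T <#> L"
  shows "hall \<tau> (L \<inter> T) L"
proof -
  have Ts: "subgroup T G" "T \<subseteq> X" using T by (auto simp: hall_def)
  have s: "subgroup (L <#> T) G" by (rule set_mult_subgroup[OF L(1) Ts(1) LT])
  have I: "subgroup (L \<inter> T) G" by (rule subgroup_Int[OF L(1) Ts(1)])
  have "idx L (L \<inter> T) = idx (L <#> T) T" using idx_set_mult[OF L(1) Ts(1) s] by simp
  also have "\<dots> dvd idx X T"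
    using idx_chain[OF Ts(1) s X subset_set_mult(2)[OF L(1) Ts(1)] set_mult_leI[OF X L(2) Ts(2)]]
    by (metis dvd_triv_right)
  finally have "prime_divisors (idx L (L \<inter> T)) \<subseteq> prime_divisors (idx X T)" by (rule prime_divisors_mono)
  hence "prime_divisors (idx L (L \<inter> T)) \<inter> \<tau> = {}" using T by (auto simp: hall_def)
  moreover have "prime_divisors (card (L \<inter> T)) \<subseteq> \<tau>"
    using prime_divisors_mono[OF card_dvd[OF I Ts(1)]] T by (auto simp: hall_def)
  ultimately show ?thesis using I by (simp add: hall_def)
qed

lemma hall_contains_normal:
  assumes W: "subgroup W G" and H: "hall \<pi> H W" and N: "subgroup N G" "N \<subseteq> W" "normalizes H N"
    and pN: "prime_divisors (card N) \<subseteq> \<pi>"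
  shows "N \<subseteq> H"
proof -
  have Hs: "subgroup H G" "H \<subseteq> W" using H by (auto simp: hall_def)
  have s: "subgroup (N <#> H) G" by (rule normalizes_set_mult(2)[OF Hs(1) N(1,3)])
  have sub: "H \<subseteq> N <#> H" "N <#> H \<subseteq> W"
    using subset_set_mult(2)[OF N(1) Hs(1)] set_mult_leI[OF W N(2) Hs(2)] by auto
  have "idx (N <#> H) H dvd card N"
    using idx_set_mult[OF N(1) Hs(1) s] idx_mult[OF subgroup_Int[OF N(1) Hs(1)] N(1)]
    by (metis Int_lower1 dvd_triv_left)
  moreover have "idx (N <#> H) H dvd idx W H"
    using idx_chain[OF Hs(1) s W sub] by (metis dvd_triv_right)
  moreover have "coprime (card N) (idx W H)" using pN H by (auto simp: hall_def intro: coprime_of_disjoint)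
  ultimately have "H = N <#> H" by (rule equal_of_coprime_indices[OF Hs(1) s sub(1)])
  thus ?thesis using subset_set_mult(1)[OF N(1) Hs(1)] by simp
qed

text \<open>Conjugacy provides a Hall \<open>{\<pi>,\<tau>}\<close>-subgroup \<open>W\<close> that contains the given \<open>H\<close>; let \<open>T\<close> be a Hall
  \<open>\<tau>\<close>-subgroup of \<open>W\<close>. In the notation of the structure theorem for \<open>\<tau>\<close>, the group \<open>AZ\<close> lies between
  \<open>Z\<close> and \<open>S\<close> and so is normalized by \<open>H \<subseteq> R\<close>, while \<open>Z \<inter> W\<close> is a normal \<open>\<pi>\<close>-subgroup of \<open>W\<close> and thus
  contained in \<open>H\<close>. Hence \<open>HA \<subseteq> A(Z \<inter> W)H = AH\<close>.\<close>

lemma hall_permutable_partner: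
  assumes SP: "sigma_power \<sigma>" and disj: "\<And>\<tau> \<tau>'. \<tau> \<in> \<sigma> \<Longrightarrow> \<tau>' \<in> \<sigma> \<Longrightarrow> \<tau> \<noteq> \<tau>' \<Longrightarrow> \<tau> \<inter> \<tau>' = {}"
    and \<pi>: "\<pi> \<in> \<sigma>" and \<tau>: "\<tau> \<in> \<sigma>" "\<tau> \<noteq> \<pi>" and X: "subgroup X G" and H: "hall \<pi> H X"
  obtains T where "hall \<tau> T X"
    "\<And>A a h. subgroup A G \<Longrightarrow> A \<subseteq> T \<Longrightarrow> a \<in> A \<Longrightarrow> h \<in> H \<Longrightarrow> h \<otimes> a \<in> A <#> H"
proof -
  have SS: "sigma_series \<sigma>" using SP by (simp add: sigma_power_def)
  have dpt: "\<tau> \<inter> \<pi> = {}" using disj \<tau> \<pi> by blast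
  have Hs: "subgroup H G" "H \<subseteq> X" "prime_divisors (card H) \<subseteq> \<pi>" using H by (auto simp: hall_def)
  have "\<exists>W. hall (\<pi> \<union> \<tau>) W X"
    by (rule hall_exists[OF SS _ X]) (use disj \<pi> \<tau> in blast)
  then obtain W0 where W0: "hall (\<pi> \<union> \<tau>) W0 X" by blast
  have W0s: "subgroup W0 G" using W0 by (simp add: hall_def)
  have "\<exists>H0. hall \<pi> H0 W0"
    by (rule hall_exists[OF SS _ W0s]) (use disj \<pi> in blast)
  then obtain H0 where H0: "hall \<pi> H0 W0" by blast
  have H0X: "hall \<pi> H0 X" by (rule hall_trans[OF X W0 H0]) simp
  obtain g where g: "g \<in> X" "cnj (inv g) ` H0 = H"
    using hall_conjugate[OF SP _ X H H0X] disj \<pi> by blast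
  define W where "W = cnj (inv g) ` W0"
  have ig: "inv g \<in> X" using g X by (simp add: subgroup.m_inv_closed)
  have W: "hall (\<pi> \<union> \<tau>) W X" unfolding W_def by (rule hall_cnj[OF X ig W0])
  have Ws: "subgroup W G" "W \<subseteq> X" "prime_divisors (card W) \<subseteq> \<pi> \<union> \<tau>" using W by (auto simp: hall_def)
  have HW: "H \<subseteq> W" unfolding W_def g(2)[symmetric] using H0 by (auto simp: hall_def)
  have hW: "hall \<pi> H W"
  proof -
    have "idx W H dvd idx X H" using idx_chain[OF Hs(1) Ws(1) X HW Ws(2)] by (metis dvd_triv_right)
    thus ?thesis using H HW prime_divisors_mono unfolding hall_def by blast
  qed
  have "\<exists>T. hall \<tau> T W"
    by (rule hall_exists[OF SS _ Ws(1)]) (use disj \<tau> in blast)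
  then obtain T where T: "hall \<tau> T W" by blast
  have Ts: "subgroup T G" "T \<subseteq> W" "prime_divisors (card T) \<subseteq> \<tau>" using T by (auto simp: hall_def)
  have TX: "hall \<tau> T X" by (rule hall_trans[OF X W T]) simp
  obtain Z S R where Z: "Z \<lhd> G" "S \<lhd> G" "R \<lhd> G" "Z \<subseteq> S" "prime_divisors (card Z) \<inter> \<tau> = {}"
    "prime_divisors (idx (carrier G) S) \<inter> \<tau> = {}"
    "prime_divisors (idx (carrier G) R) \<subseteq> \<tau>" "acts_by_powers R Z S"
    using sigma_power_structure[OF SP _ \<tau>(1)] disj \<tau>(1) by metis
  have Zs: "subgroup Z G" "normalizes (carrier G) Z" using Z(1) by (auto simp: normal_iff_normalizes)
  have TS: "T \<subseteq> S" by (intro coprime_subset_normal Ts Z coprime_of_disjoint(1)[OF Ts(3) Z(6)])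
  have HR: "H \<subseteq> R"
    using Z(7) dpt by (intro coprime_subset_normal Hs Z coprime_of_disjoint(1)[OF Hs(3)]) auto
  have ZW: "Z \<inter> W \<subseteq> H"
  proof (rule hall_contains_normal[OF Ws(1) hW])
    show I: "subgroup (Z \<inter> W) G" by (rule subgroup_Int[OF Zs(1) Ws(1)])
    show "normalizes H (Z \<inter> W)"
      using HW by (intro normalizes_Int normalizes_mono[OF Zs(2)] normalizes_mono[OF normalizes_self[OF Ws(1)]]
          subgroup.subset[OF Hs(1)])
    have "prime_divisors (card (Z \<inter> W)) \<subseteq> prime_divisors (card Z)"
      "prime_divisors (card (Z \<inter> W)) \<subseteq> prime_divisors (card W)"
      by (rule prime_divisors_mono[OF card_dvd[OF I Zs(1)]], blast)
        (rule prime_divisors_mono[OF card_dvd[OF I Ws(1)]], blast)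
    thus "prime_divisors (card (Z \<inter> W)) \<subseteq> \<pi>" using Z(5) Ws(3) by blast
  qed simp
  have "h \<otimes> a \<in> A <#> H" if A: "subgroup A G" "A \<subseteq> T" and a: "a \<in> A" and h: "h \<in> H" for A a h
  proof -
    have c: "h \<in> carrier G" "a \<in> carrier G" using sub_carrier Hs A a h by auto
    have AZ: "subgroup (A <#> Z) G"
      by (rule normalizes_set_mult(1)[OF A(1) Zs(1) normalizes_mono[OF Zs(2) subgroup.subset[OF A(1)]]])
    have "A <#> Z \<subseteq> S" using A TS Z by (intro set_mult_leI normal_imp_subgroup) auto
    hence "normalizes R (A <#> Z)"
      by (rule acts_by_powersD[OF Z(8) AZ subset_set_mult(2)[OF A(1) Zs(1)]])
    hence "cnj h a \<in> A <#> Z" using HR h a subset_set_mult(1)[OF A(1) Zs(1)] by (auto simp: normalizes_def)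
    then obtain a' z where z: "a' \<in> A" "z \<in> Z" "cnj h a = a' \<otimes> z" by (auto elim: set_multE)
    have zc: "a' \<in> carrier G" "z \<in> carrier G" using z sub_carrier[OF A(1)] sub_carrier[OF Zs(1)] by auto
    have w: "h \<in> W" "a \<in> W" "a' \<in> W" using h HW a z A Ts by auto
    hence "cnj h a \<in> W" using normalizes_self[OF Ws(1)] by (simp add: normalizes_def)
    moreover have "z = inv a' \<otimes> cnj h a" using z zc by simp
    ultimately have "z \<in> W" using w Ws(1) by (simp add: subgroup.m_closed subgroup.m_inv_closed)
    hence "z \<otimes> h \<in> H" using ZW z h Hs(1) by (auto simp: subgroup.m_closed)
    moreover have "h \<otimes> a = cnj h a \<otimes> h" using c by (simp add: cnj_def group_word)
    hence "h \<otimes> a = a' \<otimes> (z \<otimes> h)" using z zc c by (simp add: m_assoc)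
    ultimately show ?thesis using z set_multI by simp
  qed
  thus ?thesis using that TX by blast
qed

text \<open>The elements \<open>k\<close> of \<open>K\<close> with \<open>Hk \<subseteq> KH\<close> and \<open>Hk\<inverse> \<subseteq> KH\<close> form a subgroup. It contains a Hall
  \<open>\<tau>\<close>-subgroup of \<open>K\<close> for every \<open>\<tau>\<close>, so its index in \<open>K\<close> has no prime divisor.\<close>

theorem hall_permutes:
  assumes SP: "sigma_power \<sigma>" and part: "partition_on {p. Factorial_Ring.prime p} \<sigma>"
    and \<pi>: "\<pi> \<in> \<sigma>" and X: "subgroup X G" and H: "hall \<pi> H X" and K: "subgroup K G" "K \<subseteq> X"
    and KT: "\<And>\<tau> T. \<tau> \<in> \<sigma> \<Longrightarrow> hall \<tau> T X \<Longrightarrow> hall \<tau> (K \<inter> T) K"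
  shows "K <#> H = H <#> K"
proof -
  have disj: "\<tau> \<inter> \<tau>' = {}" if "\<tau> \<in> \<sigma>" "\<tau>' \<in> \<sigma>" "\<tau> \<noteq> \<tau>'" for \<tau> \<tau>'
    using part that by (auto simp: partition_on_def disjoint_def)
  have Hs: "subgroup H G" "H \<subseteq> X" using H by (auto simp: hall_def)
  have cK [simp]: "\<And>x. x \<in> K \<Longrightarrow> x \<in> carrier G" and cH [simp]: "\<And>x. x \<in> H \<Longrightarrow> x \<in> carrier G"
    using sub_carrier K Hs by auto
  define E where "E = {k \<in> K. \<forall>h\<in>H. h \<otimes> k \<in> K <#> H \<and> h \<otimes> inv k \<in> K <#> H}"
  have prod: "h \<otimes> (k \<otimes> k') \<in> K <#> H"
    if h: "h \<in> H" and k: "k \<in> K" "h \<otimes> k \<in> K <#> H" and k': "k' \<in> K" "\<And>h. h \<in> H \<Longrightarrow> h \<otimes> k' \<in> K <#> H" for h k k'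
  proof -
    from k(2) obtain k1 h1 where 1: "k1 \<in> K" "h1 \<in> H" "h \<otimes> k = k1 \<otimes> h1" by (auto elim: set_multE)
    from k'(2)[OF 1(2)] obtain k2 h2 where 2: "k2 \<in> K" "h2 \<in> H" "h1 \<otimes> k' = k2 \<otimes> h2" by (auto elim: set_multE)
    have "h \<otimes> (k \<otimes> k') = (h \<otimes> k) \<otimes> k'" using h k k' by (simp add: m_assoc)
    also have "\<dots> = k1 \<otimes> (h1 \<otimes> k')" using 1 k' by (simp add: m_assoc)
    also have "\<dots> = (k1 \<otimes> k2) \<otimes> h2" using 1 2 by (simp add: m_assoc)
    finally show ?thesis using 1 2 K set_multI by (simp add: subgroup.m_closed)
  qed
  have E: "subgroup E G"
  proof (rule subgroupI)
    have "\<one> \<in> E" using subset_set_mult(2)[OF K(1) Hs(1)] subgroup.one_closed[OF K(1)] by (auto simp: E_def)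
    thus "E \<noteq> {}" by blast
    show "inv k \<in> E" if "k \<in> E" for k using that K by (simp add: E_def subgroup.m_inv_closed)
    show "k \<otimes> k' \<in> E" if "k \<in> E" "k' \<in> E" for k k'
      using that K(1) prod[of _ k k'] prod[of _ "inv k'" "inv k"]
      by (simp add: E_def subgroup.m_closed subgroup.m_inv_closed inv_mult_group)
  qed (auto simp: E_def)
  have EK: "E \<subseteq> K" by (auto simp: E_def)
  have "\<exists>A. hall \<tau> A K \<and> A \<subseteq> E" if \<tau>: "\<tau> \<in> \<sigma>" for \<tau>
  proof (cases "\<tau> = \<pi>")
    case True
    have "K \<inter> H \<subseteq> E"
      using subset_set_mult(2)[OF K(1) Hs(1)] Hs(1)
      by (auto simp: E_def subgroup.m_closed subgroup.m_inv_closed subset_eq)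
    thus ?thesis using KT[OF \<pi> H] True by blast
  next
    case False
    obtain T where T: "hall \<tau> T X"
      "\<And>A a h. subgroup A G \<Longrightarrow> A \<subseteq> T \<Longrightarrow> a \<in> A \<Longrightarrow> h \<in> H \<Longrightarrow> h \<otimes> a \<in> A <#> H"
      using hall_permutable_partner[OF SP disj \<pi> \<tau> False X H] by blast
    have hK: "hall \<tau> (K \<inter> T) K" by (rule KT[OF \<tau> T(1)])
    hence A: "subgroup (K \<inter> T) G" by (simp add: hall_def)
    have "h \<otimes> a \<in> K <#> H" if "a \<in> K \<inter> T" "h \<in> H" for a h
      using T(2)[OF A _ that] mono_set_mult[of "K \<inter> T" K H H G] by auto
    hence "K \<inter> T \<subseteq> E" using subgroup.m_inv_closed[OF A] by (auto simp: E_def)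
    thus ?thesis using hK by blast
  qed
  have "idx K E = 1"
  proof (rule ccontr)
    assume "idx K E \<noteq> 1"
    then obtain p where p: "Factorial_Ring.prime p" "p dvd idx K E" using prime_factor_nat by blast
    then obtain \<tau> where \<tau>: "\<tau> \<in> \<sigma>" "p \<in> \<tau>" using part by (auto simp: partition_on_def)
    then obtain A where A: "hall \<tau> A K" "A \<subseteq> E"
      using \<open>\<And>\<tau>. \<tau> \<in> \<sigma> \<Longrightarrow> \<exists>A. hall \<tau> A K \<and> A \<subseteq> E\<close> by blast
    hence "idx K E * idx E A = idx K A" using idx_chain[of A E K] E K EK by (auto simp: hall_def)
    hence "idx K E dvd idx K A" by (metis dvd_triv_left)
    hence "p \<in> prime_divisors (idx K A)" using p by (auto simp: prime_divisors_def)
    thus False using A \<tau> by (auto simp: hall_def)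
  qed
  hence "E = K" by (rule idx_eq_1[OF E K(1) EK])
  hence "H <#> K \<subseteq> K <#> H" by (auto simp: E_def elim!: set_multE)
  from set_mult_inverse[OF Hs(1) K(1) this] show ?thesis by simp
qed

section \<open>\<open>\<sigma>\<close>-permutability\<close>

lemma Hall_subgroup_iff_hall:
  assumes X: "subgroup X G"
  shows "Hall_subgroup \<pi> H (G\<lparr>carrier := X\<rparr>) \<longleftrightarrow> hall \<pi> H X"
proof (cases "subgroup H G \<and> H \<subseteq> X")
  case True
  interpret X: finite_group "G\<lparr>carrier := X\<rparr>" by (rule finite_group_subgroup[OF X])
  have H: "subgroup H (G\<lparr>carrier := X\<rparr>)" using True subgroup_subgroup_iff[OF X] by blast
  have "card (rcosets\<^bsub>G\<lparr>carrier := X\<rparr>\<^esub> H) * card H = idx X H * card H"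
    using X.lagrange[OF H] idx_mult[of H X] True X by (simp add: order_def)
  hence "card (rcosets\<^bsub>G\<lparr>carrier := X\<rparr>\<^esub> H) = idx X H" using card_pos[of H] True by simp
  thus ?thesis using True H by (simp add: Hall_subgroup_def hall_def pi_group_def order_def)
next
  case False
  thus ?thesis by (auto simp: Hall_subgroup_def hall_def subgroup_subgroup_iff[OF X])
qed

lemma sigma_permutableD:
  assumes X: "subgroup X G" and K: "sigma_permutable \<sigma> K (G\<lparr>carrier := X\<rparr>)"
  shows "subgroup K G" "K \<subseteq> X" "\<And>\<pi> H. \<pi> \<in> \<sigma> \<Longrightarrow> hall \<pi> H X \<Longrightarrow> K <#> H = H <#> K"
  using K Hall_subgroup_iff_hall[OF X] by (auto simp: sigma_permutable_def subgroup_subgroup_iff[OF X])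

theorem sigma_power_PsigmaT:
  assumes SP: "sigma_power \<sigma>" and part: "partition_on {p. Factorial_Ring.prime p} \<sigma>" and X: "subgroup X G"
  shows "PsigmaT_group \<sigma> (G\<lparr>carrier := X\<rparr>)"
  unfolding PsigmaT_group_def
proof (intro allI impI, elim conjE)
  fix L K
  assume "sigma_permutable \<sigma> K (G\<lparr>carrier := X\<rparr>\<lparr>carrier := L\<rparr>)"
    and L': "sigma_permutable \<sigma> L (G\<lparr>carrier := X\<rparr>)"
  hence K': "sigma_permutable \<sigma> K (G\<lparr>carrier := L\<rparr>)" by simp
  note L = sigma_permutableD[OF X L']
  note K = sigma_permutableD[OF L(1) K']
  have "hall \<tau> (K \<inter> T) K" if \<tau>: "\<tau> \<in> \<sigma>" and T: "hall \<tau> T X" for \<tau> T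
  proof -
    have 1: "hall \<tau> (L \<inter> T) L" by (rule hall_Int_of_commute[OF X T L(1,2) L(3)[OF \<tau> T]])
    have "hall \<tau> (K \<inter> (L \<inter> T)) K" by (rule hall_Int_of_commute[OF L(1) 1 K(1,2) K(3)[OF \<tau> 1]])
    moreover have "K \<inter> (L \<inter> T) = K \<inter> T" using K(2) by blast
    ultimately show ?thesis by simp
  qed
  hence "K <#> H = H <#> K" if "\<pi> \<in> \<sigma>" "hall \<pi> H X" for \<pi> H
    using that K L by (intro hall_permutes[OF SP part _ X]) auto
  thus "sigma_permutable \<sigma> K (G\<lparr>carrier := X\<rparr>)"
    using L' K(1,2) L(2) unfolding sigma_permutable_def
    by (auto simp: Hall_subgroup_iff_hall[OF X] subgroup_subgroup_iff[OF X])
qed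

text \<open>One Hall subgroup is chosen for each block that meets the prime divisors of \<open>|X|\<close>. For such blocks
  the subgroups are nontrivial, so none of them is a Hall subgroup for two blocks.\<close>

lemma complete_Hall_set_exists:
  assumes S: "sigma_series \<sigma>" and part: "partition_on {p. Factorial_Ring.prime p} \<sigma>" and X: "subgroup X G"
  shows "\<exists>\<H>. complete_Hall_set \<sigma> \<H> (G\<lparr>carrier := X\<rparr>)"
proof -
  have disj: "\<tau> \<inter> \<tau>' = {}" if "\<tau> \<in> \<sigma>" "\<tau>' \<in> \<sigma>" "\<tau> \<noteq> \<tau>'" for \<tau> \<tau>'
    using part that by (auto simp: partition_on_def disjoint_def)
  have "\<exists>H. hall \<pi> H X" if "\<pi> \<in> \<sigma>" for \<pi>
    by (rule hall_exists[OF S _ X]) (use that disj in blast)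
  then obtain f where f: "\<And>\<pi>. \<pi> \<in> \<sigma> \<Longrightarrow> hall \<pi> (f \<pi>) X" by metis
  let ?H = "f ` sigma_of \<sigma> (card X)"
  have sub: "\<pi> \<in> \<sigma>" if "\<pi> \<in> sigma_of \<sigma> n" for \<pi> n using that by (simp add: sigma_of_def)
  have uniq: "\<pi>' = \<pi>" if \<pi>: "\<pi> \<in> \<sigma>" and \<pi>': "\<pi>' \<in> sigma_of \<sigma> (card X)" and h: "hall \<pi> (f \<pi>') X" for \<pi> \<pi>'
  proof (rule ccontr)
    assume ne: "\<pi>' \<noteq> \<pi>"
    have "hall \<pi>' (f \<pi>') X" using f sub \<pi>' by blast
    hence 1: "subgroup (f \<pi>') G" "f \<pi>' \<subseteq> X" "prime_divisors (card (f \<pi>')) \<subseteq> \<pi>'"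
      "prime_divisors (idx X (f \<pi>')) \<inter> \<pi>' = {}" by (auto simp: hall_def)
    hence "prime_divisors (card (f \<pi>')) = {}" using h disj[OF sub[OF \<pi>'] \<pi> ne] by (auto simp: hall_def)
    hence "prime_divisors (card X) = prime_divisors (idx X (f \<pi>'))"
      using idx_mult[OF 1(1) X 1(2)] by (metis prime_divisors_mult Un_empty_right)
    thus False using 1(4) \<pi>' by (auto simp: sigma_of_def)
  qed
  have "complete_Hall_set \<sigma> ?H (G\<lparr>carrier := X\<rparr>)"
    unfolding complete_Hall_set_def
  proof (intro conjI ballI impI)
    show "subgroup H (G\<lparr>carrier := X\<rparr>)" if "H \<in> ?H" for H
      using that f sub by (auto simp: subgroup_subgroup_iff[OF X] hall_def)
    show "\<exists>\<pi>\<in>\<sigma>. Hall_subgroup \<pi> H (G\<lparr>carrier := X\<rparr>)" if "H \<in> ?H" for H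
      using that f sub Hall_subgroup_iff_hall[OF X] by blast
    fix \<pi> assume "\<pi> \<in> sigma_of \<sigma> (order (G\<lparr>carrier := X\<rparr>))"
    hence \<pi>: "\<pi> \<in> sigma_of \<sigma> (card X)" by (simp add: order_def)
    show "\<exists>!H. H \<in> ?H \<and> Hall_subgroup \<pi> H (G\<lparr>carrier := X\<rparr>)"
      unfolding Hall_subgroup_iff_hall[OF X]
    proof (rule ex1I[of _ "f \<pi>"])
      show "f \<pi> \<in> ?H \<and> hall \<pi> (f \<pi>) X" using \<pi> f sub by blast
      show "H = f \<pi>" if "H \<in> ?H \<and> hall \<pi> H X" for H
        using that uniq[OF sub[OF \<pi>]] by blast
    qed
  qed
  thus ?thesis by blast
qed

lemma sigma_permutableI:
  assumes S: "sigma_series \<sigma>" and part: "partition_on {p. Factorial_Ring.prime p} \<sigma>" and X: "subgroup X G"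
    and K: "subgroup K G" "K \<subseteq> X" "\<And>\<pi> H. \<pi> \<in> \<sigma> \<Longrightarrow> hall \<pi> H X \<Longrightarrow> K <#> H = H <#> K"
  shows "sigma_permutable \<sigma> K (G\<lparr>carrier := X\<rparr>)"
  using K complete_Hall_set_exists[OF S part X]
  by (simp add: sigma_permutable_def subgroup_subgroup_iff[OF X] Hall_subgroup_iff_hall[OF X])

lemma sigma_soluble_series:
  assumes "sigma_soluble \<sigma> G"
  shows "sigma_series \<sigma>"
  unfolding sigma_series_def
proof (intro allI impI, elim conjE)
  fix N assume N: "N \<lhd> G" "N \<noteq> carrier G"
  interpret E: finite_epi G "G Mod N" "\<lambda>x. N #> x" by (rule quotient_epi(1)[OF N(1)])
  note ker = quotient_epi(2)[OF N(1)]
  have Ns: "subgroup N G" by (rule normal_imp_subgroup[OF N(1)])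
  \<comment> \<open>Least order makes \<open>M/N\<close> a chief factor.\<close>
  define T where "T M \<longleftrightarrow> M \<lhd> G \<and> N \<subseteq> M \<and> M \<noteq> N" for M
  have "T (carrier G)" using N Ns normal_carrier by (auto simp: T_def subgroup.subset)
  then obtain M where TM: "T M" and min: "\<And>L. T L \<Longrightarrow> card M \<le> card L"
    using ex_has_least_nat[of T "carrier G" card] by blast
  have M: "M \<lhd> G" "N \<subseteq> M" "M \<noteq> N" using TM by (auto simp: T_def)
  have Ms: "subgroup M G" by (rule normal_imp_subgroup[OF M(1)])
  have car: "carrier (G\<lparr>carrier := M\<rparr> Mod N) = (\<lambda>x. N #> x) ` M"
    by (auto simp: carrier_FactGroup r_coset_def)
  have "minimal_normal_subgroup (carrier (G\<lparr>carrier := M\<rparr> Mod N)) (G Mod N)"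
    unfolding minimal_normal_subgroup_def car
  proof (intro conjI allI impI)
    show "(\<lambda>x. N #> x) ` M \<lhd> G Mod N" by (rule E.normal_image[OF M(1)])
    show "(\<lambda>x. N #> x) ` M \<noteq> {\<one>\<^bsub>G Mod N\<^esub>}"
    proof
      assume "(\<lambda>x. N #> x) ` M = {\<one>\<^bsub>G Mod N\<^esub>}"
      hence "M \<subseteq> kernel G (G Mod N) (\<lambda>x. N #> x)"
        using sub_carrier[OF Ms] by (auto simp: kernel_def)
      thus False using M ker by auto
    qed
    fix L assume L: "L \<lhd> G Mod N \<and> L \<subseteq> (\<lambda>x. N #> x) ` M"
    have Ls: "subgroup L (G Mod N)" using L normal_imp_subgroup by blast
    have pL: "E.pre L \<lhd> G" "N \<subseteq> E.pre L" "E.pre L \<subseteq> M"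
      using L E.normal_pre E.kernel_subset_pre[OF Ls] ker E.pre_mono[of L "(\<lambda>x. N #> x) ` M"]
        E.pre_image[OF Ms] M(2) by auto
    have im: "(\<lambda>x. N #> x) ` E.pre L = L" using Ls by (simp add: E.image_pre subgroup.subset)
    show "L = {\<one>\<^bsub>G Mod N\<^esub>} \<or> L = (\<lambda>x. N #> x) ` M"
    proof (cases "E.pre L = N")
      case True
      have "card L = 1" using E.card_pre[OF Ls] card_pos[OF Ns] True by (simp add: ker)
      thus ?thesis using subgroup.one_closed[OF Ls] by (metis card_1_singletonE singletonD)
    next
      case False
      hence "card M \<le> card (E.pre L)" using pL by (intro min) (simp add: T_def)
      hence "E.pre L = M" using card_seteq[OF subgroup_finite[OF Ms] pL(3)] by simp
      thus ?thesis using im by simp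
    qed
  qed
  hence "chief_factor M N G" using M N by (simp add: chief_factor_def)
  hence "sigma_primary \<sigma> (G\<lparr>carrier := M\<rparr> Mod N)" using assms by (simp add: sigma_soluble_def)
  then obtain \<tau> where \<tau>: "\<tau> \<in> \<sigma>" "prime_divisors (card ((\<lambda>x. N #> x) ` M)) \<subseteq> \<tau>"
    unfolding sigma_primary_def pi_group_def order_def car by blast
  moreover have "card ((\<lambda>x. N #> x) ` M) = idx M N" using E.card_image[OF Ms] ker M(2) by simp
  ultimately show "\<exists>M. M \<lhd> G \<and> N \<subset> M \<and> (\<exists>\<tau>\<in>\<sigma>. prime_divisors (idx M N) \<subseteq> \<tau>)"
    using M by (intro exI[of _ M]) auto
qed

lemma hall_subset_normal:
  assumes part: "\<tau> \<inter> \<pi> = {}" and X: "subgroup X G" and H: "hall \<tau> H X" 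
    and N: "subgroup N G" "N \<subseteq> X" "normalizes X N" "prime_divisors (idx X N) \<subseteq> \<pi>"
  shows "H \<subseteq> N"
proof -
  have Hs: "subgroup H G" "H \<subseteq> X" "prime_divisors (card H) \<subseteq> \<tau>" using H by (auto simp: hall_def)
  have "coprime (card H) (idx X N)" using Hs(3) N(4) part by (intro coprime_of_disjoint(1)[of _ \<tau>]) auto
  thus ?thesis
    using Hs N subgroup.one_closed[OF Hs(1)] subgroup.one_closed[OF N(1)]
    by (intro coprime_index_subset[OF Hs(1) N(1) subgroup_one X]) (auto intro: normalizes_mono)
qed

text \<open>For \<open>R\<close> one takes all elements that normalize every subgroup between \<open>N\<close> and \<open>M\<close>; it contains
  every Hall \<open>\<tau>\<close>-subgroup for \<open>\<tau> \<noteq> \<pi>\<close>, so that its index is a \<open>\<pi>\<close>-number.\<close>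

theorem PsigmaT_sigma_power:
  assumes S: "sigma_series \<sigma>" and part: "partition_on {p. Factorial_Ring.prime p} \<sigma>"
    and PT: "PsigmaT_group \<sigma> G"
  shows "sigma_power \<sigma>"
  unfolding sigma_power_def
proof (intro conjI ballI allI impI S, elim conjE)
  fix \<pi> N M
  assume \<pi>: "\<pi> \<in> \<sigma>" and N: "N \<lhd> G" and M: "M \<lhd> G" and NM: "N \<subseteq> M" and iMN: "prime_divisors (idx M N) \<subseteq> \<pi>"
  have disj: "\<tau> \<inter> \<tau>' = {}" if "\<tau> \<in> \<sigma>" "\<tau>' \<in> \<sigma>" "\<tau> \<noteq> \<tau>'" for \<tau> \<tau>'
    using part that by (auto simp: partition_on_def disjoint_def)
  have Ns: "subgroup N G" and Ms: "subgroup M G" and Mn: "normalizes (carrier G) M"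
    using N M by (auto simp: normal_iff_normalizes)
  have MN: "normalizes M N" by (rule normal_normalizes_subset[OF N subgroup.subset[OF Ms]])
  have absorb: "A <#> B = A" "B <#> A = A" if "subgroup A G" "subgroup B G" "B \<subseteq> A" for A B
    using that set_mult_leI[OF that(1)] subset_set_mult[OF that(1,2)] subset_set_mult[OF that(2,1)] by blast+
  \<comment> \<open>A Hall \<open>\<pi>\<close>-subgroup of \<open>M\<close> supplements \<open>N\<close>, hence \<open>Q\<close>; the Hall subgroups for the other blocks
    are contained in \<open>N\<close>. So \<open>Q\<close> is \<open>\<sigma>\<close>-permutable in \<open>M\<close>.\<close>
  have perm: "Q <#> H = H <#> Q"
    if Q: "subgroup Q G" "N \<subseteq> Q" "Q \<subseteq> M" and \<tau>: "\<tau> \<in> \<sigma>" and H: "hall \<tau> H (carrier G)" for Q \<tau> H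
  proof -
    have "sigma_permutable \<sigma> M (G\<lparr>carrier := carrier G\<rparr>)"
    proof (rule sigma_permutableI[OF S part subgroup_self Ms subgroup.subset[OF Ms]])
      fix \<pi>' H' assume "hall \<pi>' H' (carrier G)"
      hence "subgroup H' G" by (simp add: hall_def)
      thus "M <#> H' = H' <#> M"
        using normalizes_commute[OF _ Ms normal_normalizes_subset[OF M subgroup.subset]] by simp
    qed
    moreover have "sigma_permutable \<sigma> Q (G\<lparr>carrier := M\<rparr>)"
    proof (rule sigma_permutableI[OF S part Ms Q(1,3)])
      fix \<pi>' H' assume \<pi>': "\<pi>' \<in> \<sigma>" and H': "hall \<pi>' H' M"
      have Hs: "subgroup H' G" "H' \<subseteq> M" "prime_divisors (idx M H') \<inter> \<pi>' = {}" using H' by (auto simp: hall_def)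
      show "Q <#> H' = H' <#> Q"
      proof (cases "\<pi>' = \<pi>")
        case True
        have NH: "subgroup (N <#> H') G"
          by (rule normalizes_set_mult(2)[OF Hs(1) Ns normalizes_mono[OF MN Hs(2)]])
        have sub: "N \<subseteq> N <#> H'" "H' \<subseteq> N <#> H'" "N <#> H' \<subseteq> M"
          using subset_set_mult[OF Ns Hs(1)] set_mult_leI[OF Ms NM Hs(2)] by auto
        have "idx M (N <#> H') dvd idx M N" "idx M (N <#> H') dvd idx M H'"
          using idx_chain[OF Ns NH Ms sub(1,3)] idx_chain[OF Hs(1) NH Ms sub(2,3)] by (metis dvd_triv_left)+
        moreover have "coprime (idx M N) (idx M H')" using coprime_of_disjoint(1)[OF iMN] Hs(3) True by simp
        ultimately have NHM: "N <#> H' = M" by (rule equal_of_coprime_indices[OF NH Ms sub(3)])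
        hence HNM: "H' <#> N = M" using normalizes_commute[OF Hs(1) Ns normalizes_mono[OF MN Hs(2)]] by simp
        have "M \<subseteq> Q <#> H'" "M \<subseteq> H' <#> Q"
          using mono_set_mult[OF Q(2) subset_refl[of H'], of G] mono_set_mult[OF subset_refl[of H'] Q(2), of G]
          by (simp_all add: NHM HNM)
        moreover have "Q <#> H' \<subseteq> M" "H' <#> Q \<subseteq> M" using Q Hs by (simp_all add: set_mult_leI[OF Ms])
        ultimately show ?thesis by blast
      next
        case False
        have "H' \<subseteq> N"
          by (rule hall_subset_normal[OF disj[OF \<pi>' \<pi> False] Ms H' Ns NM MN iMN])
        hence "H' \<subseteq> Q" using Q by blast
        thus ?thesis using absorb[OF Q(1) Hs(1)] by simp
      qed
    qed
    ultimately have "sigma_permutable \<sigma> Q (G\<lparr>carrier := carrier G\<rparr>)"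
      using PT unfolding PsigmaT_group_def by simp
    thus ?thesis using sigma_permutableD(3)[OF subgroup_self _ \<tau> H] by blast
  qed
  define R where "R = {g \<in> carrier G. \<forall>Q\<in>{Q. subgroup Q G \<and> N \<subseteq> Q \<and> Q \<subseteq> M}. \<forall>q\<in>Q. cnj g q \<in> Q}"
  have Rs: "subgroup R G" unfolding R_def by (rule common_normalizer_subgroup[OF subgroup_self]) auto
  have RA: "acts_by_powers R N M" by (auto simp: acts_by_powers_def normalizes_def R_def)
  have "R \<lhd> G"
  proof (rule normal_of_conjugate_subset[OF Rs], rule subsetI)
    fix g x assume g: "g \<in> carrier G" and x: "x \<in> cnj g ` R"
    have "acts_by_powers (cnj (inv (inv g)) ` R) N M"
      using g by (intro acts_by_powers_conjugate[OF RA _ _ subgroup_self normal_imp_normalizes[OF N] Mn])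
        (simp_all add: Rs Ns subgroup.subset)
    moreover have "x \<in> carrier G" using x g sub_carrier[OF Rs] by auto
    ultimately show "x \<in> R" using x g by (auto simp: R_def acts_by_powers_def normalizes_def)
  qed
  moreover have "prime_divisors (idx (carrier G) R) \<subseteq> \<pi>"
  proof
    fix p assume p: "p \<in> prime_divisors (idx (carrier G) R)"
    then obtain \<tau> where \<tau>: "\<tau> \<in> \<sigma>" "p \<in> \<tau>"
      using part by (auto simp: partition_on_def prime_divisors_def)
    show "p \<in> \<pi>"
    proof (rule ccontr)
      assume "p \<notin> \<pi>"
      hence ne: "\<tau> \<noteq> \<pi>" using \<tau> by blast
      have "\<exists>H. hall \<tau> H (carrier G)"
        by (rule hall_exists[OF S _ subgroup_self]) (use \<tau> disj in blast)
      then obtain H where H: "hall \<tau> H (carrier G)" by blast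
      have Hs: "subgroup H G" "prime_divisors (card H) \<subseteq> \<tau>" "prime_divisors (idx (carrier G) H) \<inter> \<tau> = {}"
        using H by (auto simp: hall_def)
      have HMs: "subgroup (H \<inter> M) G" by (rule subgroup_Int[OF Hs(1) Ms])
      have "H \<inter> M \<subseteq> N"
      proof (rule coprime_index_subset[OF HMs Ns subgroup_one Ms])
        have "prime_divisors (card (H \<inter> M)) \<subseteq> \<tau>"
          using prime_divisors_mono[OF card_dvd[OF HMs Hs(1)]] Hs(2) by auto
        moreover have "prime_divisors (idx M N) \<inter> \<tau> = {}" using iMN disj[OF \<tau>(1) \<pi> ne] by blast
        ultimately show "coprime (idx (H \<inter> M) {\<one>}) (idx M N)"
          using coprime_of_disjoint(1) by simp
      qed (use NM subgroup.one_closed[OF HMs] subgroup.one_closed[OF Ns] MN in \<open>auto intro: normalizes_mono\<close>)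
      have "H \<subseteq> R"
      proof
        fix x assume x: "x \<in> H"
        have xc: "x \<in> carrier G" by (rule sub_carrier[OF Hs(1) x])
        have "cnj x q \<in> Q" if Q: "subgroup Q G" "N \<subseteq> Q" "Q \<subseteq> M" and q: "q \<in> Q" for Q q
        proof -
          have qc: "q \<in> carrier G" by (rule sub_carrier[OF Q(1) q])
          have QH: "subgroup (Q <#> H) G" by (rule set_mult_subgroup[OF Q(1) Hs(1) perm[OF Q \<tau>(1) H]])
          have "x \<in> Q <#> H" "q \<in> Q <#> H" using subset_set_mult[OF Q(1) Hs(1)] x q by auto
          hence "cnj x q \<in> Q <#> H" using normalizes_self[OF QH] by (simp add: normalizes_def)
          then obtain q' y where y: "q' \<in> Q" "y \<in> H" "cnj x q = q' \<otimes> y" by (auto elim: set_multE)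
          have "q \<in> M" "q' \<in> M" using q y(1) Q(3) by auto
          moreover from this have "cnj x q \<in> M" using Mn xc by (simp add: normalizes_def)
          moreover have "y = inv q' \<otimes> cnj x q" using y sub_carrier[OF Q(1)] sub_carrier[OF Hs(1)] by simp
          ultimately have "y \<in> M" using Ms by (simp add: subgroup.m_closed subgroup.m_inv_closed)
          hence "y \<in> Q" using y \<open>H \<inter> M \<subseteq> N\<close> Q by blast
          thus ?thesis using y Q by (simp add: subgroup.m_closed)
        qed
        thus "x \<in> R" using xc by (simp add: R_def)
      qed
      hence "idx (carrier G) R dvd idx (carrier G) H"
        using idx_chain[OF Hs(1) Rs subgroup_self] subgroup.subset[OF Rs] by (metis dvd_triv_left)
      hence "p \<in> prime_divisors (idx (carrier G) H)" using p prime_divisors_mono by blast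
      thus False using Hs(3) \<tau> by blast
    qed
  qed
  ultimately show "\<exists>R. R \<lhd> G \<and> prime_divisors (idx (carrier G) R) \<subseteq> \<pi> \<and> acts_by_powers R N M"
    using RA by blast
qed

end

theorem corollary1p4:
  fixes \<sigma> :: "nat set set" and G :: "('a, 'b) monoid_scheme"
  assumes "partition_on {p. Factorial_Ring.prime p} \<sigma>"
    and "group G" and "finite (carrier G)"
    and "sigma_soluble \<sigma> G" and "PsigmaT_group \<sigma> G"
  shows "(\<forall>N. N \<lhd> G \<longrightarrow> PsigmaT_group \<sigma> (G Mod N)) \<and>
    (\<forall>H. subgroup H G \<longrightarrow> PsigmaT_group \<sigma> (G\<lparr>carrier := H\<rparr>))"
proof -
  interpret finite_group G
    using assms(2,3) by (simp add: finite_group_def finite_group_axioms_def)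
  have SP: "sigma_power \<sigma>"
    by (rule PsigmaT_sigma_power[OF sigma_soluble_series[OF assms(4)] assms(1,5)])
  show ?thesis
  proof (intro conjI allI impI)
    fix N assume N: "N \<lhd> G"
    interpret E: finite_epi G "G Mod N" "r_coset G N" by (rule quotient_epi(1)[OF N])
    show "PsigmaT_group \<sigma> (G Mod N)"
      using E.H.sigma_power_PsigmaT[OF E.sigma_power_epi[OF SP] assms(1) E.H.subgroup_self] by simp
  next
    fix H assume "subgroup H G"
    thus "PsigmaT_group \<sigma> (G\<lparr>carrier := H\<rparr>)" by (rule sigma_power_PsigmaT[OF SP assms(1)])
  qed
qed

end
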